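(* Let $d\ge1$. The limiting distribution $\mu$ of any exponentially uniformly ergodic probabilistic cellular automaton (PCA) on $S^{\mathbb{Z}^d}$, with $S$ a non-empty finite set, is a finitary factor of a finite-valued i.i.d. process with stretched-exponential tails; that is, there exist a finite set $T$, an i.i.d. process $Y=(Y_v)_{v\in\mathbb{Z}^d}$ taking values in $T$, and a coding $\varphi$ from $Y$ to a random field $X$ with distribution $\mu$ whose coding radius $R$ has stretched-exponential tails.
   Context: **PCA.** A PCA consists of the following data: non-empty finite sets $S$ and $A$, a probability distribution on $A$, finite sets $F,F'\subset\mathbb{Z}^d$, and a function $f:S^F\times A^{F'}\to S$. Let $(W_{v,i})_{v\in\mathbb{Z}^d,i\in\mathbb{Z}}$ be i.i.d. random variables with the given distribution on $A$. The time evolution started from $\xi\in S^{\mathbb{Z}^d}$ at time $i_0\in\mathbb{Z}$ is the process $(\omega^{\xi,i_0}_{v,i})_{v\in\mathbb{Z}^d,i\ge i_0}$ defined by $\omega^{\xi,i_0}_{v,i_0}:=\xi_v$ and $$\omega^{\xi,i_0}_{v,i+1}:=f\big((\omega^{\xi,i_0}_{v+u,i})_{u\in F},(W_{v+u,i})_{u\in F'}\big),\qquad v\in\mathbb{Z}^d,\ i\ge i_0,$$ where the same variables $(W_{v,i})$ are used for all $\xi$ and $i_0$. The PCA is ergodic if there is a probability measure $\mu$ on $S^{\mathbb{Z}^d}$ (the limiting distribution) such that for every $\xi$, the distribution of $(\omega^{\xi,0}_{v,i})_{v\in\mathbb{Z}^d}$ converges weakly to $\mu$ as $i\to\infty$.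 For $v\in\mathbb{Z}^d$ let $$\tau_v:=\min\{i\ge0:\omega^{\xi,-i}_{v,0}\text{ does not depend on the starting state }\xi\}.$$ An ergodic PCA is uniformly ergodic if $\tau_v$ is almost surely finite for all $v$, and exponentially uniformly ergodic if $\tau_v$ has exponential tails. (These notions depend on the chosen $f$ and not only on the law of the evolutions.) **Tails.** A non-negative random variable $R$ has exponential tails if there are $C,c>0$ with $\mathbb{P}(R\ge r)\le Ce^{-cr}$ for all $r\ge0$, and stretched-exponential tails if there are $C,c>0$ with $\mathbb{P}(R\ge r)\le Ce^{-r^c}$ for all $r\ge0$. **Codings.** Let $(S,\mathcal{S})$, $(T,\mathcal{T})$ be measurable spaces and let $X=(X_v)_{v\in\mathbb{Z}^d}$ and $Y=(Y_v)_{v\in\mathbb{Z}^d}$ be $S$-valued and $T$-valued stationary (translation-invariant in law) random fields. A coding from $Y$ to $X$ is a measurable function $\varphi:T^{\mathbb{Z}^d}\to S^{\mathbb{Z}^d}$ which commutes with every translation of $\mathbb{Z}^d$ and such that $\varphi(Y)$ and $X$ are identical in distribution. The coding radius $R(y)$ of $\varphi$ at $y\in T^{\mathbb{Z}^d}$ is the minimal integer $r\ge0$ such that $\varphi(y')_{\mathbf{0}}=\varphi(y)_{\mathbf{0}}$ for almost all (with respect to the law of $Y$) $y'\in T^{\mathbb{Z}^d}$ which satisfy $y'_v=y_v$ for all $\|v\|_1\le r$, with $R(y)=\infty$ if no such $r$ exists; here $\mathbf{0}$ is the origin. Write $R=R(Y)$. The coding is finitary if $R$ is almost surely finite. A probability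 measure is said to be a factor of a given type if a random field having that distribution is. *)

theory Defs
  imports "HOL-Probability.Probability"
begin

definition norm1 :: "int ^ 'd::finite \<Rightarrow> nat" where
  "norm1 v = (\<Sum>k\<in>UNIV. nat \<bar>v $ k\<bar>)"


subsection \<open>Random fields\<close>

definition field_space :: "'b measure \<Rightarrow> (int ^ 'd::finite \<Rightarrow> 'b) measure" where
  "field_space E = (\<Pi>\<^sub>M v\<in>UNIV. E)"

definition field_law :: "'w measure \<Rightarrow> 'b measure \<Rightarrow> (int ^ 'd::finite \<Rightarrow> 'w \<Rightarrow> 'b)
    \<Rightarrow> (int ^ 'd \<Rightarrow> 'b) measure" where
  "field_law N E X = distr N (field_space E) (\<lambda>x v. X v x)"

definition random_field :: "'w measure \<Rightarrow> 'b measure \<Rightarrow> (int ^ 'd::finite \<Rightarrow> 'w \<Rightarrow> 'b) \<Rightarrow> bool" where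
  "random_field N E X \<longleftrightarrow> prob_space N \<and> (\<forall>v. X v \<in> N \<rightarrow>\<^sub>M E)"

definition stationary_field :: "'w measure \<Rightarrow> 'b measure \<Rightarrow> (int ^ 'd::finite \<Rightarrow> 'w \<Rightarrow> 'b) \<Rightarrow> bool" where
  "stationary_field N E X \<longleftrightarrow> random_field N E X \<and>
     (\<forall>u. field_law N E (\<lambda>v. X (v + u)) = field_law N E X)"

definition iid_process :: "'w measure \<Rightarrow> 'b measure \<Rightarrow> ('i \<Rightarrow> 'w \<Rightarrow> 'b) \<Rightarrow> bool" where
  "iid_process N E Y \<longleftrightarrow> prob_space N \<and> prob_space.indep_vars N (\<lambda>_. E) Y UNIV \<and>
     (\<forall>j k. distr N E (Y j) = distr N E (Y k))"


subsection \<open>Tails\<close>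

text \<open>The variables whose tails are considered take values in the non-negative integers
  together with infinity. Measurability is part of the definitions because
  \<^const>\<open>measure\<close> is 0 on sets that are not measurable.\<close>

definition exponential_tails :: "'w measure \<Rightarrow> ('w \<Rightarrow> enat) \<Rightarrow> bool" where
  "exponential_tails N R \<longleftrightarrow> R \<in> N \<rightarrow>\<^sub>M count_space UNIV \<and>
     (\<exists>C>0. \<exists>c>0. \<forall>r\<ge>0::real.
        measure N {x \<in> space N. ereal r \<le> ereal_of_enat (R x)} \<le> C * exp (- c * r))"

definition stretched_exponential_tails :: "'w measure \<Rightarrow> ('w \<Rightarrow> enat) \<Rightarrow> bool" where
  "stretched_exponential_tails N R \<longleftrightarrow> R \<in> N \<rightarrow>\<^sub>M count_space UNIV \<and>
     (\<exists>C>0. \<exists>c>0. \<forall>r\<ge>0::real.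
        measure N {x \<in> space N. ereal r \<le> ereal_of_enat (R x)} \<le> C * exp (- (r powr c)))"


subsection \<open>Weak convergence\<close>

definition weakly_converges :: "'x topology \<Rightarrow> (nat \<Rightarrow> 'x measure) \<Rightarrow> 'x measure \<Rightarrow> bool" where
  "weakly_converges \<T> \<nu> \<mu> \<longleftrightarrow>
     (\<forall>g. continuous_map \<T> euclideanreal g \<and> bounded (g ` topspace \<T>) \<longrightarrow>
        (\<lambda>n. integral\<^sup>L (\<nu> n) g) \<longlonglongrightarrow> integral\<^sup>L \<mu> g)"

definition config_topology :: "(int ^ 'd::finite \<Rightarrow> 's) topology" where
  "config_topology = product_topology (\<lambda>_. discrete_topology UNIV) UNIV"


subsection \<open>Probabilistic cellular automata\<close>

text \<open>The local rule \<open>f\<close> is only ever applied to extensional functions (restricted to \<open>F\<close> and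
  \<open>F'\<close>), so it represents a map from \<open>S\<^sup>F \<times> A\<^sup>F'\<close> to \<open>S\<close>; here \<open>S\<close> and \<open>A\<close> are finite types.
  The argument \<open>w\<close> is one realization of the noise, and \<open>n\<close> counts the steps since time \<open>i0\<close>.\<close>

primrec pca_steps :: "(int ^ 'd::finite) set \<Rightarrow> (int ^ 'd) set
    \<Rightarrow> ((int ^ 'd \<Rightarrow> 's) \<Rightarrow> (int ^ 'd \<Rightarrow> 'a) \<Rightarrow> 's)
    \<Rightarrow> (int ^ 'd \<Rightarrow> int \<Rightarrow> 'a) \<Rightarrow> (int ^ 'd \<Rightarrow> 's) \<Rightarrow> int \<Rightarrow> nat \<Rightarrow> int ^ 'd \<Rightarrow> 's" where
  "pca_steps F F' f w \<xi> i0 0 = \<xi>"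
| "pca_steps F F' f w \<xi> i0 (Suc n) =
     (\<lambda>v. f (\<lambda>u\<in>F. pca_steps F F' f w \<xi> i0 n (v + u)) (\<lambda>u\<in>F'. w (v + u) (i0 + int n)))"

definition pca_evolution :: "(int ^ 'd::finite) set \<Rightarrow> (int ^ 'd) set
    \<Rightarrow> ((int ^ 'd \<Rightarrow> 's) \<Rightarrow> (int ^ 'd \<Rightarrow> 'a) \<Rightarrow> 's)
    \<Rightarrow> (int ^ 'd \<Rightarrow> int \<Rightarrow> 'a) \<Rightarrow> (int ^ 'd \<Rightarrow> 's) \<Rightarrow> int \<Rightarrow> int ^ 'd \<Rightarrow> int \<Rightarrow> 's" where
  "pca_evolution F F' f w \<xi> i0 v i = pca_steps F F' f w \<xi> i0 (nat (i - i0)) v"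

lemma pca_evolution_start: "pca_evolution F F' f w \<xi> i0 v i0 = \<xi> v"
  by (simp add: pca_evolution_def)

lemma pca_evolution_step:
  assumes "i \<ge> i0"
  shows "pca_evolution F F' f w \<xi> i0 v (i + 1) =
    f (\<lambda>u\<in>F. pca_evolution F F' f w \<xi> i0 (v + u) i) (\<lambda>u\<in>F'. w (v + u) i)"
proof -
  have "nat (i + 1 - i0) = Suc (nat (i - i0))"
    using assms by simp
  then show ?thesis
    using assms by (simp add: pca_evolution_def)
qed

definition pca_noise :: "'w measure \<Rightarrow> 'a pmf \<Rightarrow> (int ^ 'd::finite \<Rightarrow> int \<Rightarrow> 'w \<Rightarrow> 'a) \<Rightarrow> bool" where
  "pca_noise M p W \<longleftrightarrow> iid_process M (count_space UNIV) (\<lambda>(v, i). W v i) \<and>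
     (\<forall>v i. distr M (count_space UNIV) (W v i) = measure_pmf p)"

definition limiting_distribution :: "'w measure \<Rightarrow> (int ^ 'd::finite) set \<Rightarrow> (int ^ 'd) set
    \<Rightarrow> ((int ^ 'd \<Rightarrow> 's) \<Rightarrow> (int ^ 'd \<Rightarrow> 'a) \<Rightarrow> 's)
    \<Rightarrow> (int ^ 'd \<Rightarrow> int \<Rightarrow> 'w \<Rightarrow> 'a) \<Rightarrow> (int ^ 'd \<Rightarrow> 's) measure \<Rightarrow> bool" where
  "limiting_distribution M F F' f W \<mu> \<longleftrightarrow>
     prob_space \<mu> \<and> sets \<mu> = sets (field_space (count_space UNIV)) \<and>
     (\<forall>\<xi>. weakly_converges config_topology
        (\<lambda>n. field_law M (count_space UNIV)
           (\<lambda>v x. pca_evolution F F' f (\<lambda>u j. W u j x) \<xi> 0 v (int n))) \<mu>)"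

definition ergodic_pca :: "'w measure \<Rightarrow> (int ^ 'd::finite) set \<Rightarrow> (int ^ 'd) set
    \<Rightarrow> ((int ^ 'd \<Rightarrow> 's) \<Rightarrow> (int ^ 'd \<Rightarrow> 'a) \<Rightarrow> 's)
    \<Rightarrow> (int ^ 'd \<Rightarrow> int \<Rightarrow> 'w \<Rightarrow> 'a) \<Rightarrow> bool" where
  "ergodic_pca M F F' f W \<longleftrightarrow> (\<exists>\<mu>. limiting_distribution M F F' f W \<mu>)"

text \<open>The infimum of the empty set in \<^typ>\<open>enat\<close> is infinity; a non-empty infimum is attained.\<close>

definition coupling_time :: "(int ^ 'd::finite) set \<Rightarrow> (int ^ 'd) set
    \<Rightarrow> ((int ^ 'd \<Rightarrow> 's) \<Rightarrow> (int ^ 'd \<Rightarrow> 'a) \<Rightarrow> 's)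
    \<Rightarrow> (int ^ 'd \<Rightarrow> int \<Rightarrow> 'a) \<Rightarrow> int ^ 'd \<Rightarrow> enat" where
  "coupling_time F F' f w v =
     Inf {enat i | i. \<forall>\<xi> \<xi>'. pca_evolution F F' f w \<xi> (- int i) v 0 =
                             pca_evolution F F' f w \<xi>' (- int i) v 0}"

definition exponentially_uniformly_ergodic_pca ::
    "'w measure \<Rightarrow> (int ^ 'd::finite) set \<Rightarrow> (int ^ 'd) set
    \<Rightarrow> ((int ^ 'd \<Rightarrow> 's) \<Rightarrow> (int ^ 'd \<Rightarrow> 'a) \<Rightarrow> 's)
    \<Rightarrow> (int ^ 'd \<Rightarrow> int \<Rightarrow> 'w \<Rightarrow> 'a) \<Rightarrow> bool" where
  "exponentially_uniformly_ergodic_pca M F F' f W \<longleftrightarrow> ergodic_pca M F F' f W \<and>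
     (\<forall>v. exponential_tails M (\<lambda>x. coupling_time F F' f (\<lambda>u j. W u j x) v))"


subsection \<open>Codings\<close>

definition translate :: "int ^ 'd::finite \<Rightarrow> (int ^ 'd \<Rightarrow> 'b) \<Rightarrow> int ^ 'd \<Rightarrow> 'b" where
  "translate u y = (\<lambda>v. y (v + u))"

text \<open>\<open>is_coding N D Y M E X \<phi>\<close>: the map \<open>\<phi>\<close> is a coding from the \<open>D\<close>-valued field \<open>Y\<close>, defined
  on the probability space \<open>N\<close>, to the \<open>E\<close>-valued field \<open>X\<close>, defined on \<open>M\<close>.\<close>

definition is_coding :: "'v measure \<Rightarrow> 't measure \<Rightarrow> (int ^ 'd::finite \<Rightarrow> 'v \<Rightarrow> 't)
    \<Rightarrow> 'w measure \<Rightarrow> 's measure \<Rightarrow> (int ^ 'd \<Rightarrow> 'w \<Rightarrow> 's)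
    \<Rightarrow> ((int ^ 'd \<Rightarrow> 't) \<Rightarrow> int ^ 'd \<Rightarrow> 's) \<Rightarrow> bool" where
  "is_coding N D Y M E X \<phi> \<longleftrightarrow>
     stationary_field N D Y \<and> stationary_field M E X \<and>
     \<phi> \<in> field_space D \<rightarrow>\<^sub>M field_space E \<and>
     (\<forall>u. \<forall>y\<in>space (field_space D). \<phi> (translate u y) = translate u (\<phi> y)) \<and>
     field_law N E (\<lambda>v x. \<phi> (\<lambda>u. Y u x) v) = field_law M E X"

text \<open>Here \<open>\<nu>\<close> is the law of the field being coded.\<close>

definition coding_radius :: "(int ^ 'd::finite \<Rightarrow> 't) measure
    \<Rightarrow> ((int ^ 'd \<Rightarrow> 't) \<Rightarrow> int ^ 'd \<Rightarrow> 's) \<Rightarrow> (int ^ 'd \<Rightarrow> 't) \<Rightarrow> enat" where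
  "coding_radius \<nu> \<phi> y =
     Inf {enat r | r. AE y' in \<nu>. (\<forall>v. norm1 v \<le> r \<longrightarrow> y' v = y v) \<longrightarrow> \<phi> y' 0 = \<phi> y 0}"

definition finitary_coding :: "'v measure \<Rightarrow> 't measure \<Rightarrow> (int ^ 'd::finite \<Rightarrow> 'v \<Rightarrow> 't)
    \<Rightarrow> 'w measure \<Rightarrow> 's measure \<Rightarrow> (int ^ 'd \<Rightarrow> 'w \<Rightarrow> 's)
    \<Rightarrow> ((int ^ 'd \<Rightarrow> 't) \<Rightarrow> int ^ 'd \<Rightarrow> 's) \<Rightarrow> bool" where
  "finitary_coding N D Y M E X \<phi> \<longleftrightarrow> is_coding N D Y M E X \<phi> \<and>
     (AE x in N. coding_radius (field_law N D Y) \<phi> (\<lambda>v. Y v x) < \<infinity>)"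

end

theory Submission
  imports Defs
begin

text \<open>Running the automaton from the distant past shows the limiting field as a function of
  independent noise: the value at a site is read off from a space-time cone below it, as deep as the
  coupling time of that site. Call the noise variable at \<open>u\<close> and time \<open>- n\<close> the symbol of
  level \<open>n\<close> at \<open>u\<close>. There are infinitely many levels, whereas a finite-valued source
  offers a bounded number of symbols per site. But most symbols are never looked at. The symbol of
  level \<open>n\<close> at \<open>u\<close> is needed only if some site within distance \<open>L * n\<close> is
  still unresolved after \<open>n - 1\<close> levels, and by the exponential tail of the coupling time such
  \<open>u\<close> have a density of at most a polynomial in \<open>n\<close> times \<open>exp (- c * n)\<close>.

  The source therefore shows at each site its symbols of levels up to a constant \<open>n0\<close>, a ternary mark, and one
  slot for a symbol from elsewhere. Read along a coordinate axis, the marks spell labels of levels, and the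
  slots labelled \<open>n\<close> have density at least \<open>1 / (9 * n\<^sup>2)\<close>, which beats the demand
  for all \<open>n > n0\<close>. Needed symbols and slots of level \<open>n\<close> are matched along
  the axis like opening and closing parentheses, and every needed symbol is exchanged with the content of
  its slot. What is needed at level \<open>n\<close> and where it goes is decided by the marks and the lower levels;
  given these, the exchange is a fixed permutation of the other coordinates. So it preserves the
  product measure (\<open>distr_iid_adaptive_reindex\<close>, \<open>swapped_preserves\<close>), and what is visible
  after the exchanges at all levels is again independent and identically distributed
  (\<open>distr_recoded\<close>).

  Each slot serves a single level. If the levels shared a common pool of slots, then demands of a low
  level from arbitrarily far away could use up the slots near a site before a higher level is served, and no finite
  window would exclude this. With labels, a partner at distance \<open>j\<close> is recognised on the
  segment of length \<open>j\<close>.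

  Decoding goes up level by level: the lower levels tell which symbols are needed next, and their partners
  tell where to find them (\<open>decode\<close>). The distance to the partner is the time that a walk with
  negative drift, whose increments have finite-range dependence, takes to return to zero, and Hoeffding's inequality
  bounds its tail (\<open>prob_excess\<close>). A site with coupling time at most \<open>N\<close> takes at most \<open>N\<close>
  steps, each of polynomial length in \<open>N\<close>, apart from an event of probability exponentially small
  in \<open>N\<close>. Hence a window of radius \<open>N ^ 9\<close> fails with a probability that is
  exponentially small in \<open>N\<close> (\<open>prob_undecodable\<close>), which is a stretched-exponential tail.

  The coding map is not defined by this recursion. It returns the value on which all
  noise fields that produce the given source within some window agree
  (\<open>certified\<close>). Such a map is defined and equivariant on all inputs, it is measurable, and its
  coding radius is at most the radius of a window that suffices for decoding.\<close>

section \<open>Independent identically distributed coordinates\<close>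

lemma measurable_count_spaceI:
  fixes f :: "'x \<Rightarrow> 'c::countable"
  assumes "\<And>c. Measurable.pred M (\<lambda>x. f x = c)"
  shows "f \<in> M \<rightarrow>\<^sub>M count_space UNIV"
proof (rule measurable_count_space_eq_countable[THEN iffD2])
  show "f \<in> space M \<rightarrow> UNIV \<and> (\<forall>a\<in>UNIV. f -` {a} \<inter> space M \<in> sets M)"
    using assms by (auto simp: pred_def vimage_def Int_def conj_commute)
qed (auto intro: countableI_type)

lemma (in prob_space) tendsto_prob_eventually_eq:
  assumes [measurable]: "\<And>n. Measurable.pred M (A n)" "Measurable.pred M B"
    and ev: "AE x in M. eventually (\<lambda>n. A n x = B x) sequentially"
  shows "(\<lambda>n. prob {x\<in>space M. A n x}) \<longlonglongrightarrow> prob {x\<in>space M. B x}"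
proof -
  have "(\<lambda>n. \<integral>x. indicator {x\<in>space M. A n x} x \<partial>M) \<longlonglongrightarrow>
      (\<integral>x. indicator {x\<in>space M. B x} x \<partial>M :: real)"
  proof (rule integral_dominated_convergence[where w="\<lambda>_. 1"])
    show "AE x in M. (\<lambda>n. indicator {x \<in> space M. A n x} x :: real) \<longlonglongrightarrow> indicator {x \<in> space M. B x} x"
      using ev
    proof eventually_elim
      case (elim x)
      then show ?case
        by (intro tendsto_eventually, elim eventually_mono) (auto simp: indicator_def)
    qed
  qed auto
  then show ?thesis by simp
qed

definition iid :: "'b pmf \<Rightarrow> ('i \<Rightarrow> 'b) measure" where
  "iid q = (\<Pi>\<^sub>M i\<in>UNIV. measure_pmf q)"

definition depends_on :: "'i set \<Rightarrow> (('i \<Rightarrow> 'b) \<Rightarrow> 'c) \<Rightarrow> bool" where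
  "depends_on J f \<longleftrightarrow> (\<forall>\<omega> \<omega>'. (\<forall>j\<in>J. \<omega> j = \<omega>' j) \<longrightarrow> f \<omega> = f \<omega>')"

lemma depends_onI:
  "(\<And>\<omega> \<omega>'. (\<And>j. j \<in> J \<Longrightarrow> \<omega> j = \<omega>' j) \<Longrightarrow> f \<omega> = f \<omega>') \<Longrightarrow> depends_on J f"
  unfolding depends_on_def by blast

lemma depends_onD:
  "depends_on J f \<Longrightarrow> (\<And>j. j \<in> J \<Longrightarrow> \<omega> j = \<omega>' j) \<Longrightarrow> f \<omega> = f \<omega>'"
  unfolding depends_on_def by blast

lemma space_iid [simp]: "space (iid q) = UNIV"
  by (simp add: iid_def space_PiM)

lemma prob_space_iid: "prob_space (iid q)"
  unfolding iid_def by (intro prob_space_PiM measure_pmf.prob_space_axioms)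

lemma sets_iid: "sets (iid q) = sets (\<Pi>\<^sub>M i\<in>UNIV. count_space UNIV)"
  unfolding iid_def by (intro sets_PiM_cong) auto

lemma measurable_iid_component [measurable]:
  "(\<lambda>\<omega>. \<omega> i) \<in> iid q \<rightarrow>\<^sub>M count_space UNIV"
  unfolding iid_def by (rule measurable_component_singleton[where M="\<lambda>_. measure_pmf q", THEN measurable_compose]) auto

lemma measurable_to_iid:
  assumes "\<And>i. (\<lambda>x. f x i) \<in> N \<rightarrow>\<^sub>M count_space UNIV"
  shows "f \<in> N \<rightarrow>\<^sub>M iid q"
proof -
  have "(\<lambda>x i. f x i) \<in> N \<rightarrow>\<^sub>M (\<Pi>\<^sub>M i\<in>UNIV. count_space UNIV)"
    by (rule measurable_PiM_single'[where f="\<lambda>i x. f x i", OF assms]) (simp add: PiE_UNIV_domain)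
  then show ?thesis
    by (simp add: measurable_cong_sets[OF refl sets_iid])
qed

lemma sets_iid_Collect: "Measurable.pred (iid q) A \<Longrightarrow> {\<omega>. A \<omega>} \<in> sets (iid q)"
  by (simp add: pred_def)

lemma measurable_depends_on:
  fixes f :: "('i \<Rightarrow> 'b::countable) \<Rightarrow> 'c"
  assumes "finite J" and dep: "depends_on J f"
  shows "f \<in> iid q \<rightarrow>\<^sub>M count_space UNIV"
proof -
  have eq: "(\<Pi>\<^sub>M i\<in>J. count_space (UNIV::'b set)) = count_space (PiE J (\<lambda>_. UNIV))"
    using assms by (intro count_space_PiM_finite) auto
  have "(\<lambda>\<omega>. restrict \<omega> J) \<in> (\<Pi>\<^sub>M i\<in>UNIV. count_space UNIV) \<rightarrow>\<^sub>M (\<Pi>\<^sub>M i\<in>J. count_space (UNIV::'b set))"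
    by (rule measurable_restrict_subset) simp
  then have "(\<lambda>\<omega>. restrict \<omega> J) \<in> iid q \<rightarrow>\<^sub>M count_space (PiE J (\<lambda>_. UNIV))"
    by (simp add: eq measurable_cong_sets[OF sets_iid refl])
  from measurable_compose[OF this, of f "count_space UNIV"]
  have "(\<lambda>\<omega>. f (restrict \<omega> J)) \<in> iid q \<rightarrow>\<^sub>M count_space UNIV"
    by simp
  moreover have "(\<lambda>\<omega>. f (restrict \<omega> J)) = f"
    by (intro ext depends_onD[OF dep]) auto
  ultimately show ?thesis by simp
qed

lemma indep_vars_coordinates:
  "prob_space.indep_vars (iid q) (\<lambda>_. measure_pmf q) (\<lambda>i \<omega>. \<omega> i) UNIV"
proof -
  interpret prob_space "iid q :: ('a \<Rightarrow> 'b) measure" by (rule prob_space_iid)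
  have 1: "distr (iid q) (measure_pmf q) (\<lambda>\<omega>. \<omega> i) = measure_pmf q" for i :: 'a
    unfolding iid_def by (rule distr_PiM_component) (auto intro: measure_pmf.prob_space_axioms)
  show ?thesis
    by (subst indep_vars_iff_distr_eq_PiM) (auto simp: 1 iid_def[symmetric] distr_id restrict_UNIV)
qed

lemma indep_vars_depends_on:
  fixes q :: "'b pmf" and f :: "'k \<Rightarrow> ('a \<Rightarrow> 'b) \<Rightarrow> 'c"
  assumes meas: "\<And>k. k \<in> K \<Longrightarrow> f k \<in> iid q \<rightarrow>\<^sub>M count_space UNIV"
    and dep: "\<And>k. k \<in> K \<Longrightarrow> depends_on (J k) (f k)"
    and disj: "disjoint_family_on J K"
  shows "prob_space.indep_vars (iid q) (\<lambda>_. count_space UNIV) f K"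
proof -
  interpret prob_space "iid q :: ('a \<Rightarrow> 'b) measure" by (rule prob_space_iid)
  have 1: "indep_vars (\<lambda>k. PiM (J k) (\<lambda>_. measure_pmf q)) (\<lambda>k \<omega>. restrict (\<lambda>i. \<omega> i) (J k)) K"
    by (rule indep_vars_restrict[OF indep_vars_coordinates]) (use disj in auto)
  have 2: "f k \<in> PiM (J k) (\<lambda>_. measure_pmf q) \<rightarrow>\<^sub>M count_space UNIV" if k: "k \<in> K" for k
  proof -
    have "(\<lambda>\<omega> i. if i \<in> J k then \<omega> i else undefined) \<in> PiM (J k) (\<lambda>_. measure_pmf q) \<rightarrow>\<^sub>M iid q"
    proof (rule measurable_to_iid)
      fix i
      show "(\<lambda>\<omega>. if i \<in> J k then \<omega> i else undefined) \<in> PiM (J k) (\<lambda>_. measure_pmf q) \<rightarrow>\<^sub>M count_space UNIV"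
        using measurable_component_singleton[of i "J k" "\<lambda>_. measure_pmf q"]
        by (cases "i \<in> J k") (auto cong: measurable_cong_sets)
    qed
    from measurable_compose[OF this meas[OF k]]
    have "(\<lambda>\<omega>. f k (\<lambda>i. if i \<in> J k then \<omega> i else undefined)) \<in>
      PiM (J k) (\<lambda>_. measure_pmf q) \<rightarrow>\<^sub>M count_space UNIV" .
    moreover have "(\<lambda>\<omega>. f k (\<lambda>i. if i \<in> J k then \<omega> i else undefined)) = f k"
      by (intro ext depends_onD[OF dep[OF k]]) auto
    ultimately show ?thesis by simp
  qed
  have "indep_vars (\<lambda>_. count_space UNIV) (\<lambda>k \<omega>. f k (restrict (\<lambda>i. \<omega> i) (J k))) K"
    by (rule indep_vars_compose2[OF 1 2])
  moreover have "f k (restrict (\<lambda>i. \<omega> i) (J k)) = f k \<omega>" if "k \<in> K" for k \<omega>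
    by (rule depends_onD[OF dep[OF that]]) auto
  ultimately show ?thesis
    by (subst indep_vars_cong[OF refl]) auto
qed

lemma emeasure_depends_on_inter:
  fixes q :: "'b pmf" and J :: "'i set"
  assumes [measurable]: "Measurable.pred (iid q) A" "Measurable.pred (iid q) B"
    and dep: "depends_on J A" "depends_on K B" and "J \<inter> K = {}"
  shows "emeasure (iid q) {\<omega>. A \<omega> \<and> B \<omega>} = emeasure (iid q) {\<omega>. A \<omega>} * emeasure (iid q) {\<omega>. B \<omega>}"
proof -
  interpret prob_space "iid q :: ('i \<Rightarrow> 'b) measure" by (rule prob_space_iid)
  let ?f = "\<lambda>b. if b then A else B"
  have *: "indep_vars (\<lambda>_. count_space UNIV) ?f (UNIV::bool set)"
    by (rule indep_vars_depends_on[where J="\<lambda>b. if b then J else K"])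
      (use assms in \<open>auto simp: disjoint_family_on_def\<close>)
  have "prob (\<Inter>i\<in>UNIV. ?f i -` {True} \<inter> space (iid q)) = (\<Prod>i\<in>UNIV. prob (?f i -` {True} \<inter> space (iid q)))"
    by (rule indep_varsD[OF *]) auto
  also have "\<dots> = prob (?f True -` {True} \<inter> space (iid q)) * prob (?f False -` {True} \<inter> space (iid q))"
    unfolding UNIV_bool by (subst prod.insert) auto
  also have "?f True -` {True} \<inter> space (iid q) = {\<omega>. A \<omega>}"
    by auto
  also have "?f False -` {True} \<inter> space (iid q) = {\<omega>. B \<omega>}"
    by auto
  also have "(\<Inter>i\<in>UNIV. ?f i -` {True} \<inter> space (iid q)) = {\<omega>. A \<omega> \<and> B \<omega>}"
    by (simp add: set_eq_iff all_bool_eq conj_commute)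
  finally have "prob {\<omega>. A \<omega> \<and> B \<omega>} = prob {\<omega>. A \<omega>} * prob {\<omega>. B \<omega>}" .
  then show ?thesis
    by (simp add: emeasure_eq_measure ennreal_mult)
qed

lemma emeasure_iid_cylinder:
  assumes "finite B"
  shows "emeasure (iid q) {\<omega>. \<forall>i\<in>B. \<omega> i \<in> X i} = (\<Prod>i\<in>B. emeasure (measure_pmf q) (X i))"
proof -
  interpret product_prob_space "\<lambda>_. measure_pmf q" UNIV
    by unfold_locales
  show ?thesis
    using emeasure_PiM_Collect[of B X] assms by (simp add: iid_def space_PiM)
qed

lemma iid_eqI:
  fixes N :: "('i \<Rightarrow> 'b) measure"
  assumes "sets N = sets (iid q)"
    and "\<And>B X. finite B \<Longrightarrow> emeasure N {\<omega>. \<forall>i\<in>B. \<omega> i \<in> X i} = (\<Prod>i\<in>B. emeasure (measure_pmf q) (X i))"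
  shows "N = iid q"
proof -
  interpret product_prob_space "\<lambda>_::'i. measure_pmf q" UNIV
    by unfold_locales
  show ?thesis
    unfolding iid_def
  proof (rule PiM_eq)
    show "sets N = sets (\<Pi>\<^sub>M i\<in>UNIV. measure_pmf q)" using assms(1) by (simp add: iid_def)
    fix J :: "'i set" and F :: "'i \<Rightarrow> 'b set" assume "finite J"
    have "prod_emb UNIV (\<lambda>_. measure_pmf q) J (\<Pi>\<^sub>E j\<in>J. F j) = {\<omega>. \<forall>i\<in>J. \<omega> i \<in> F i}"
      by (auto simp: prod_emb_def)
    then show "emeasure N (prod_emb UNIV (\<lambda>_. measure_pmf q) J (\<Pi>\<^sub>E j\<in>J. F j)) = (\<Prod>j\<in>J. emeasure (measure_pmf q) (F j))"
      using assms(2)[OF \<open>finite J\<close>] by simp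
  qed
qed

text \<open>On a finite set \<open>B\<close> of coordinates there are only countably many possibilities for \<open>\<sigma>\<close>.
  Which of them occurs is decided by the coordinates in \<open>J\<close>. In each case the coordinates in \<open>B - J\<close> are
  read at distinct places outside \<open>J\<close>, hence are independent of the case and have the
  right product law. Summing over the cases gives the claim.\<close>

lemma distr_iid_adaptive_reindex:
  fixes \<sigma> :: "('i::countable \<Rightarrow> 'b) \<Rightarrow> 'i \<Rightarrow> 'i"
  assumes meas: "\<And>i. (\<lambda>\<omega>. \<sigma> \<omega> i) \<in> iid q \<rightarrow>\<^sub>M count_space UNIV"
    and dep: "\<And>i. depends_on J (\<lambda>\<omega>. \<sigma> \<omega> i)"
    and fixJ: "\<And>\<omega> i. i \<in> J \<Longrightarrow> \<sigma> \<omega> i = i"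
    and inj: "\<And>\<omega>. inj (\<sigma> \<omega>)"
  shows "(\<lambda>\<omega> i. \<omega> (\<sigma> \<omega> i)) \<in> iid q \<rightarrow>\<^sub>M iid q"
    and "distr (iid q) (iid q) (\<lambda>\<omega> i. \<omega> (\<sigma> \<omega> i)) = iid q"
proof -
  show T[measurable]: "(\<lambda>\<omega> i. \<omega> (\<sigma> \<omega> i)) \<in> iid q \<rightarrow>\<^sub>M iid q"
  proof (rule measurable_to_iid)
    fix i
    show "(\<lambda>\<omega>. \<omega> (\<sigma> \<omega> i)) \<in> iid q \<rightarrow>\<^sub>M count_space UNIV"
      by (rule measurable_compose_countable[OF _ meas]) measurable
  qed
  show "distr (iid q) (iid q) (\<lambda>\<omega> i. \<omega> (\<sigma> \<omega> i)) = iid q"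
  proof (rule iid_eqI)
    fix B :: "'i set" and X :: "'i \<Rightarrow> 'b set" assume B: "finite B"
    let ?Q = "emeasure (measure_pmf q)"
    \<comment> \<open>\<open>E b\<close> is the part of the event \<open>G b\<close> that is decided by \<open>J\<close>.\<close>
    define E where "E b = {\<omega>. (\<forall>i\<in>B. \<sigma> \<omega> i = b i) \<and> (\<forall>i\<in>B\<inter>J. \<omega> i \<in> X i)}" for b
    define G where "G b = {\<omega>. (\<forall>i\<in>B. \<sigma> \<omega> i = b i) \<and> (\<forall>i\<in>B. \<omega> (b i) \<in> X i)}" for b
    let ?I = "PiE B (\<lambda>_. UNIV :: 'i set)"
    have cI: "countable ?I" by (intro countable_PiE B) auto
    have m1: "Measurable.pred (iid q) (\<lambda>\<omega>. \<sigma> \<omega> i = j)" for i j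
      by (rule measurable_compose[OF meas]) simp
    have m2: "Measurable.pred (iid q) (\<lambda>\<omega>. \<omega> i \<in> A)" for i :: 'i and A :: "'b set"
      by (rule measurable_compose[OF measurable_iid_component]) simp
    have Es: "E b \<in> sets (iid q)" for b
      unfolding E_def using B by (intro sets_iid_Collect pred_intros_logic pred_intros_finite m1 m2) auto
    have Gs: "G b \<in> sets (iid q)" for b
      unfolding G_def using B by (intro sets_iid_Collect pred_intros_logic pred_intros_finite m1 m2) auto
    have EG: "emeasure (iid q) (G b) = emeasure (iid q) (E b) * (\<Prod>i\<in>B-J. ?Q (X i))" for b
    proof (cases "E b = {}")
      case True
      have "G b \<subseteq> E b"
      proof
        fix \<omega> assume w: "\<omega> \<in> G b"
        have "\<omega> i \<in> X i" if i: "i \<in> B" "i \<in> J" for i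
        proof -
          have "b i = i" using w i fixJ[OF i(2), of \<omega>] by (simp add: G_def)
          then show ?thesis using w i unfolding G_def by force
        qed
        then show "\<omega> \<in> E b" using w by (simp add: E_def G_def)
      qed
      then show ?thesis using True by simp
    next
      case False
      then obtain \<omega>0 where w: "\<And>i. i \<in> B \<Longrightarrow> \<sigma> \<omega>0 i = b i" by (auto simp: E_def)
      have bJ: "b i = i" if "i \<in> B" "i \<in> J" for i using w fixJ that by metis
      have inj_b: "inj_on b B" 
      proof (rule inj_onI)
        fix i j assume "i \<in> B" "j \<in> B" "b i = b j"
        then show "i = j" using injD[OF inj[of \<omega>0], of i j] w by simp
      qed
      have nJ: "b i \<notin> J" if i: "i \<in> B" "i \<notin> J" for i
      proof
        assume "b i \<in> J"
        then have "\<sigma> \<omega>0 (\<sigma> \<omega>0 i) = \<sigma> \<omega>0 i" using w[OF i(1)] fixJ by simp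
        then have "\<sigma> \<omega>0 i = i" using inj[of \<omega>0] by (meson injD)
        then show False using w[OF i(1)] i \<open>b i \<in> J\<close> by simp
      qed
      let ?c = "the_inv_into B b"
      have c: "?c (b i) = i" if "i \<in> B" for i using the_inv_into_f_f[OF inj_b that] .
      have "G b = {\<omega>. \<omega> \<in> E b \<and> (\<forall>i\<in>b ` (B-J). \<omega> i \<in> X (?c i))}"
      proof (rule set_eqI)
        fix \<omega>
        have "(\<forall>i\<in>B. \<omega> (b i) \<in> X i) \<longleftrightarrow> (\<forall>i\<in>B\<inter>J. \<omega> (b i) \<in> X i) \<and> (\<forall>i\<in>B-J. \<omega> (b i) \<in> X i)"
          by blast
        also have "(\<forall>i\<in>B\<inter>J. \<omega> (b i) \<in> X i) \<longleftrightarrow> (\<forall>i\<in>B\<inter>J. \<omega> i \<in> X i)"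
          using bJ by simp
        also have "(\<forall>i\<in>B-J. \<omega> (b i) \<in> X i) \<longleftrightarrow> (\<forall>i\<in>b ` (B-J). \<omega> i \<in> X (?c i))"
          using c by simp
        finally show "\<omega> \<in> G b \<longleftrightarrow> \<omega> \<in> {\<omega>. \<omega> \<in> E b \<and> (\<forall>i\<in>b ` (B-J). \<omega> i \<in> X (?c i))}"
          by (simp add: E_def G_def conj_assoc)
      qed
      also have "emeasure (iid q) \<dots> = emeasure (iid q) {\<omega>. \<omega> \<in> E b} *
          emeasure (iid q) {\<omega>. (\<forall>i\<in>b ` (B-J). \<omega> i \<in> X (?c i))}"
      proof (rule emeasure_depends_on_inter[where J=J and K="-J"])
        show "Measurable.pred (iid q) (\<lambda>\<omega>. \<omega> \<in> E b)" using Es[of b] by simp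
        show "Measurable.pred (iid q) (\<lambda>\<omega>. \<forall>i\<in>b ` (B - J). \<omega> i \<in> X (?c i))"
          using B by (intro pred_intros_finite m2) auto
        show "depends_on J (\<lambda>\<omega>. \<omega> \<in> E b)"
        proof (rule depends_onI)
          fix \<omega> \<omega>' :: "'i \<Rightarrow> 'b" assume eq: "\<And>j. j \<in> J \<Longrightarrow> \<omega> j = \<omega>' j"
          have "\<sigma> \<omega> i = \<sigma> \<omega>' i" for i by (rule depends_onD[OF dep]) (rule eq)
          then show "(\<omega> \<in> E b) = (\<omega>' \<in> E b)" by (simp add: E_def eq)
        qed
        show "depends_on (- J) (\<lambda>\<omega>. \<forall>i\<in>b ` (B - J). \<omega> i \<in> X (?c i))"
          using nJ by (auto simp: depends_on_def)
      qed auto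
      also have "emeasure (iid q) {\<omega>. (\<forall>i\<in>b ` (B-J). \<omega> i \<in> X (?c i))} = (\<Prod>i\<in>b ` (B-J). ?Q (X (?c i)))"
        by (rule emeasure_iid_cylinder) (use B in auto)
      also have "\<dots> = (\<Prod>i\<in>B-J. ?Q (X i))"
        by (subst prod.reindex) (use inj_b c in \<open>auto intro: inj_on_subset\<close>)
      finally show ?thesis by simp
    qed
    have disjE: "disjoint_family_on E ?I" "disjoint_family_on G ?I"
    proof -
      have neq: "\<exists>i\<in>B. b i \<noteq> b' i" if "b \<in> ?I" "b' \<in> ?I" "b \<noteq> b'" for b b'
        using PiE_ext[OF that(1,2)] that(3) by auto
      show "disjoint_family_on E ?I" "disjoint_family_on G ?I"
        unfolding disjoint_family_on_def
      proof (safe)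
        fix b b' \<omega> assume b: "b \<in> ?I" "b' \<in> ?I" "b \<noteq> b'"
        from neq[OF b] obtain i where i: "i \<in> B" "b i \<noteq> b' i" by blast
        show "\<omega> \<in> {}" if "\<omega> \<in> E b" "\<omega> \<in> E b'" using that i by (simp add: E_def)
        show "\<omega> \<in> {}" if "\<omega> \<in> G b" "\<omega> \<in> G b'" using that i by (simp add: G_def)
      qed
    qed
    have UE: "(\<Union>b\<in>?I. E b) = {\<omega>. \<forall>i\<in>B\<inter>J. \<omega> i \<in> X i}"
    proof (rule set_eqI)
      fix \<omega>
      have "restrict (\<sigma> \<omega>) B \<in> ?I" by auto
      moreover have "\<omega> \<in> E (restrict (\<sigma> \<omega>) B) \<longleftrightarrow> (\<forall>i\<in>B\<inter>J. \<omega> i \<in> X i)"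
        by (auto simp: E_def)
      ultimately show "\<omega> \<in> (\<Union>b\<in>?I. E b) \<longleftrightarrow> \<omega> \<in> {\<omega>. \<forall>i\<in>B\<inter>J. \<omega> i \<in> X i}"
        unfolding E_def by blast
    qed
    have UG: "(\<Union>b\<in>?I. G b) = {\<omega>. \<forall>i\<in>B. \<omega> (\<sigma> \<omega> i) \<in> X i}"
    proof (rule set_eqI)
      fix \<omega>
      have "restrict (\<sigma> \<omega>) B \<in> ?I" by auto
      moreover have "\<omega> \<in> G (restrict (\<sigma> \<omega>) B) \<longleftrightarrow> (\<forall>i\<in>B. \<omega> (\<sigma> \<omega> i) \<in> X i)"
        by (auto simp: G_def)
      moreover have "\<omega> \<in> G b \<Longrightarrow> (\<forall>i\<in>B. \<omega> (\<sigma> \<omega> i) \<in> X i)" for b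
        by (auto simp: G_def)
      ultimately show "\<omega> \<in> (\<Union>b\<in>?I. G b) \<longleftrightarrow> \<omega> \<in> {\<omega>. \<forall>i\<in>B. \<omega> (\<sigma> \<omega> i) \<in> X i}"
        by blast
    qed
    have "emeasure (distr (iid q) (iid q) (\<lambda>\<omega> i. \<omega> (\<sigma> \<omega> i))) {\<omega>. \<forall>i\<in>B. \<omega> i \<in> X i}
        = emeasure (iid q) {\<omega>. \<forall>i\<in>B. \<omega> (\<sigma> \<omega> i) \<in> X i}"
    proof (subst emeasure_distr[OF T])
      show "{\<omega>. \<forall>i\<in>B. \<omega> i \<in> X i} \<in> sets (iid q)"
        using B by (intro sets_iid_Collect pred_intros_finite m2) auto
    qed (auto simp: vimage_def)
    also have "\<dots> = (\<integral>\<^sup>+b. emeasure (iid q) (G b) \<partial>count_space ?I)"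
      unfolding UG[symmetric] using Gs cI disjE by (intro emeasure_UN_countable) auto
    also have "\<dots> = (\<integral>\<^sup>+b. emeasure (iid q) (E b) \<partial>count_space ?I) * (\<Prod>i\<in>B-J. ?Q (X i))"
      unfolding EG by (rule nn_integral_multc) auto
    also have "(\<integral>\<^sup>+b. emeasure (iid q) (E b) \<partial>count_space ?I) = emeasure (iid q) {\<omega>. \<forall>i\<in>B\<inter>J. \<omega> i \<in> X i}"
      unfolding UE[symmetric] using Es cI disjE by (intro emeasure_UN_countable[symmetric]) auto
    also have "\<dots> = (\<Prod>i\<in>B\<inter>J. ?Q (X i))"
      by (rule emeasure_iid_cylinder) (use B in auto)
    also have "\<dots> * (\<Prod>i\<in>B-J. ?Q (X i)) = (\<Prod>i\<in>B. ?Q (X i))"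
      using prod.Int_Diff[OF B, of "\<lambda>i. ?Q (X i)" J] by simp
    finally show "emeasure (distr (iid q) (iid q) (\<lambda>\<omega> i. \<omega> (\<sigma> \<omega> i))) {\<omega>. \<forall>i\<in>B. \<omega> i \<in> X i}
        = (\<Prod>i\<in>B. ?Q (X i))" .
  qed simp
qed

lemma distr_iid_reindex:
  assumes "inj f"
  shows "distr (iid q) (iid q) (\<lambda>\<omega> i. \<omega> (f i)) = iid q"
  using distr_PiM_reindex[of UNIV "\<lambda>_. measure_pmf q" f UNIV] assms
  by (simp add: iid_def measure_pmf.prob_space_axioms restrict_UNIV)

lemma distr_iid_map: "distr (iid q) (iid (map_pmf g q)) (\<lambda>\<omega> i. g (\<omega> i)) = iid (map_pmf g q)"
proof (rule iid_eqI)
  have meas: "(\<lambda>\<omega> i. g (\<omega> i)) \<in> iid q \<rightarrow>\<^sub>M iid (map_pmf g q)"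
    by (rule measurable_to_iid) (rule measurable_compose[OF measurable_iid_component], simp)
  fix B :: "'a set" and X assume B: "finite B"
  have "{\<omega>. \<forall>i\<in>B. \<omega> i \<in> X i} \<in> sets (iid (map_pmf g q))"
    using B by (intro sets_iid_Collect pred_intros_finite measurable_compose[OF measurable_iid_component]) auto
  then have "emeasure (distr (iid q) (iid (map_pmf g q)) (\<lambda>\<omega> i. g (\<omega> i))) {\<omega>. \<forall>i\<in>B. \<omega> i \<in> X i} =
      emeasure (iid q) {\<omega>. \<forall>i\<in>B. \<omega> i \<in> g -` X i}"
    by (subst emeasure_distr[OF meas]) (auto simp: vimage_def)
  also have "\<dots> = (\<Prod>i\<in>B. emeasure (measure_pmf q) (g -` X i))"
    by (rule emeasure_iid_cylinder[OF B])
  finally show "emeasure (distr (iid q) (iid (map_pmf g q)) (\<lambda>\<omega> i. g (\<omega> i))) {\<omega>. \<forall>i\<in>B. \<omega> i \<in> X i} =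
      (\<Prod>i\<in>B. emeasure (measure_pmf (map_pmf g q)) (X i))"
    by (simp add: emeasure_map_pmf)
qed simp

section \<open>Geometry of the lattice\<close>

lemma norm1_triangle: "norm1 (u + v) \<le> norm1 u + norm1 v"
  unfolding norm1_def sum.distrib[symmetric] by (intro sum_mono) (auto simp: nat_add_distrib)

lemma norm1_minus [simp]: "norm1 (- v) = norm1 v"
  by (simp add: norm1_def)

lemma norm1_minus_commute: "norm1 (u - v) = norm1 (v - u)"
  using norm1_minus[of "u - v"] by simp

lemma norm1_triangle_diff: "norm1 (u - w) \<le> norm1 (u - v) + norm1 (v - w)"
  using norm1_triangle[of "u - v" "v - w"] by simp

lemma norm1_axis [simp]: "norm1 (axis k c) = nat \<bar>c\<bar>"
  unfolding norm1_def axis_def by (subst sum.remove[of _ k]) auto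

lemma finite_card_norm1_ball:
  fixes v :: "int ^ 'd::finite"
  shows "finite {u. norm1 (u - v) \<le> r}" and "card {u. norm1 (u - v) \<le> r} \<le> (2 * r + 1) ^ CARD('d)"
proof -
  let ?B = "{u. norm1 (u - v) \<le> r}" and ?P = "PiE (UNIV :: 'd set) (\<lambda>_. {- int r..int r})"
  let ?f = "\<lambda>u. vec_nth (u - v)"
  have sub: "?f ` ?B \<subseteq> ?P"
  proof (rule image_subsetI)
    fix u assume u: "u \<in> ?B"
    have "(u - v) $ i \<in> {- int r..int r}" for i
    proof -
      have "nat \<bar>(u - v) $ i\<bar> \<le> norm1 (u - v)"
        unfolding norm1_def by (rule member_le_sum) auto
      then show ?thesis using u by auto
    qed
    then show "vec_nth (u - v) \<in> ?P" unfolding PiE_UNIV_domain by blast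
  qed
  have fin: "finite ?P" by (intro finite_PiE) auto
  have inj: "inj_on ?f ?B" by (auto simp: inj_on_def vec_eq_iff fun_eq_iff)
  show "finite ?B" using finite_subset[OF sub fin] inj by (rule finite_imageD)
  have "card ?B \<le> card ?P" using card_inj_on_le[OF inj sub fin] .
  also have "\<dots> = (2 * r + 1) ^ CARD('d)"
    by (subst card_PiE) (auto simp: nat_add_distrib nat_mult_distrib)
  finally show "card ?B \<le> (2 * r + 1) ^ CARD('d)" .
qed

definition fwd :: "'d \<Rightarrow> int ^ 'd::finite \<Rightarrow> nat \<Rightarrow> int ^ 'd" where
  "fwd k u i = u + axis k (int i)"

lemma fwd_0 [simp]: "fwd k u 0 = u"
  by (simp add: fwd_def axis_def vec_eq_iff)

lemma fwd_fwd: "fwd k (fwd k u i) j = fwd k u (i + j)"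
  by (simp add: fwd_def axis_def vec_eq_iff)

lemma fwd_add: "fwd k (u + v) i = fwd k u i + v"
  by (simp add: fwd_def)

lemma norm1_fwd: "norm1 (fwd k u i - u) = i"
  by (simp add: fwd_def)

lemma norm1_fwd_fwd: "norm1 (fwd k u i - fwd k u j) = nat \<bar>int i - int j\<bar>"
proof -
  have "fwd k u i - fwd k u j = axis k (int i - int j)"
    by (simp add: fwd_def axis_def vec_eq_iff)
  then show ?thesis by simp
qed

lemma norm1_fwd_le: "norm1 (fwd k u i) \<le> norm1 u + i"
  using norm1_triangle[of "u" "axis k (int i)"] by (simp add: fwd_def)

lemma fwd_eq_fwd:
  assumes "fwd k u i = fwd k u' i'" "i' \<le> i"
  shows "u' = fwd k u (i - i')"
proof -
  have "u' = u + (axis k (int i) - axis k (int i'))"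
    using assms by (simp add: fwd_def algebra_simps)
  also have "axis k (int i) - axis k (int i') = axis k (int (i - i'))"
    using assms(2) by (simp add: axis_def vec_eq_iff)
  finally show ?thesis by (simp add: fwd_def)
qed

section \<open>Parenthesis matching along a line\<close>

text \<open>Read along the axis \<open>k\<close>, a site with demand \<open>D\<close> is an opening parenthesis and a site with
  a free slot \<open>E\<close> a closing one; at a site that is both, the opening one comes first. The excess is
  the number of parentheses still open.\<close>

definition excess :: "'d \<Rightarrow> (int ^ 'd::finite \<Rightarrow> bool) \<Rightarrow> (int ^ 'd \<Rightarrow> bool) \<Rightarrow> int ^ 'd \<Rightarrow> nat \<Rightarrow> int" where
  "excess k D E u j = (\<Sum>i\<le>j. of_bool (D (fwd k u i)) - of_bool (E (fwd k u i)))"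

definition partner :: "'d \<Rightarrow> (int ^ 'd::finite \<Rightarrow> bool) \<Rightarrow> (int ^ 'd \<Rightarrow> bool) \<Rightarrow> int ^ 'd \<Rightarrow> nat \<Rightarrow> bool" where
  "partner k D E u j \<longleftrightarrow> D u \<and> excess k D E u j \<le> 0 \<and> (\<forall>i<j. excess k D E u i > 0)"

lemma excess_Suc:
  "excess k D E u (Suc j) = excess k D E u j + of_bool (D (fwd k u (Suc j))) - of_bool (E (fwd k u (Suc j)))"
  by (simp add: excess_def)

lemma excess_add:
  "excess k D E u (i + Suc j) = excess k D E u i + excess k D E (fwd k u (Suc i)) j"
  by (induction j) (simp_all add: excess_def fwd_fwd)

text \<open>The walk moves by at most one per site, so it cannot jump over zero, and its first step to zero
  is a closing parenthesis.\<close>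

lemma partner_free:
  assumes "partner k D E u j"
  shows "E (fwd k u j)" and "excess k D E u j = 0"
proof -
  have "E (fwd k u j) \<and> excess k D E u j = 0"
  proof (cases j)
    case 0
    then show ?thesis using assms by (auto simp: partner_def excess_def split: if_splits)
  next
    case (Suc i)
    then have "excess k D E u i > 0" "excess k D E u (Suc i) \<le> 0"
      using assms by (auto simp: partner_def)
    then show ?thesis unfolding Suc excess_Suc by (auto simp: of_bool_def split: if_splits)
  qed
  then show "E (fwd k u j)" "excess k D E u j = 0" by auto
qed

lemma partner_unique:
  assumes "partner k D E u j" "partner k D E u j'"
  shows "j = j'"
  using assms unfolding partner_def by (metis linorder_neqE_nat not_less)

text \<open>If two demanding sites had the same partner, the walk started from the left one would already have
  returned to zero just before the right one.\<close>

lemma partner_inj: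
  assumes p: "partner k D E u j" "partner k D E u' j'" and eq: "fwd k u j = fwd k u' j'"
  shows "u = u' \<and> j = j'"
proof -
  have *: "u = u'" if p: "partner k D E u j" "partner k D E u' j'"
    and eq: "fwd k u j = fwd k u' j'" and "j' \<le> j" for u u' j j'
  proof (cases "j' = j")
    case True
    then show ?thesis using eq by (simp add: fwd_def)
  next
    case False
    define i where "i = j - j' - 1"
    have j: "j = i + Suc j'" "i < j" using False \<open>j' \<le> j\<close> by (auto simp: i_def)
    have "u' = fwd k u (Suc i)"
      using fwd_eq_fwd[OF eq \<open>j' \<le> j\<close>] j by simp
    then have "excess k D E u j = excess k D E u i + excess k D E u' j'"
      using excess_add[of k D E u i j'] j by simp
    then have "excess k D E u i = 0"
      using partner_free(2)[OF p(1)] partner_free(2)[OF p(2)] by simp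
    then show ?thesis using p(1) j(2) by (auto simp: partner_def)
  qed
  have "u = u'"
    using *[OF p eq] *[OF p(2,1) eq[symmetric]] by (cases "j' \<le> j") auto
  then show ?thesis using partner_unique p by blast
qed

lemma partner_exists:
  assumes "D u" "excess k D E u r \<le> 0"
  shows "\<exists>j\<le>r. partner k D E u j"
proof -
  let ?j = "LEAST j. excess k D E u j \<le> 0"
  have "excess k D E u ?j \<le> 0" by (rule LeastI[of _ r]) (rule assms)
  moreover have "?j \<le> r" by (rule Least_le) (rule assms)
  moreover have "excess k D E u i > 0" if "i < ?j" for i
    using not_less_Least[OF that] by simp
  ultimately show ?thesis using assms(1) unfolding partner_def by blast
qed

lemma excess_cong:
  assumes "\<And>i. i \<le> j \<Longrightarrow> D (fwd k u i) = D' (fwd k u i)" "\<And>i. i \<le> j \<Longrightarrow> E (fwd k u i) = E' (fwd k u i)"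
  shows "excess k D E u j = excess k D' E' u j"
  unfolding excess_def using assms by (intro sum.cong) auto

text \<open>The segment up to the partner decides who the partner is. This locality is why the decoding
  radius is governed by the matching distance.\<close>

lemma partner_cong:
  assumes "\<And>i. i \<le> j \<Longrightarrow> D (fwd k u i) = D' (fwd k u i)" "\<And>i. i \<le> j \<Longrightarrow> E (fwd k u i) = E' (fwd k u i)"
  shows "partner k D E u j = partner k D' E' u j"
proof -
  have "excess k D E u i = excess k D' E' u i" if "i \<le> j" for i
    by (rule excess_cong) (use assms that in auto)
  moreover have "D u = D' u" using assms(1)[of 0] by simp
  ultimately show ?thesis unfolding partner_def by auto
qed

lemma excess_translate:
  "excess k (\<lambda>x. D (x + v)) (\<lambda>x. E (x + v)) u j = excess k D E (u + v) j"
  by (simp add: excess_def fwd_add)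

lemma partner_translate:
  "partner k (\<lambda>x. D (x + v)) (\<lambda>x. E (x + v)) u j = partner k D E (u + v) j"
  by (simp add: partner_def excess_translate)

section \<open>Labels for the levels\<close>

text \<open>Level \<open>n\<close> is written with about \<open>log 2 n\<close> binary digits, so that uniform ternary marks (two digits
  and an end mark) spell it with a probability that is only polynomially small in \<open>n\<close>. The tail
  bound relies on this: a label that is exponentially unlikely would push the
  partners exponentially far away.\<close>

fun binary_digits :: "nat \<Rightarrow> bool list" where
  "binary_digits n = (if n = 0 then [] else odd n # binary_digits (n div 2))"

declare binary_digits.simps [simp del]

lemma binary_digits_inj: "binary_digits m = binary_digits n \<Longrightarrow> m = n"
proof (induction m arbitrary: n rule: binary_digits.induct)
  case (1 m)
  show ?case
  proof (cases "m = 0")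
    case True
    then show ?thesis using "1.prems" by (subst (asm) (1 2) binary_digits.simps) (auto split: if_splits)
  next
    case False
    then have "n \<noteq> 0" using "1.prems" by (subst (asm) (1 2) binary_digits.simps) (auto split: if_splits)
    then have "odd m = odd n" "binary_digits (m div 2) = binary_digits (n div 2)"
      using "1.prems" False by (subst (asm) (1 2) binary_digits.simps, simp)+
    then show ?thesis using "1.IH"[OF False] by (metis bit_eq_rec)
  qed
qed

lemma length_binary_digits_le: "length (binary_digits n) \<le> n"
proof (induction n rule: binary_digits.induct)
  case (1 n)
  show ?case
  proof (cases "n = 0")
    case False
    then have "length (binary_digits (n div 2)) \<le> n div 2" using 1 by simp
    moreover have "n div 2 < n" using False by simp
    ultimately show ?thesis using False by (subst binary_digits.simps) simp
  qed (simp add: binary_digits.simps)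
qed

lemma three_power_length_binary_digits: "0 < n \<Longrightarrow> 3 ^ length (binary_digits n) \<le> 3 * n\<^sup>2"
proof (induction n rule: binary_digits.induct)
  case (1 n)
  have b: "binary_digits n = odd n # binary_digits (n div 2)" using 1 by (subst binary_digits.simps) simp
  show ?case
  proof (cases "n div 2 = 0")
    case True
    then have "n = 1" using 1 by auto
    then show ?thesis by (simp add: binary_digits.simps)
  next
    case False
    then have "3 ^ length (binary_digits (n div 2)) \<le> 3 * (n div 2)\<^sup>2" using 1 by simp
    moreover have "(2 * (n div 2))\<^sup>2 \<le> n\<^sup>2" by (intro power_mono) auto
    ultimately have "3 ^ length (binary_digits n) \<le> 9 * (n div 2)\<^sup>2" "4 * (n div 2)\<^sup>2 \<le> n\<^sup>2"
      by (simp_all add: b power_mult_distrib)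
    then show ?thesis by linarith
  qed
qed

definition label :: "nat \<Rightarrow> bool option list" where
  "label n = map Some (binary_digits n) @ [None]"

lemma length_label: "length (label n) \<le> n + 1"
  using length_binary_digits_le[of n] by (simp add: label_def)

lemma three_power_length_label: "0 < n \<Longrightarrow> 3 ^ length (label n) \<le> 9 * n\<^sup>2"
  using three_power_length_binary_digits[of n] by (simp add: label_def)

text \<open>The end mark occurs in a label at the last position only, so the marks determine the length of the label that
  they spell. Hence a site carries at most one label.\<close>

lemma label_prefix_free:
  assumes "\<And>i. i < length (label m) \<Longrightarrow> x i = label m ! i" "\<And>i. i < length (label n) \<Longrightarrow> x i = label n ! i"
  shows "m = n"
proof -
  have end_le: "length (binary_digits n) \<le> length (binary_digits m)"
    if "\<And>i. i < length (label m) \<Longrightarrow> x i = label m ! i" "\<And>i. i < length (label n) \<Longrightarrow> x i = label n ! i" for m n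
  proof (rule ccontr)
    assume "\<not> ?thesis"
    then have "x (length (binary_digits m)) = None" "x (length (binary_digits m)) \<noteq> None"
      using that(1)[of "length (binary_digits m)"] that(2)[of "length (binary_digits m)"]
      by (auto simp: label_def nth_append)
    then show False by simp
  qed
  have len: "length (binary_digits m) = length (binary_digits n)"
    using end_le[OF assms] end_le[OF assms(2,1)] by simp
  have "binary_digits m = binary_digits n"
  proof (rule nth_equalityI[OF len])
    fix i assume i: "i < length (binary_digits m)"
    then show "binary_digits m ! i = binary_digits n ! i"
      using assms(1)[of i] assms(2)[of i] len by (simp add: label_def nth_append)
  qed
  then show ?thesis by (rule binary_digits_inj)
qed

section \<open>Tail estimates\<close>

text \<open>For \<open>t = s ^ 20\<close> the bound at \<open>N = \<lfloor>s\<^sup>2\<rfloor>\<close> applies, since \<open>N ^ 9 \<le> s ^ 18 < t\<close>, and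
  \<open>a * N\<close> exceeds \<open>s\<close> as soon as \<open>s\<close> is large. Small \<open>t\<close> are absorbed by the constant.\<close>

lemma stretched_exponential_tailsI:
  fixes R :: "'w \<Rightarrow> enat"
  assumes "prob_space M" and [measurable]: "R \<in> M \<rightarrow>\<^sub>M count_space UNIV"
    and A: "0 < A" and a: "0 < a"
    and tail: "\<And>N. N1 \<le> N \<Longrightarrow> measure M {x\<in>space M. enat (N ^ 9) < R x} \<le> A * exp (- a * real N)"
  shows "stretched_exponential_tails M R"
proof -
  interpret prob_space M by fact
  \<comment> \<open>Beyond \<open>s0\<close> both \<open>N1 \<le> N\<close> and \<open>s \<le> a * N\<close> hold for the \<open>N\<close> chosen below.\<close>
  define s0 where "s0 = 2 + 1 / a + real N1"
  have main: "prob {x\<in>space M. ereal t \<le> ereal_of_enat (R x)} \<le> (A + exp s0) * exp (- (t powr (1 / 20)))"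
    if t: "0 \<le> t" for t
  proof (cases "t powr (1 / 20) < s0")
    case True
    have "prob {x\<in>space M. ereal t \<le> ereal_of_enat (R x)} \<le> exp s0 * exp (- s0)"
      by (simp flip: exp_add)
    also have "\<dots> \<le> (A + exp s0) * exp (- (t powr (1 / 20)))"
      using A True by (intro mult_mono) auto
    finally show ?thesis .
  next
    case False
    define s where "s = t powr (1 / 20)"
    have s: "s0 \<le> s" using False by (simp add: s_def)
    have s1: "1 < s" using s a unfolding s0_def by (smt (verit) divide_pos_pos of_nat_0_le_iff)
    then have "t \<noteq> 0" by (auto simp: s_def)
    then have ts: "t = s ^ 20" using t by (simp add: s_def powr_powr flip: powr_realpow)
    define N where "N = nat \<lfloor>s\<^sup>2\<rfloor>"
    have s2: "s < s\<^sup>2" using s1 by (simp add: power2_eq_square)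
    have N: "real N \<le> s\<^sup>2" "s\<^sup>2 - 1 < real N" 
    proof -
      have "real N = of_int \<lfloor>s\<^sup>2\<rfloor>" by (simp add: N_def)
      then show "real N \<le> s\<^sup>2" "s\<^sup>2 - 1 < real N" by linarith+
    qed
    have "real N1 \<le> s - 1" using s a unfolding s0_def by (smt (verit) divide_pos_pos)
    then have N1: "N1 \<le> N" using N(2) s2 by linarith
    have "real (N ^ 9) \<le> (s\<^sup>2) ^ 9" unfolding of_nat_power by (rule power_mono[OF N(1)]) simp
    also have "\<dots> < t" unfolding ts power_mult[symmetric] using s1 by (intro power_strict_increasing) auto
    finally have Nt: "real (N ^ 9) < t" .
    have "prob {x\<in>space M. ereal t \<le> ereal_of_enat (R x)} \<le> prob {x\<in>space M. enat (N ^ 9) < R x}"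
    proof (rule finite_measure_mono)
      show "{x \<in> space M. enat (N ^ 9) < R x} \<in> events" by measurable
      show "{x \<in> space M. ereal t \<le> ereal_of_enat (R x)} \<subseteq> {x \<in> space M. enat (N ^ 9) < R x}"
      proof safe
        fix x assume le: "ereal t \<le> ereal_of_enat (R x)"
        show "enat (N ^ 9) < R x"
        proof (cases "R x")
          case (enat m)
          then have "real (N ^ 9) < real m" using Nt le by (simp del: of_nat_power)
          then have "N ^ 9 < m" by (simp only: of_nat_less_iff)
          then show ?thesis using enat by simp
        qed simp
      qed
    qed
    also have "\<dots> \<le> A * exp (- a * real N)" by (rule tail[OF N1])
    also have "\<dots> \<le> A * exp (- s)"
    proof -
      have "1 / a \<le> s - 1" using s unfolding s0_def by simp
      then have "1 \<le> (s - 1) * a" using a by (simp add: field_simps)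
      then have "1 * s \<le> (s - 1) * a * s" using s1 by (intro mult_right_mono) auto
      also have "\<dots> \<le> a * (s\<^sup>2 - 1)"
      proof -
        have "0 \<le> a * (s - 1)" using a s1 by simp
        then show ?thesis by (simp add: algebra_simps power2_eq_square)
      qed
      also have "\<dots> \<le> a * real N" using N(2) a by (intro mult_left_mono) auto
      finally show ?thesis using A by simp
    qed
    also have "\<dots> \<le> (A + exp s0) * exp (- s)" by (intro mult_right_mono) auto
    finally show ?thesis by (simp add: s_def)
  qed
  have "0 < A + exp s0" using A by (simp add: add_pos_pos)
  then show ?thesis
    unfolding stretched_exponential_tails_def using main assms(2)
    by (intro conjI exI[of _ "A + exp s0"] exI[of _ "1 / 20 :: real"]) auto
qed

text \<open>The left-hand side is the union bound for the density of needed symbols of level \<open>n\<close>, the right-hand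
  side is half of the guaranteed density of slots.\<close>

lemma exponential_beats_polynomial:
  fixes C c :: real
  assumes "0 < c" "0 \<le> C"
  shows "\<exists>n0. \<forall>n>n0. real ((2 * (L * n) + 1) ^ d) * (C * exp (- c * (n - 1))) \<le> 1 / (18 * (real n)\<^sup>2)"
proof -
  let ?K = "18 * real (2 * L + 1) ^ d * C * exp c / c ^ (d + 2)"
  have "filterlim (\<lambda>n. c * real n) at_top sequentially"
    using assms by (intro filterlim_tendsto_pos_mult_at_top[OF tendsto_const]) (auto intro: filterlim_real_sequentially)
  from filterlim_compose[OF tendsto_power_div_exp_0 this]
  have "(\<lambda>n. ?K * ((c * real n) ^ (d + 2) / exp (c * real n))) \<longlonglongrightarrow> ?K * 0"
    by (intro tendsto_intros)
  then have "eventually (\<lambda>n. ?K * ((c * real n) ^ (d + 2) / exp (c * real n)) < 1) sequentially"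
    by (intro order_tendstoD(2)[of _ 0]) auto
  then obtain n1 where n1: "\<And>n. n1 \<le> n \<Longrightarrow> ?K * ((c * real n) ^ (d + 2) / exp (c * real n)) < 1"
    by (auto simp: eventually_sequentially)
  have "real ((2 * (L * n) + 1) ^ d) * (C * exp (- c * (n - 1))) \<le> 1 / (18 * (real n)\<^sup>2)" if n: "n > n1" for n
  proof -
    have npos: "0 < real n" using n by simp
    have "2 * (L * n) + 1 \<le> (2 * L + 1) * n" using n by (simp add: algebra_simps)
    then have "real (2 * (L * n) + 1) \<le> real ((2 * L + 1) * n)" by (rule of_nat_mono)
    then have "real (2 * (L * n) + 1) ^ d \<le> real ((2 * L + 1) * n) ^ d" by (rule power_mono) simp
    then have "real ((2 * (L * n) + 1) ^ d) \<le> real (2 * L + 1) ^ d * real n ^ d"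
      by (simp only: of_nat_power of_nat_mult power_mult_distrib)
    moreover have e: "exp (- c * (n - 1)) = exp c / exp (c * real n)"
      using n by (simp add: of_nat_diff algebra_simps flip: exp_diff)
    ultimately have "real ((2 * (L * n) + 1) ^ d) * (C * exp (- c * (n - 1))) \<le>
        (real (2 * L + 1) ^ d * real n ^ d) * (C * (exp c / exp (c * real n)))"
      unfolding e using assms(2) by (intro mult_right_mono) auto
    also have "\<dots> = (?K * ((c * real n) ^ (d + 2) / exp (c * real n))) * (1 / (18 * (real n)\<^sup>2))"
      using assms npos by (simp add: power_mult_distrib power_add power2_eq_square)
    also have "\<dots> \<le> 1 * (1 / (18 * (real n)\<^sup>2))"
      using n1[of n] n by (intro mult_right_mono) auto
    finally show ?thesis by simp
  qed
  then show ?thesis by blast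
qed

section \<open>Moving needed symbols into free slots\<close>

text \<open>The noise at times \<open>- n, \<dots>, - 1\<close> that can influence the site \<open>v\<close> at time 0.\<close>

definition cone :: "nat \<Rightarrow> int ^ 'd::finite \<Rightarrow> nat \<Rightarrow> ((int ^ 'd) \<times> int) set" where
  "cone L v n = {(u, - int m) | u m. 1 \<le> m \<and> m \<le> n \<and> norm1 (u - v) \<le> L * m}"

definition shift_field :: "int ^ 'd::finite \<Rightarrow> ((int ^ 'd) \<times> int \<Rightarrow> 'b) \<Rightarrow> (int ^ 'd) \<times> int \<Rightarrow> 'b" where
  "shift_field u \<omega> = (\<lambda>(x, t). \<omega> (x + u, t))"

lemma finite_cone: "finite (cone L v n)"
proof -
  have "cone L v n \<subseteq> {u. norm1 (u - v) \<le> L * n} \<times> {- int n..0}"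
    unfolding cone_def by (auto intro: order_trans[OF _ mult_le_mono2])
  then show ?thesis
    by (rule finite_subset) (intro finite_cartesian_product finite_card_norm1_ball(1) finite_atLeastAtMost_int)
qed

text \<open>The coordinates at time \<open>- n\<close> are the symbols of level \<open>n\<close>, those at time 0 the initial contents
  of the slots, and those at time 1 carry the marks. The predicate \<open>U n v\<close> says that the
  levels up to \<open>n\<close> do not yet determine the value \<open>h v\<close>.\<close>

locale layered_field =
  fixes q :: "'b::finite pmf" and mark :: "'b \<Rightarrow> bool option" and L :: nat
    and U :: "nat \<Rightarrow> int ^ 'd::finite \<Rightarrow> ((int ^ 'd) \<times> int \<Rightarrow> 'b) \<Rightarrow> bool"
    and h :: "int ^ 'd \<Rightarrow> ((int ^ 'd) \<times> int \<Rightarrow> 'b) \<Rightarrow> 's"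
    and k :: 'd and n0 :: nat
  assumes U_local: "depends_on (cone L v n) (U n v)"
    and U_antimono: "U (Suc n) v \<omega> \<Longrightarrow> U n v \<omega>"
    and h_local: "\<not> U n v \<omega> \<Longrightarrow> (\<And>i. i \<in> cone L v n \<Longrightarrow> \<omega> i = \<omega>' i) \<Longrightarrow> h v \<omega> = h v \<omega>'"
    and U_shift: "U n (v + u) \<omega> = U n v (shift_field u \<omega>)"
    and h_shift: "h (v + u) \<omega> = h v (shift_field u \<omega>)"
begin

text \<open>The symbols of level \<open>n\<close> matter only to sites that the levels below \<open>n\<close> leave unresolved.\<close>

definition needed :: "nat \<Rightarrow> ((int ^ 'd) \<times> int \<Rightarrow> 'b) \<Rightarrow> int ^ 'd \<Rightarrow> bool" where
  "needed n \<omega> u \<longleftrightarrow> (\<exists>v. norm1 (v - u) \<le> L * n \<and> U (n - 1) v \<omega>)"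

definition free :: "nat \<Rightarrow> ((int ^ 'd) \<times> int \<Rightarrow> 'b) \<Rightarrow> int ^ 'd \<Rightarrow> bool" where
  "free n \<omega> x \<longleftrightarrow> (\<forall>i<length (label n). mark (\<omega> (fwd k x i, 1)) = label n ! i)"

definition link :: "nat \<Rightarrow> ((int ^ 'd) \<times> int \<Rightarrow> 'b) \<Rightarrow> int ^ 'd \<Rightarrow> int ^ 'd \<Rightarrow> bool" where
  "link n \<omega> u x \<longleftrightarrow> n0 < n \<and> (\<exists>j. partner k (needed n \<omega>) (free n \<omega>) u j \<and> x = fwd k u j)"

text \<open>A symbol is exchanged with the content of its slot rather than copied, so that the operation permutes the
  coordinates.\<close>

definition swap_rel :: "nat \<Rightarrow> ((int ^ 'd) \<times> int \<Rightarrow> 'b) \<Rightarrow> (int ^ 'd) \<times> int \<Rightarrow> (int ^ 'd) \<times> int \<Rightarrow> bool" where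
  "swap_rel n \<omega> i i' \<longleftrightarrow> (\<exists>u x. link n \<omega> u x \<and>
     (i = (x, 0) \<and> i' = (u, - int n) \<or> i = (u, - int n) \<and> i' = (x, 0)))"

definition swap :: "nat \<Rightarrow> ((int ^ 'd) \<times> int \<Rightarrow> 'b) \<Rightarrow> (int ^ 'd) \<times> int \<Rightarrow> (int ^ 'd) \<times> int" where
  "swap n \<omega> i = (if \<exists>i'. swap_rel n \<omega> i i' then SOME i'. swap_rel n \<omega> i i' else i)"

definition swapped :: "nat \<Rightarrow> ((int ^ 'd) \<times> int \<Rightarrow> 'b) \<Rightarrow> (int ^ 'd) \<times> int \<Rightarrow> 'b" where
  "swapped n \<omega> = (\<lambda>i. \<omega> (swap n \<omega> i))"

text \<open>The swap of the highest level comes first: it leaves the lower levels unchanged, so the later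
  swaps are still the ones that the original field prescribes.\<close>

primrec stage :: "nat \<Rightarrow> ((int ^ 'd) \<times> int \<Rightarrow> 'b) \<Rightarrow> (int ^ 'd) \<times> int \<Rightarrow> 'b" where
  "stage 0 \<omega> = \<omega>"
| "stage (Suc N) \<omega> = stage N (swapped (Suc N) \<omega>)"

text \<open>The limit of the stages at the times from \<open>- n0\<close> on, see \<open>eventually_stage_eq_refilled\<close>. At most
  one level and site is linked to a given slot, by \<open>link_unique\<close>.\<close>

definition refilled :: "((int ^ 'd) \<times> int \<Rightarrow> 'b) \<Rightarrow> (int ^ 'd) \<times> int \<Rightarrow> 'b" where
  "refilled \<omega> = (\<lambda>(x, t). if t = 0 \<and> (\<exists>n u. link n \<omega> u x)
      then \<omega> (SOME i. \<exists>n u. link n \<omega> u x \<and> i = (u, - int n)) else \<omega> (x, t))"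

text \<open>The label of a slot determines the level, and within a level the matching is injective.\<close>

lemma link_unique:
  assumes "link n \<omega> u x" "link n' \<omega> u' x"
  shows "n = n' \<and> u = u'"
proof -
  obtain j j' where p: "partner k (needed n \<omega>) (free n \<omega>) u j" "x = fwd k u j"
      "partner k (needed n' \<omega>) (free n' \<omega>) u' j'" "x = fwd k u' j'"
    using assms by (auto simp: link_def)
  have "free n \<omega> x" "free n' \<omega> x"
    using partner_free(1)[OF p(1)] partner_free(1)[OF p(3)] p(2,4) by auto
  then have n: "n = n'"
    unfolding free_def by (intro label_prefix_free[of n "\<lambda>i. mark (\<omega> (fwd k x i, 1))" n']) auto
  show ?thesis using partner_inj[OF p(1), of u' j'] p n by auto
qed

lemma link_unique_right:
  assumes "link n \<omega> u x" "link n \<omega> u x'"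
  shows "x = x'"
  using assms partner_unique unfolding link_def by metis

lemma swap_rel_sym: "swap_rel n \<omega> i i' \<Longrightarrow> swap_rel n \<omega> i' i"
  unfolding swap_rel_def by blast

lemma link_pos: "link n \<omega> u x \<Longrightarrow> 0 < n"
  by (auto simp: link_def)

lemma swap_rel_unique:
  assumes "swap_rel n \<omega> i i'" "swap_rel n \<omega> i i''"
  shows "i' = i''"
  using assms unfolding swap_rel_def
  by (auto dest: link_unique link_unique_right link_pos)

lemma swap_eqI: "swap_rel n \<omega> i i' \<Longrightarrow> swap n \<omega> i = i'"
  unfolding swap_def using swap_rel_unique by (metis someI_ex)

lemma swap_id: "(\<And>i'. \<not> swap_rel n \<omega> i i') \<Longrightarrow> swap n \<omega> i = i"
  unfolding swap_def by auto

lemma inj_swap: "inj (swap n \<omega>)"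
proof -
  have "swap n \<omega> (swap n \<omega> i) = i" for i
    using swap_eqI swap_id swap_rel_sym by metis
  then show ?thesis by (metis injI)
qed

section \<open>Locality and invariance of the swaps\<close>

lemma U_antimono': "m \<le> n \<Longrightarrow> U n v \<omega> \<Longrightarrow> U m v \<omega>"
  by (induction rule: dec_induct) (auto dest: U_antimono)

lemma depends_on_free: "depends_on {(x, 1) | x. True} (\<lambda>\<omega>. free n \<omega> x)"
  unfolding free_def by (rule depends_onI) auto

lemma depends_on_needed: "depends_on {(x, - int m) | x m. 1 \<le> m \<and> m < n} (\<lambda>\<omega>. needed n \<omega> u)"
proof (rule depends_onI)
  fix \<omega> \<omega>' :: "(int ^ 'd) \<times> int \<Rightarrow> 'b"
  assume eq: "\<And>j. j \<in> {(x, - int m) | x m. 1 \<le> m \<and> m < n} \<Longrightarrow> \<omega> j = \<omega>' j"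
  have "U (n - 1) v \<omega> = U (n - 1) v \<omega>'" for v
    by (rule depends_onD[OF U_local], rule eq) (auto simp: cone_def)
  then show "needed n \<omega> u = needed n \<omega>' u"
    by (simp add: needed_def)
qed

text \<open>The coordinates that decide the swap of level \<open>n\<close>; the swap moves none of them.\<close>

definition known :: "nat \<Rightarrow> ((int ^ 'd) \<times> int) set" where
  "known n = {(x, t). t = 1 \<or> - int n < t \<and> t < 0}"

lemma link_cong:
  assumes "\<And>i. i \<in> known n \<Longrightarrow> \<omega> i = \<omega>' i"
  shows "link n \<omega> u x = link n \<omega>' u x"
proof -
  have "needed n \<omega> u = needed n \<omega>' u" for u
    by (rule depends_onD[OF depends_on_needed], rule assms) (auto simp: known_def)
  moreover have "free n \<omega> u = free n \<omega>' u" for u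
    by (rule depends_onD[OF depends_on_free], rule assms) (auto simp: known_def)
  ultimately have "needed n \<omega> = needed n \<omega>'" "free n \<omega> = free n \<omega>'" by auto
  then show ?thesis by (simp add: link_def)
qed

lemma swap_cong:
  assumes "\<And>i. i \<in> known n \<Longrightarrow> \<omega> i = \<omega>' i"
  shows "swap n \<omega> i = swap n \<omega>' i"
proof -
  have "swap_rel n \<omega> = swap_rel n \<omega>'"
    unfolding swap_rel_def using link_cong[OF assms] by (intro ext) auto
  then show ?thesis by (simp add: swap_def)
qed

lemma measurable_U [measurable]: "Measurable.pred (iid q) (U n v)"
  by (rule measurable_depends_on[OF finite_cone U_local])

lemma measurable_needed [measurable]: "Measurable.pred (iid q) (\<lambda>\<omega>. needed n \<omega> u)"
  unfolding needed_def by measurable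

lemma measurable_free [measurable]: "Measurable.pred (iid q) (\<lambda>\<omega>. free n \<omega> x)"
proof -
  have "Measurable.pred (iid q) (\<lambda>\<omega>. mark (\<omega> (fwd k x i, 1)) = c)" for i c
    by (rule measurable_compose[OF measurable_iid_component]) simp
  then show ?thesis unfolding free_def by measurable
qed

lemma measurable_excess [measurable]:
  "(\<lambda>\<omega>. excess k (needed n \<omega>) (free n \<omega>) u j) \<in> iid q \<rightarrow>\<^sub>M count_space UNIV"
proof (induction j)
  case 0
  show ?case unfolding excess_def by simp
next
  case (Suc j)
  note [measurable] = Suc
  show ?case unfolding excess_Suc by measurable
qed

lemma measurable_link [measurable]: "Measurable.pred (iid q) (\<lambda>\<omega>. link n \<omega> u x)"
  unfolding link_def partner_def by measurable

lemma measurable_swap_rel [measurable]: "Measurable.pred (iid q) (\<lambda>\<omega>. swap_rel n \<omega> i i')"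
  unfolding swap_rel_def by measurable

lemma measurable_swap: "(\<lambda>\<omega>. swap n \<omega> i) \<in> iid q \<rightarrow>\<^sub>M count_space UNIV"
proof (rule measurable_count_spaceI)
  fix c
  have "(\<lambda>\<omega>. swap n \<omega> i = c) = (\<lambda>\<omega>. swap_rel n \<omega> i c \<or> c = i \<and> \<not> (\<exists>i'. swap_rel n \<omega> i i'))"
    using swap_eqI swap_id by (intro ext) metis
  also have "Measurable.pred (iid q) \<dots>" by measurable
  finally show "Measurable.pred (iid q) (\<lambda>\<omega>. swap n \<omega> i = c)" .
qed

lemma swapped_preserves:
  "swapped n \<in> iid q \<rightarrow>\<^sub>M iid q" "distr (iid q) (iid q) (swapped n) = iid q"
proof -
  have dep: "depends_on (known n) (\<lambda>\<omega>. swap n \<omega> i)" for i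
    by (rule depends_onI) (rule swap_cong)
  have fixed: "swap n \<omega> i = i" if "i \<in> known n" for \<omega> i
    by (rule swap_id) (use that in \<open>auto simp: swap_rel_def known_def\<close>)
  show "swapped n \<in> iid q \<rightarrow>\<^sub>M iid q" "distr (iid q) (iid q) (swapped n) = iid q"
    unfolding swapped_def
    using distr_iid_adaptive_reindex[OF measurable_swap dep fixed inj_swap] by auto
qed

lemma stage_preserves:
  "stage N \<in> iid q \<rightarrow>\<^sub>M iid q \<and> distr (iid q) (iid q) (stage N) = iid q"
proof (induction N)
  case 0
  have "stage 0 = (\<lambda>\<omega>. \<omega>)" by auto
  then show ?case by (simp add: distr_id)
next
  case (Suc N)
  have eq: "stage (Suc N) = stage N \<circ> swapped (Suc N)" by auto
  show ?case
    unfolding eq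
    using Suc swapped_preserves[of "Suc N"] distr_distr[of "stage N" "iid q" "iid q" "swapped (Suc N)" "iid q"]
    by (metis measurable_comp)
qed

lemma swapped_outside:
  assumes "snd i \<noteq> 0" "snd i \<noteq> - int n"
  shows "swapped n \<omega> i = \<omega> i"
  unfolding swapped_def by (subst swap_id) (use assms in \<open>auto simp: swap_rel_def\<close>)

lemma link_swapped:
  assumes "n \<le> N"
  shows "link n (swapped (Suc N) \<omega>) u x = link n \<omega> u x"
  by (rule link_cong, rule swapped_outside) (use assms in \<open>auto simp: known_def\<close>)

text \<open>The induction is over all fields at once, since the lower swaps act on the field that the
  highest swap has already changed. The links of lower levels are the same in both fields, and a slot linked at the
  highest level is linked at no other one.\<close>

lemma stage_eq:
  "(n \<le> N \<longrightarrow> link n \<omega> u x \<longrightarrow> stage N \<omega> (x, 0) = \<omega> (u, - int n)) \<and>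
   (- int n0 \<le> t \<longrightarrow> (t = 0 \<longrightarrow> (\<forall>n\<le>N. \<forall>u. \<not> link n \<omega> u x)) \<longrightarrow> stage N \<omega> (x, t) = \<omega> (x, t))"
proof (induction N arbitrary: \<omega> n u x t)
  case 0
  then show ?case by (auto dest: link_pos)
next
  case (Suc N)
  let ?\<omega> = "swapped (Suc N) \<omega>"
  have a: "stage (Suc N) \<omega> (x, 0) = \<omega> (u, - int n)" if n: "n \<le> Suc N" and l: "link n \<omega> u x"
  proof (cases "n \<le> N")
    case True
    then have "stage N ?\<omega> (x, 0) = ?\<omega> (u, - int n)"
      using Suc.IH[of n ?\<omega> u x] l link_swapped by auto
    also have "\<dots> = \<omega> (u, - int n)"
      by (rule swapped_outside) (use True link_pos[OF l] in auto)
    finally show ?thesis by simp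
  next
    case False
    then have n: "n = Suc N" using n by simp
    have "\<not> link n' ?\<omega> u' x" if "n' \<le> N" for n' u'
      using link_unique[OF l, of n' u'] link_swapped[OF that] that n by auto
    then have "stage N ?\<omega> (x, 0) = ?\<omega> (x, 0)"
      using Suc.IH[of _ ?\<omega> _ x 0] by auto
    also have "\<dots> = \<omega> (u, - int n)"
      unfolding swapped_def by (subst swap_eqI[of _ _ _ "(u, - int n)"]) (use l n in \<open>auto simp: swap_rel_def\<close>)
    finally show ?thesis by simp
  qed
  have b: "stage (Suc N) \<omega> (x, t) = \<omega> (x, t)"
    if t: "- int n0 \<le> t" "t = 0 \<longrightarrow> (\<forall>n\<le>Suc N. \<forall>u. \<not> link n \<omega> u x)"
  proof -
    have "stage N ?\<omega> (x, t) = ?\<omega> (x, t)"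
      using Suc.IH[of _ ?\<omega> _ x t] t link_swapped by auto
    also have "\<dots> = \<omega> (x, t)"
      unfolding swapped_def by (subst swap_id) (use t in \<open>auto simp: swap_rel_def link_def\<close>)
    finally show ?thesis by simp
  qed
  show ?case using a b by blast
qed

lemma refilled_link: "link n \<omega> u x \<Longrightarrow> refilled \<omega> (x, 0) = \<omega> (u, - int n)"
proof -
  assume l: "link n \<omega> u x"
  have "(SOME i. \<exists>n u. link n \<omega> u x \<and> i = (u, - int n)) = (u, - int n)"
    by (rule some_equality) (use l link_unique[OF l] in blast)+
  then show ?thesis using l by (auto simp: refilled_def)
qed

lemma refilled_unlinked:
  "\<not> (t = 0 \<and> (\<exists>n u. link n \<omega> u x)) \<Longrightarrow> refilled \<omega> (x, t) = \<omega> (x, t)"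
  unfolding refilled_def prod.case by (rule if_not_P)

lemma eventually_stage_eq_refilled:
  assumes "- int n0 \<le> snd i"
  shows "eventually (\<lambda>N. stage N \<omega> i = refilled \<omega> i) sequentially"
proof -
  obtain x t where i: "i = (x, t)" by (cases i)
  show ?thesis
  proof (cases "t = 0 \<and> (\<exists>n u. link n \<omega> u x)")
    case True
    then obtain n u where l: "link n \<omega> u x" by auto
    have "stage N \<omega> i = refilled \<omega> i" if "N \<ge> n" for N
      using stage_eq[of n N \<omega> u x] refilled_link[OF l] l that True i by auto
    then show ?thesis unfolding eventually_sequentially by blast
  next
    case False
    then have "stage N \<omega> i = refilled \<omega> i" for N
      using stage_eq[of _ N \<omega> _ x t] refilled_unlinked[of t \<omega> x] assms i by auto
    then show ?thesis by simp
  qed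
qed

lemma measurable_refilled: "(\<lambda>\<omega>. refilled \<omega> i) \<in> iid q \<rightarrow>\<^sub>M count_space UNIV"
proof -
  obtain x t where i: "i = (x, t)" by (cases i)
  have [measurable]: "Measurable.pred (iid q) (\<lambda>\<omega>. \<omega> j = c)" for c and j :: "(int ^ 'd) \<times> int"
    by (rule measurable_compose[OF measurable_iid_component]) simp
  show ?thesis
  proof (rule measurable_count_spaceI)
    fix c
    have "(\<lambda>\<omega>. refilled \<omega> i = c) = (\<lambda>\<omega>. if t = 0 \<and> (\<exists>n u. link n \<omega> u x)
        then \<exists>n u. link n \<omega> u x \<and> \<omega> (u, - int n) = c else \<omega> (x, t) = c)"
    proof
      fix \<omega>
      show "(refilled \<omega> i = c) = (if t = 0 \<and> (\<exists>n u. link n \<omega> u x)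
        then \<exists>n u. link n \<omega> u x \<and> \<omega> (u, - int n) = c else \<omega> (x, t) = c)"
      proof (cases "t = 0 \<and> (\<exists>n u. link n \<omega> u x)")
        case True
        then obtain n u where l: "link n \<omega> u x" by blast
        have "(\<exists>n u. link n \<omega> u x \<and> \<omega> (u, - int n) = c) \<longleftrightarrow> \<omega> (u, - int n) = c"
          using l link_unique[OF l] by blast
        then show ?thesis using True refilled_link[OF l] i by simp
      next
        case False
        then show ?thesis using refilled_unlinked[of t \<omega> x] i by auto
      qed
    qed
    also have "Measurable.pred (iid q) \<dots>" by measurable
    finally show "Measurable.pred (iid q) (\<lambda>\<omega>. refilled \<omega> i = c)" .
  qed
qed

lemma needed_shift: "needed n (shift_field w \<omega>) u = needed n \<omega> (u + w)"
proof -
  have "(\<exists>v. norm1 (v - u) \<le> L * n \<and> U (n - 1) (v + w) \<omega>) \<longleftrightarrow>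
    (\<exists>v. norm1 (v - (u + w)) \<le> L * n \<and> U (n - 1) v \<omega>)" (is "?A \<longleftrightarrow> ?B")
  proof
    assume ?A
    then obtain v where "norm1 (v - u) \<le> L * n \<and> U (n - 1) (v + w) \<omega>" by blast
    then show ?B by (intro exI[of _ "v + w"]) (simp add: algebra_simps)
  next
    assume ?B
    then obtain v where "norm1 (v - (u + w)) \<le> L * n \<and> U (n - 1) v \<omega>" by blast
    then show ?A by (intro exI[of _ "v - w"]) (simp add: algebra_simps)
  qed
  then show ?thesis unfolding needed_def U_shift by simp
qed

lemma free_shift: "free n (shift_field w \<omega>) x = free n \<omega> (x + w)"
  by (simp add: free_def shift_field_def fwd_add)

lemma link_shift: "link n (shift_field w \<omega>) u x = link n \<omega> (u + w) (x + w)"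
proof -
  have "needed n (shift_field w \<omega>) = (\<lambda>x. needed n \<omega> (x + w))" "free n (shift_field w \<omega>) = (\<lambda>x. free n \<omega> (x + w))"
    by (intro ext needed_shift free_shift)+
  then show ?thesis
    unfolding link_def by (simp add: partner_translate fwd_add)
qed

lemma refilled_shift: "refilled (shift_field w \<omega>) (x, t) = refilled \<omega> (x + w, t)"
proof (cases "t = 0 \<and> (\<exists>n u. link n \<omega> u (x + w))")
  case True
  then obtain n u where l: "link n \<omega> u (x + w)" by blast
  then have "link n (shift_field w \<omega>) (u - w) x" by (simp add: link_shift)
  from refilled_link[OF this] refilled_link[OF l] True show ?thesis
    by (simp add: shift_field_def)
next
  case False
  then have "\<not> (t = 0 \<and> (\<exists>n u. link n (shift_field w \<omega>) u x))" by (auto simp: link_shift)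
  from refilled_unlinked[OF this] refilled_unlinked[OF False] show ?thesis
    by (simp add: shift_field_def)
qed

section \<open>The finite-valued source\<close>

definition visible :: "int set" where "visible = {- int n0..1}"

text \<open>The choice of the encoding is immaterial: on the visible times it is injective.\<close>

definition code :: "(int \<Rightarrow> 'b) \<Rightarrow> nat" where
  "code \<eta> = to_nat_on (PiE visible (\<lambda>_. UNIV :: 'b set)) (restrict \<eta> visible)"

definition codes :: "nat set" where "codes = range (code :: (int \<Rightarrow> 'b) \<Rightarrow> nat)"

definition recoded :: "((int ^ 'd) \<times> int \<Rightarrow> 'b) \<Rightarrow> int ^ 'd \<Rightarrow> nat" where
  "recoded \<omega> x = code (\<lambda>t. refilled \<omega> (x, t))"

text \<open>The source before any exchange. Its coordinates are functions of disjoint columns, which makes its law a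
  product measure.\<close>

definition plain :: "((int ^ 'd) \<times> int \<Rightarrow> 'b) \<Rightarrow> int ^ 'd \<Rightarrow> nat" where
  "plain \<omega> x = code (\<lambda>t. \<omega> (x, t))"

lemma finite_visible_words: "finite (PiE visible (\<lambda>_. UNIV :: 'b set))"
  by (intro finite_PiE) (auto simp: visible_def)

lemma code_eq_iff:
  fixes \<eta> \<eta>' :: "int \<Rightarrow> 'b"
  shows "code \<eta> = code \<eta>' \<longleftrightarrow> (\<forall>t\<in>visible. \<eta> t = \<eta>' t)"
proof -
  have "code \<eta> = code \<eta>' \<longleftrightarrow> restrict \<eta> visible = restrict \<eta>' visible"
    unfolding code_def by (intro inj_on_eq_iff[OF inj_on_to_nat_on]) (auto intro: countable_finite finite_visible_words)
  also have "\<dots> \<longleftrightarrow> (\<forall>t\<in>visible. \<eta> t = \<eta>' t)"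
    by (metis restrict_apply' restrict_ext)
  finally show ?thesis .
qed

lemma finite_codes: "finite codes"
proof -
  have "codes \<subseteq> to_nat_on (PiE visible (\<lambda>_. UNIV :: 'b set)) ` PiE visible (\<lambda>_. UNIV)"
    by (auto simp: codes_def code_def)
  then show ?thesis using finite_visible_words by (meson finite_imageI finite_subset)
qed

lemma recoded_in_codes: "recoded \<omega> x \<in> codes"
  by (simp add: recoded_def codes_def)

lemma plain_in_codes: "plain \<omega> x \<in> codes"
  by (simp add: plain_def codes_def)

lemma recoded_shift: "recoded (shift_field w \<omega>) x = recoded \<omega> (x + w)"
  by (simp add: recoded_def refilled_shift)

lemma plain_shift: "plain (shift_field w \<omega>) x = plain \<omega> (x + w)"
  by (simp add: plain_def shift_field_def)

lemma recoded_eqD: "recoded \<omega> x = recoded \<omega>' x \<Longrightarrow> - int n0 \<le> t \<Longrightarrow> t \<le> 1 \<Longrightarrow> refilled \<omega> (x, t) = refilled \<omega>' (x, t)"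
  by (simp add: recoded_def code_eq_iff visible_def)

lemma measurable_code:
  assumes "\<And>t. (\<lambda>\<omega>. X \<omega> t) \<in> N \<rightarrow>\<^sub>M count_space (UNIV :: 'b set)"
  shows "(\<lambda>\<omega>. code (X \<omega>)) \<in> N \<rightarrow>\<^sub>M count_space codes"
proof -
  have [measurable]: "Measurable.pred N (\<lambda>\<omega>. X \<omega> t = c)" for t c
    by (rule measurable_compose[OF assms]) simp
  have fs: "finite visible" by (simp add: visible_def)
  have "{\<omega> \<in> space N. code (X \<omega>) = c} \<in> sets N" if mem: "c \<in> codes" for c
  proof -
    obtain \<eta> :: "int \<Rightarrow> 'b" where c: "c = code \<eta>" using mem by (auto simp: codes_def)
    show ?thesis unfolding c code_eq_iff using fs by measurable
  qed
  then show ?thesis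
    by (subst measurable_count_space_eq2[OF finite_codes])
      (auto simp: codes_def vimage_def Int_def conj_commute)
qed

lemma measurable_recoded_at: "(\<lambda>\<omega>. recoded \<omega> x) \<in> iid q \<rightarrow>\<^sub>M count_space codes"
  unfolding recoded_def by (rule measurable_code) (rule measurable_refilled)

lemma measurable_plain_at: "(\<lambda>\<omega>. plain \<omega> x) \<in> iid q \<rightarrow>\<^sub>M count_space codes"
  unfolding plain_def by (rule measurable_code) (rule measurable_iid_component)

lemma measurable_recoded: "recoded \<in> iid q \<rightarrow>\<^sub>M field_space (count_space codes)"
proof -
  have "(\<lambda>\<omega> x. recoded \<omega> x) \<in> iid q \<rightarrow>\<^sub>M field_space (count_space codes)"
    unfolding field_space_def
    by (rule measurable_PiM_single'[where f="\<lambda>x \<omega>. recoded \<omega> x", OF measurable_recoded_at])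
      (auto simp: recoded_in_codes)
  then show ?thesis by simp
qed

lemma measurable_plain: "plain \<in> iid q \<rightarrow>\<^sub>M field_space (count_space codes)"
proof -
  have "(\<lambda>\<omega> x. plain \<omega> x) \<in> iid q \<rightarrow>\<^sub>M field_space (count_space codes)"
    unfolding field_space_def
    by (rule measurable_PiM_single'[where f="\<lambda>x \<omega>. plain \<omega> x", OF measurable_plain_at])
      (auto simp: plain_in_codes)
  then show ?thesis by simp
qed

text \<open>All stages have the law of the original field, and each visible coordinate changes at most once along
  the stages.\<close>

lemma distr_recoded:
  "distr (iid q) (field_space (count_space codes)) recoded =
   distr (iid q) (field_space (count_space codes)) plain"
proof -
  interpret prob_space "iid q :: ((int ^ 'd) \<times> int \<Rightarrow> 'b) measure" by (rule prob_space_iid)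
  show ?thesis
  proof (rule measure_eqI_PiM_infinite[of _ UNIV "\<lambda>_. count_space codes"])
    show "finite_measure (distr (iid q) (field_space (count_space codes)) recoded)"
      by (intro finite_measure_distr measurable_recoded)
    fix A :: "int ^ 'd \<Rightarrow> nat set" and J :: "(int ^ 'd) set"
    assume J: "finite J" and A: "\<And>i. i \<in> J \<Longrightarrow> A i \<in> sets (count_space codes)"
    let ?S = "prod_emb UNIV (\<lambda>_. count_space codes) J (Pi\<^sub>E J A)"
    have S: "?S \<in> sets (field_space (count_space codes))"
      unfolding field_space_def using J A by (intro sets_PiM_I) auto
    have pre: "X \<in> ?S \<longleftrightarrow> (\<forall>x\<in>J. X x \<in> A x)" if "\<And>x. X x \<in> codes" for X
      using that by (auto simp: prod_emb_def PiE_iff extensional_def)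
    have m1: "Measurable.pred (iid q) (\<lambda>\<omega>. plain \<omega> \<in> ?S)"
      using measurable_sets[OF measurable_plain S] by (simp add: pred_def vimage_def)
    have m2: "Measurable.pred (iid q) (\<lambda>\<omega>. recoded \<omega> \<in> ?S)"
      using measurable_sets[OF measurable_recoded S] by (simp add: pred_def vimage_def)
    have m3: "Measurable.pred (iid q) (\<lambda>\<omega>. plain (stage N \<omega>) \<in> ?S)" for N
      using measurable_compose[OF _ m1] stage_preserves by blast
    have "prob {\<omega>. plain (stage N \<omega>) \<in> ?S} = prob {\<omega>. plain \<omega> \<in> ?S}" for N
    proof -
      have "prob {\<omega>. plain \<omega> \<in> ?S} = measure (distr (iid q) (iid q) (stage N)) {\<omega>. plain \<omega> \<in> ?S}"
        using stage_preserves[of N] by simp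
      also have "\<dots> = prob {\<omega>. plain (stage N \<omega>) \<in> ?S}"
        using stage_preserves[of N] sets_iid_Collect[OF m1] by (subst measure_distr) (auto simp: vimage_def)
      finally show ?thesis by simp
    qed
    moreover have "(\<lambda>N. prob {\<omega>\<in>space (iid q). plain (stage N \<omega>) \<in> ?S}) \<longlonglongrightarrow> prob {\<omega>\<in>space (iid q). recoded \<omega> \<in> ?S}"
    proof (rule tendsto_prob_eventually_eq[OF m3 m2], rule AE_I2)
      fix \<omega> :: "(int ^ 'd) \<times> int \<Rightarrow> 'b"
      have "eventually (\<lambda>N. \<forall>i\<in>J \<times> visible. stage N \<omega> i = refilled \<omega> i) sequentially"
        using J by (intro eventually_ball_finite ballI eventually_stage_eq_refilled) (auto simp: visible_def)
      then show "eventually (\<lambda>N. (plain (stage N \<omega>) \<in> ?S) = (recoded \<omega> \<in> ?S)) sequentially"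
      proof eventually_elim
        case (elim N)
        have "plain (stage N \<omega>) x = recoded \<omega> x" if "x \<in> J" for x
          unfolding plain_def recoded_def code_eq_iff using elim that by auto
        then show ?case by (simp add: pre plain_in_codes recoded_in_codes)
      qed
    qed
    ultimately have "prob {\<omega>. plain \<omega> \<in> ?S} = prob {\<omega>. recoded \<omega> \<in> ?S}"
      by (simp add: LIMSEQ_const_iff)
    then show "emeasure (distr (iid q) (field_space (count_space codes)) recoded) ?S =
        emeasure (distr (iid q) (field_space (count_space codes)) plain) ?S"
      by (simp add: emeasure_distr measurable_recoded measurable_plain S emeasure_eq_measure vimage_def)
  qed (simp_all add: field_space_def)
qed

lemma distr_shift: "distr (iid q) (iid q) (shift_field w) = iid q"
proof -
  have "shift_field w = (\<lambda>(\<omega> :: _ \<Rightarrow> 'b) i. \<omega> (fst i + w, snd i))"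
    by (auto simp: shift_field_def fun_eq_iff)
  then show ?thesis
    using distr_iid_reindex[of "\<lambda>i. (fst i + w, snd i)" q] by (auto simp: inj_on_def)
qed

lemma measurable_shift: "shift_field w \<in> iid q \<rightarrow>\<^sub>M iid q"
  by (rule measurable_to_iid) (auto simp: shift_field_def split_beta)

lemma distr_plain:
  obtains \<nu> where "distr (iid q) (field_space (count_space codes)) plain = (\<Pi>\<^sub>M x\<in>UNIV. \<nu>)"
    "prob_space \<nu>" "sets \<nu> = sets (count_space codes)"
proof -
  interpret prob_space "iid q :: ((int ^ 'd) \<times> int \<Rightarrow> 'b) measure" by (rule prob_space_iid)
  define \<nu> where "\<nu> = distr (iid q) (count_space codes) (\<lambda>\<omega>. plain \<omega> 0)"
  have \<nu>: "distr (iid q) (count_space codes) (\<lambda>\<omega>. plain \<omega> x) = \<nu>" for x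
  proof -
    have "\<nu> = distr (distr (iid q) (iid q) (shift_field x)) (count_space codes) (\<lambda>\<omega>. plain \<omega> 0)"
      by (simp add: distr_shift \<nu>_def)
    also have "\<dots> = distr (iid q) (count_space codes) ((\<lambda>\<omega>. plain \<omega> 0) \<circ> shift_field x)"
      by (rule distr_distr[OF measurable_plain_at measurable_shift])
    also have "(\<lambda>\<omega>. plain \<omega> 0) \<circ> shift_field x = (\<lambda>\<omega>. plain \<omega> x)"
      by (simp add: fun_eq_iff plain_shift)
    finally show ?thesis by simp
  qed
  have "indep_vars (\<lambda>_. count_space UNIV) (\<lambda>x \<omega>. plain \<omega> x) UNIV"
  proof (rule indep_vars_depends_on[where J="\<lambda>x. {x} \<times> visible"])
    show "(\<lambda>\<omega>. plain \<omega> x) \<in> iid q \<rightarrow>\<^sub>M count_space UNIV" for x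
      by (rule measurable_compose[OF measurable_plain_at]) simp
    show "depends_on ({x} \<times> visible) (\<lambda>\<omega>. plain \<omega> x)" for x
      by (rule depends_onI) (auto simp: plain_def code_eq_iff)
  qed (auto simp: disjoint_family_on_def)
  then have "indep_vars (\<lambda>_. count_space codes) (\<lambda>x \<omega>. (\<lambda>c. if c \<in> codes then c else code undefined) (plain \<omega> x)) UNIV"
    by (rule indep_vars_compose2) (auto simp: codes_def)
  then have "indep_vars (\<lambda>_. count_space codes) (\<lambda>x \<omega>. plain \<omega> x) UNIV"
    by (simp add: plain_in_codes)
  then have "distr (iid q) (field_space (count_space codes)) plain = (\<Pi>\<^sub>M x\<in>UNIV. \<nu>)"
    by (subst (asm) indep_vars_iff_distr_eq_PiM) (auto simp: \<nu> measurable_plain_at restrict_UNIV field_space_def)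
  moreover have "prob_space \<nu>" unfolding \<nu>_def by (rule prob_space_distr[OF measurable_plain_at])
  ultimately show ?thesis using that by (simp add: \<nu>_def)
qed

section \<open>Decoding\<close>

text \<open>Both fields are compared on balls that shrink as the level \<open>n\<close> grows: there they have the same unresolved sites, and
  the same symbols wherever these are needed. Passing to the next level costs \<open>L * N\<close> to
  see which symbols are needed, \<open>r\<close> to reach the partner, \<open>N + 1\<close> to read labels, and again
  \<open>L * N\<close> for the cone of a site. Nothing is assumed about the second field outside
  the window, so its symbols must be found in the same places; this holds because partners
  and labels are recognised locally.\<close>

lemma decode:
  assumes resolved: "\<not> U N 0 \<omega>"
    and matched: "\<And>n u. n0 < n \<Longrightarrow> n \<le> N \<Longrightarrow> norm1 u \<le> R \<Longrightarrow>
        \<exists>j\<le>r. excess k (needed n \<omega>) (free n \<omega>) u j \<le> 0"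
    and R: "N * (2 * L * N + r + N + 1) \<le> R"
    and agree: "\<And>x. norm1 x \<le> R \<Longrightarrow> recoded \<omega> x = recoded \<omega>' x"
  shows "h 0 \<omega> = h 0 \<omega>'"
proof -
  define s where "s = 2 * L * N + r + N + 1"
  have inv: "(\<forall>v. norm1 v + n * s \<le> R \<longrightarrow> U n v \<omega> = U n v \<omega>') \<and>
      (\<forall>u. 1 \<le> n \<longrightarrow> norm1 u + (n - 1) * s + L * N + r + N + 1 \<le> R \<longrightarrow> needed n \<omega> u \<longrightarrow>
         \<omega> (u, - int n) = \<omega>' (u, - int n))" if "n \<le> N" for n
    using that
  proof (induction n rule: less_induct)
    case (less n)
    show ?case
    proof (cases "n = 0")
      case True
      have "U 0 v \<omega> = U 0 v \<omega>'" for v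
        by (rule depends_onD[OF U_local]) (auto simp: cone_def)
      then show ?thesis using True by auto
    next
      case False
      then obtain n' where n': "n = Suc n'" by (cases n) auto
      have U': "U n' v \<omega> = U n' v \<omega>'" if "norm1 v + n' * s \<le> R" for v
        using less.IH[of n'] less.prems that n' by auto
      have Ln: "L * n \<le> L * N" using less.prems by simp
      have needed: "needed n \<omega> u = needed n \<omega>' u" if u: "norm1 u + n' * s + L * N \<le> R" for u
      proof -
        have "U n' v \<omega> = U n' v \<omega>'" if "norm1 (v - u) \<le> L * n" for v
        proof (rule U')
          have "norm1 v \<le> norm1 u + L * n"
            using norm1_triangle[of "v - u" u] that by simp
          then show "norm1 v + n' * s \<le> R" using u Ln by linarith
        qed
        then show ?thesis unfolding needed_def n' by auto
      qed
      have mark: "\<omega> (x, t) = \<omega>' (x, t)" if "norm1 x \<le> R" "- int n0 \<le> t" "t \<le> 1" "t \<noteq> 0" for x t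
        using recoded_eqD[OF agree[OF that(1)] that(2,3)] refilled_unlinked[of t \<omega> x] refilled_unlinked[of t \<omega>' x] that(4)
        by simp
      have symbols: "\<omega> (u, - int n) = \<omega>' (u, - int n)"
        if u: "norm1 u + n' * s + L * N + r + N + 1 \<le> R" and need: "needed n \<omega> u" for u
      proof (cases "n \<le> n0")
        case True
        then show ?thesis using mark[of u "- int n"] u False by auto
      next
        case n: False
        have "norm1 u \<le> R" using u by simp
        then obtain j0 where "j0 \<le> r" "excess k (needed n \<omega>) (free n \<omega>) u j0 \<le> 0"
          using matched[of n u] n less.prems by auto
        then obtain j where j: "j \<le> r" "partner k (needed n \<omega>) (free n \<omega>) u j"
          using partner_exists[of "needed n \<omega>" u k "free n \<omega>" j0] need by (metis le_trans)
        have fu: "norm1 (fwd k u i) \<le> norm1 u + r" if "i \<le> j" for i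
          using norm1_fwd_le[of k u i] that j(1) by linarith
        have "partner k (needed n \<omega>') (free n \<omega>') u j"
        proof (rule partner_cong[THEN iffD1, OF _ _ j(2)])
          fix i assume i: "i \<le> j"
          show "needed n \<omega> (fwd k u i) = needed n \<omega>' (fwd k u i)"
            by (rule needed) (use fu[OF i] u in linarith)
          have "\<omega> (fwd k (fwd k u i) l, 1) = \<omega>' (fwd k (fwd k u i) l, 1)" if "l < length (label n)" for l
          proof (rule mark)
            have "norm1 (fwd k (fwd k u i) l) \<le> norm1 u + r + l"
              using norm1_fwd_le[of k "fwd k u i" l] fu[OF i] by linarith
            then show "norm1 (fwd k (fwd k u i) l) \<le> R"
              using u that length_label[of n] less.prems by linarith
          qed auto
          then show "free n \<omega> (fwd k u i) = free n \<omega>' (fwd k u i)"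
            by (simp add: free_def)
        qed
        then have l: "link n \<omega>' u (fwd k u j)" "link n \<omega> u (fwd k u j)"
          using n j(2) unfolding link_def by auto
        have "recoded \<omega> (fwd k u j) = recoded \<omega>' (fwd k u j)"
          by (rule agree) (use fu[of j] u in linarith)
        from recoded_eqD[OF this, of 0] show ?thesis
          using refilled_link[OF l(1)] refilled_link[OF l(2)] by simp
      qed
      have "U n v \<omega> = U n v \<omega>'" if v: "norm1 v + n * s \<le> R" for v
      proof (cases "U n' v \<omega>")
        case True
        show ?thesis
        proof (rule depends_onD[OF U_local])
          fix i assume "i \<in> cone L v n"
          then obtain u m where i: "i = (u, - int m)" "1 \<le> m" "m \<le> n" "norm1 (u - v) \<le> L * m"
            by (auto simp: cone_def)
          have "U (m - 1) v \<omega>" by (rule U_antimono'[OF _ True]) (use i n' in auto)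
          then have need: "needed m \<omega> u"
            unfolding needed_def using i(4) norm1_minus_commute[of u v] by auto
          have "norm1 u \<le> norm1 v + L * m" using norm1_triangle[of "u - v" v] i(4) by simp
          moreover have "L * m \<le> L * N" using i(3) less.prems by simp
          moreover have "(m - 1) * s \<le> n' * s" by (rule mult_le_mono1) (use i(3) n' in simp)
          moreover have "n * s = n' * s + s" using n' by simp
          ultimately have "norm1 u + (m - 1) * s + L * N + r + N + 1 \<le> R"
            using v unfolding s_def by linarith
          then show "\<omega> i = \<omega>' i"
            using less.IH[of m] symbols[of u] need i(1,2,3) n' less.prems by (cases "m = n") auto
        qed
      next
        case False
        have "norm1 v + n' * s \<le> R" using v n' by simp
        then have "\<not> U n' v \<omega>'" using U' False by simp
        then show ?thesis using False U_antimono n' by blast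
      qed
      then show ?thesis using symbols n' by auto
    qed
  qed
  define n where "n = (LEAST n. \<not> U n 0 \<omega>)"
  have n: "\<not> U n 0 \<omega>" "n \<le> N"
    unfolding n_def using resolved by (rule LeastI, rule Least_le)
  show ?thesis
  proof (rule h_local[OF n(1)])
    fix i :: "(int ^ 'd) \<times> int" assume "i \<in> cone L 0 n"
    then obtain u m where i: "i = (u, - int m)" "1 \<le> m" "m \<le> n" "norm1 u \<le> L * m"
      by (auto simp: cone_def)
    have "U (m - 1) 0 \<omega>"
      using not_less_Least[of "m - 1" "\<lambda>n. \<not> U n 0 \<omega>"] i(2,3) unfolding n_def by auto
    then have need: "needed m \<omega> u"
      unfolding needed_def using i(4) norm1_minus_commute[of u 0] by (intro exI[of _ 0]) auto
    have m: "m \<le> N" "L * m \<le> L * N" using i(3) n(2) by auto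
    have "(m - 1) * s + s \<le> N * s"
      using i(2) m(1) mult_le_mono1[of m N s] by (cases m) auto
    then have "norm1 u + (m - 1) * s + L * N + r + N + 1 \<le> R"
      using R i(4) m(2) unfolding s_def by linarith
    then show "\<omega> i = \<omega>' i" using inv[OF m(1)] need i(1,2) by auto
  qed
qed

end

text \<open>Beyond level \<open>n0\<close> the density of needed symbols is at most half of the density of slots.\<close>

locale layered_field_tail = layered_field q mark L U h k n0
  for q :: "'b::finite pmf" and mark L
    and U :: "nat \<Rightarrow> int ^ 'd::finite \<Rightarrow> ((int ^ 'd) \<times> int \<Rightarrow> 'b) \<Rightarrow> bool"
    and h :: "int ^ 'd \<Rightarrow> ((int ^ 'd) \<times> int \<Rightarrow> 'b) \<Rightarrow> 's" and k n0 +
  fixes C c :: real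
  assumes mark_prob: "measure_pmf.prob q {b. mark b = m} = 1 / 3"
    and C_pos: "0 < C" and c_pos: "0 < c"
    and U_tail: "measure (iid q) {\<omega>. U n 0 \<omega>} \<le> C * exp (- c * n)"
    and n0: "n0 < n \<Longrightarrow> real ((2 * (L * n) + 1) ^ CARD('d)) * (C * exp (- c * (n - 1))) \<le> 1 / (18 * (real n)\<^sup>2)"
begin

sublocale prob_space "iid q :: ((int ^ 'd) \<times> int \<Rightarrow> 'b) measure"
  by (rule prob_space_iid)

lemma prob_U_shift: "prob {\<omega>. U n v \<omega>} = prob {\<omega>. U n 0 \<omega>}"
proof -
  have "prob {\<omega>. U n 0 \<omega>} = measure (distr (iid q) (iid q) (shift_field v)) {\<omega>. U n 0 \<omega>}"
    by (simp add: distr_shift)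
  also have "\<dots> = prob (shift_field v -` {\<omega>. U n 0 \<omega>})"
    by (subst measure_distr[OF measurable_shift]) (auto intro: sets_iid_Collect)
  also have "shift_field v -` {\<omega>. U n 0 \<omega>} = {\<omega>. U n v \<omega>}"
    using U_shift[of n 0 v] by (auto simp: vimage_def)
  finally show ?thesis by simp
qed

lemma prob_needed: "n0 < n \<Longrightarrow> prob {\<omega>. needed n \<omega> u} \<le> 1 / (18 * (real n)\<^sup>2)"
proof -
  assume n: "n0 < n"
  let ?B = "{v. norm1 (v - u) \<le> L * n}"
  have "prob {\<omega>. needed n \<omega> u} = prob (\<Union>v\<in>?B. {\<omega>. U (n - 1) v \<omega>})"
    by (intro arg_cong[where f=prob]) (auto simp: needed_def)
  also have "\<dots> \<le> (\<Sum>v\<in>?B. prob {\<omega>. U (n - 1) v \<omega>})"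
    by (intro finite_measure_subadditive_finite finite_card_norm1_ball) (auto intro: sets_iid_Collect)
  also have "\<dots> \<le> (\<Sum>v\<in>?B. C * exp (- c * (n - 1)))"
    using U_tail[of "n - 1"] prob_U_shift[of "n - 1"] by (intro sum_mono) metis
  also have "\<dots> = real (card ?B) * (C * exp (- c * (n - 1)))" by simp
  also have "\<dots> \<le> real ((2 * (L * n) + 1) ^ CARD('d)) * (C * exp (- c * (n - 1)))"
  proof (rule mult_right_mono)
    show "real (card ?B) \<le> real ((2 * (L * n) + 1) ^ CARD('d))"
      by (rule of_nat_mono[OF finite_card_norm1_ball(2)])
    show "0 \<le> C * exp (- c * (n - 1))" using C_pos by simp
  qed
  also have "\<dots> \<le> 1 / (18 * (real n)\<^sup>2)" by (rule n0[OF n])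
  finally show ?thesis .
qed

lemma prob_free: "0 < n \<Longrightarrow> prob {\<omega>. free n \<omega> x} \<ge> 1 / (9 * (real n)\<^sup>2)"
proof -
  assume n: "0 < n"
  let ?l = "length (label n)"
  let ?B = "(\<lambda>i. (fwd k x i, 1 :: int)) ` {..<?l}"
  let ?X = "\<lambda>(y, t :: int). {b. mark b = label n ! norm1 (y - x)}"
  have inj: "inj_on (\<lambda>i. (fwd k x i, 1 :: int)) {..<?l}"
    by (rule inj_on_inverseI[where g="\<lambda>(y, t). norm1 (y - x)"]) (simp add: norm1_fwd)
  have "emeasure (iid q) {\<omega>. free n \<omega> x} = emeasure (iid q) {\<omega>. \<forall>i\<in>?B. \<omega> i \<in> ?X i}"
    by (intro arg_cong[where f="emeasure (iid q)"]) (auto simp: free_def norm1_fwd)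
  also have "\<dots> = (\<Prod>i\<in>?B. emeasure (measure_pmf q) (?X i))"
    by (rule emeasure_iid_cylinder) simp
  also have "\<dots> = (\<Prod>i<?l. ennreal (1 / 3))"
    by (subst prod.reindex[OF inj]) (simp add: measure_pmf.emeasure_eq_measure mark_prob norm1_fwd)
  also have "\<dots> = ennreal ((1 / 3) ^ ?l)"
    by (simp add: ennreal_power)
  finally have "prob {\<omega>. free n \<omega> x} = (1 / 3) ^ ?l"
    by (simp add: emeasure_eq_measure)
  also have "\<dots> = 1 / real (3 ^ ?l)" by (simp add: power_one_over)
  also have "\<dots> \<ge> 1 / real (9 * n\<^sup>2)"
  proof (rule divide_left_mono)
    show "real (3 ^ ?l) \<le> real (9 * n\<^sup>2)"
      by (rule of_nat_mono[OF three_power_length_label[OF n]])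
  qed (use n in simp_all)
  finally show ?thesis by simp
qed

text \<open>Whether a site is an opening or a closing parenthesis of level \<open>n\<close> is decided within distance \<open>reach n\<close>, so
  sites at distance \<open>period n\<close> behave independently.\<close>

definition reach :: "nat \<Rightarrow> nat" where "reach n = 2 * L * n + n"
definition period :: "nat \<Rightarrow> nat" where "period n = 2 * reach n + 1"

lemma depends_on_step:
  "depends_on {(x, t). norm1 (x - y) \<le> reach n} (\<lambda>\<omega>. (needed n \<omega> y, free n \<omega> y))"
proof (rule depends_onI)
  fix \<omega> \<omega>' :: "(int ^ 'd) \<times> int \<Rightarrow> 'b"
  assume eq: "\<And>j. j \<in> {(x, t). norm1 (x - y) \<le> reach n} \<Longrightarrow> \<omega> j = \<omega>' j"
  have "U (n - 1) v \<omega> = U (n - 1) v \<omega>'" if v: "norm1 (v - y) \<le> L * n" for v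
  proof (rule depends_onD[OF U_local], rule eq)
    fix j assume "j \<in> cone L v (n - 1)"
    then obtain u m where j: "j = (u, - int m)" "m \<le> n" "norm1 (u - v) \<le> L * m"
      by (auto simp: cone_def)
    moreover have "L * m \<le> L * n" using j(2) by simp
    ultimately have "norm1 (u - y) \<le> reach n"
      using norm1_triangle_diff[of u y v] v unfolding reach_def by linarith
    then show "j \<in> {(x, t). norm1 (x - y) \<le> reach n}" using j by simp
  qed
  then have "needed n \<omega> y = needed n \<omega>' y"
    unfolding needed_def by blast
  moreover have "\<omega> (fwd k y i, 1) = \<omega>' (fwd k y i, 1)" if "i < length (label n)" for i
    by (rule eq) (use that length_label[of n] in \<open>auto simp: norm1_fwd reach_def\<close>)
  then have "free n \<omega> y = free n \<omega>' y"
    by (simp add: free_def)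
  ultimately show "(needed n \<omega> y, free n \<omega> y) = (needed n \<omega>' y, free n \<omega>' y)" by simp
qed

definition gain :: "nat \<Rightarrow> (int ^ 'd) \<Rightarrow> ((int ^ 'd) \<times> int \<Rightarrow> 'b) \<Rightarrow> real" where
  "gain n y \<omega> = of_bool (needed n \<omega> y) - of_bool (free n \<omega> y)"

lemma measurable_gain [measurable]: "gain n y \<in> borel_measurable (iid q)"
  unfolding gain_def by measurable

lemma expectation_gain:
  assumes "n0 < n"
  shows "expectation (gain n y) \<le> - 1 / (18 * (real n)\<^sup>2)"
proof -
  have "expectation (gain n y) = expectation (\<lambda>\<omega>. indicator {\<omega>. needed n \<omega> y} \<omega> - indicator {\<omega>. free n \<omega> y} \<omega>)"
    by (simp add: gain_def[abs_def] indicator_def of_bool_def)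
  also have "\<dots> = prob {\<omega>. needed n \<omega> y} - prob {\<omega>. free n \<omega> y}"
    by (subst Bochner_Integration.integral_diff) (auto simp: integrable_indicator_iff sets_iid_Collect less_top[symmetric])
  also have "\<dots> \<le> 1 / (18 * (real n)\<^sup>2) - 1 / (9 * (real n)\<^sup>2)"
    by (rule diff_mono[OF prob_needed[OF assms] prob_free]) (use assms in simp)
  also have "\<dots> = - 1 / (18 * (real n)\<^sup>2)"
    using assms by (simp add: field_simps)
  finally show ?thesis .
qed

text \<open>Along one residue class modulo the period the increments of the walk are independent, lie between \<open>- 1\<close> and 1 and
  have mean at most \<open>- 1 / (18 * n\<^sup>2)\<close>. Hoeffding's inequality with deviation \<open>K / (18 * n\<^sup>2)\<close> gives the
  exponent \<open>2 * (K / (18 * n\<^sup>2))\<^sup>2 / (4 * K)\<close>.\<close>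

lemma prob_class_sum:
  assumes n: "n0 < n" and K: "0 < K"
  shows "prob {\<omega>. (\<Sum>t<K. gain n (fwd k u (t * period n + i)) \<omega>) > 0} \<le> exp (- real K / (648 * (real n) ^ 4))"
proof -
  let ?y = "\<lambda>t. fwd k u (t * period n + i)"
  let ?X = "\<lambda>t. gain n (?y t)"
  have far: "reach n < norm1 (x - ?y t')" if "norm1 (x - ?y t) \<le> reach n" "t \<noteq> t'" for x t t'
  proof -
    have "int (t * period n + i) - int (t' * period n + i) = (int t - int t') * int (period n)"
      by (simp add: algebra_simps)
    then have "norm1 (?y t - ?y t') = nat \<bar>int t - int t'\<bar> * period n"
      by (simp only: norm1_fwd_fwd) (simp add: abs_mult nat_mult_distrib)
    moreover have "nat \<bar>int t - int t'\<bar> \<ge> 1" using that(2) by simp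
    then have "nat \<bar>int t - int t'\<bar> * period n \<ge> 1 * period n" by (rule mult_le_mono1)
    ultimately have "norm1 (?y t - ?y t') \<ge> period n" by simp
    then show ?thesis
      using norm1_triangle_diff[of "?y t" "?y t'" x] that(1) norm1_minus_commute[of x "?y t"]
      unfolding period_def by linarith
  qed
  have "indep_vars (\<lambda>_. count_space UNIV) (\<lambda>t \<omega>. (needed n \<omega> (?y t), free n \<omega> (?y t))) {..<K}"
  proof (rule indep_vars_depends_on[OF _ depends_on_step])
    show "(\<lambda>\<omega>. (needed n \<omega> (?y t), free n \<omega> (?y t))) \<in> iid q \<rightarrow>\<^sub>M count_space UNIV" for t
      by measurable
    show "disjoint_family_on (\<lambda>t. {(x, s::int). norm1 (x - ?y t) \<le> reach n}) {..<K}"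
      unfolding disjoint_family_on_def using far by force
  qed
  then have "indep_vars (\<lambda>_. borel) (\<lambda>t \<omega>. (\<lambda>(a, b). of_bool a - of_bool b :: real) (needed n \<omega> (?y t), free n \<omega> (?y t))) {..<K}"
    by (rule indep_vars_compose2) simp
  then have indep: "indep_vars (\<lambda>_. borel) ?X {..<K}"
    by (simp add: gain_def[abs_def])
  interpret H: Hoeffding_ineq "iid q" "{..<K}" ?X "\<lambda>_. -1" "\<lambda>_. 1" "\<Sum>t<K. expectation (?X t)"
  proof (unfold_locales)
    show "AE \<omega> in iid q. ?X t \<omega> \<in> {- 1..1}" for t
      by (rule AE_I2) (simp add: gain_def of_bool_def)
  qed (auto simp: indep)
  let ?\<epsilon> = "real K / (18 * (real n)\<^sup>2)"
  have "(\<Sum>t<K. expectation (?X t)) \<le> (\<Sum>t<K. - 1 / (18 * (real n)\<^sup>2))"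
    by (intro sum_mono expectation_gain n)
  then have mu: "(\<Sum>t<K. expectation (?X t)) + ?\<epsilon> \<le> 0" by simp
  have "prob {\<omega>. (\<Sum>t<K. ?X t \<omega>) > 0} \<le> prob {\<omega>\<in>space (iid q). (\<Sum>t<K. ?X t \<omega>) \<ge> (\<Sum>t<K. expectation (?X t)) + ?\<epsilon>}"
  proof (rule finite_measure_mono)
    show "{\<omega>\<in>space (iid q). (\<Sum>t<K. ?X t \<omega>) \<ge> (\<Sum>t<K. expectation (?X t)) + ?\<epsilon>} \<in> events"
      by measurable
  qed (use mu in auto)
  also have "\<dots> \<le> exp (- 2 * ?\<epsilon>\<^sup>2 / (\<Sum>t<K. (1 - (- 1))\<^sup>2))"
    by (rule H.Hoeffding_ineq_ge) (use K in auto)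
  also have "- 2 * ?\<epsilon>\<^sup>2 / (\<Sum>t<K. (1 - (- 1 :: real))\<^sup>2) = - real K / (648 * (real n) ^ 4)"
    using K n by (simp add: field_simps power2_eq_square power4_eq_xxxx)
  finally show ?thesis .
qed

text \<open>A positive excess has a positive contribution from at least one residue class.\<close>

lemma prob_excess:
  assumes n: "n0 < n" and K: "0 < K"
  shows "prob {\<omega>. excess k (needed n \<omega>) (free n \<omega>) u (K * period n - 1) > 0}
    \<le> real (period n) * exp (- real K / (648 * (real n) ^ 4))"
proof -
  let ?S = "\<lambda>i \<omega>. \<Sum>t<K. gain n (fwd k u (t * period n + i)) \<omega>"
  have p: "0 < period n" by (simp add: period_def)
  have split: "real_of_int (excess k (needed n \<omega>) (free n \<omega>) u (K * period n - 1)) = (\<Sum>i<period n. ?S i \<omega>)" for \<omega>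
  proof -
    have "0 < K * period n" using K p by simp
    then have "{..K * period n - 1} = {..<K * period n}"
      by (metis Suc_pred' lessThan_Suc_atMost)
    then have "real_of_int (excess k (needed n \<omega>) (free n \<omega>) u (K * period n - 1)) = (\<Sum>j<K * period n. gain n (fwd k u j) \<omega>)"
      by (simp add: excess_def gain_def)
    also have "\<dots> = (\<Sum>t<K. \<Sum>j\<in>{t * period n..<t * period n + period n}. gain n (fwd k u j) \<omega>)"
      by (simp add: sum.nat_group)
    also have "\<dots> = (\<Sum>t<K. \<Sum>i<period n. gain n (fwd k u (t * period n + i)) \<omega>)"
    proof (rule sum.cong[OF refl])
      fix t
      show "(\<Sum>j\<in>{t * period n..<t * period n + period n}. gain n (fwd k u j) \<omega>) =
        (\<Sum>i<period n. gain n (fwd k u (t * period n + i)) \<omega>)"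
        using sum.shift_bounds_nat_ivl[of "\<lambda>j. gain n (fwd k u j) \<omega>" 0 "t * period n" "period n"]
        by (simp add: atLeast0LessThan add.commute)
    qed
    also have "\<dots> = (\<Sum>i<period n. ?S i \<omega>)" by (rule sum.swap)
    finally show ?thesis .
  qed
  have "prob {\<omega>. excess k (needed n \<omega>) (free n \<omega>) u (K * period n - 1) > 0}
      \<le> prob (\<Union>i\<in>{..<period n}. {\<omega>. ?S i \<omega> > 0})"
  proof (rule finite_measure_mono)
    show "(\<Union>i\<in>{..<period n}. {\<omega>. ?S i \<omega> > 0}) \<in> sets (iid q)"
      by (intro sets.finite_UN sets_iid_Collect) measurable
    show "{\<omega>. excess k (needed n \<omega>) (free n \<omega>) u (K * period n - 1) > 0} \<subseteq> (\<Union>i\<in>{..<period n}. {\<omega>. ?S i \<omega> > 0})"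
    proof (rule subsetI, rule ccontr)
      fix \<omega> assume a: "\<omega> \<in> {\<omega>. excess k (needed n \<omega>) (free n \<omega>) u (K * period n - 1) > 0}"
        "\<omega> \<notin> (\<Union>i\<in>{..<period n}. {\<omega>. ?S i \<omega> > 0})"
      then have "?S i \<omega> \<le> 0" if "i < period n" for i using that by (auto simp: not_less)
      then have "(\<Sum>i<period n. ?S i \<omega>) \<le> 0" by (intro sum_nonpos[where f="\<lambda>i. ?S i \<omega>"]) simp
      then show False using a(1) split[of \<omega>] by simp
    qed
  qed
  also have "\<dots> \<le> (\<Sum>i<period n. prob {\<omega>. ?S i \<omega> > 0})"
    by (intro finite_measure_subadditive_finite image_subsetI sets_iid_Collect) (auto, measurable)
  also have "\<dots> \<le> (\<Sum>i<period n. exp (- real K / (648 * (real n) ^ 4)))"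
    by (intro sum_mono prob_class_sum n K)
  also have "\<dots> = real (period n) * exp (- real K / (648 * (real n) ^ 4))" by simp
  finally show ?thesis .
qed

text \<open>The other field ranges over all configurations, not only over typical ones, so what the
  remaining windows decode is certain.\<close>

definition undecodable :: "nat \<Rightarrow> ((int ^ 'd) \<times> int \<Rightarrow> 'b) \<Rightarrow> bool" where
  "undecodable R \<omega> \<longleftrightarrow>
     (\<exists>\<omega>'. (\<forall>x. norm1 x \<le> R \<longrightarrow> recoded \<omega> x = recoded \<omega>' x) \<and> h 0 \<omega> \<noteq> h 0 \<omega>')"

text \<open>Apart from the event that the origin is unresolved at level \<open>N\<close>, decoding on the ball of radius \<open>N ^ 9\<close> fails only
  if some walk of a level \<open>n \<le> N\<close> started in that ball is still positive after \<open>N ^ 6\<close> periods.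
  There are polynomially many such walks, and each of them is positive with probability at most
  \<open>N\<^sup>2 * exp (- N\<^sup>2 / 648)\<close>. The power 6 is what makes \<open>N ^ 6 / n ^ 4\<close> at least \<open>N\<^sup>2\<close>; the decoding radius is then of the order
  \<open>N ^ 8\<close>.\<close>

lemma prob_undecodable:
  assumes N: "6 * L + 5 \<le> N" "648 * (10 * CARD('d) + 4) \<le> N"
  shows "prob {\<omega>. undecodable (N ^ 9) \<omega>} \<le> (C + 1) * exp (- min c 1 * N)"
proof -
  let ?D = "CARD('d)"
  let ?E = "\<lambda>n u \<omega>. excess k (needed n \<omega>) (free n \<omega>) u (N ^ 6 * period n - 1)"
  let ?B = "{u :: int ^ 'd. norm1 (u - 0) \<le> N ^ 9}"
  define Bad where "Bad = (\<Union>p\<in>{n0<..N} \<times> ?B. {\<omega>. ?E (fst p) (snd p) \<omega> > 0})"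
  have N0: "1 \<le> N" using N by simp
  have finB: "finite ({n0<..N} \<times> ?B)" by (intro finite_cartesian_product finite_card_norm1_ball) simp
  have Bad_sets: "Bad \<in> events"
    unfolding Bad_def by (intro sets.finite_UN finB sets_iid_Collect) measurable
  have period: "period n \<le> (4 * L + 3) * N" if "n \<le> N" for n
  proof -
    have "L * n \<le> L * N" using that by simp
    moreover have "(4 * L + 3) * N = 4 * (L * N) + 3 * N" by (simp add: algebra_simps)
    moreover have "period n = 4 * (L * n) + 2 * n + 1" by (simp add: period_def reach_def)
    ultimately show ?thesis using that N0 by linarith
  qed
  have pow: "N ^ 6 * N = N ^ 7" "N ^ 7 * N = N ^ 8" "N * N ^ 8 = N ^ 9"
    by (simp_all add: power_Suc2[symmetric] power_Suc[symmetric])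
  have sub: "{\<omega>. undecodable (N ^ 9) \<omega>} \<subseteq> {\<omega>. U N 0 \<omega>} \<union> Bad"
  proof (rule subsetI, rule ccontr)
    fix \<omega> assume u: "\<omega> \<in> {\<omega>. undecodable (N ^ 9) \<omega>}" and nb: "\<omega> \<notin> {\<omega>. U N 0 \<omega>} \<union> Bad"
    obtain \<omega>' where agree: "\<And>x. norm1 x \<le> N ^ 9 \<Longrightarrow> recoded \<omega> x = recoded \<omega>' x" and neq: "h 0 \<omega> \<noteq> h 0 \<omega>'"
      using u by (auto simp: undecodable_def)
    have "h 0 \<omega> = h 0 \<omega>'"
    proof (rule decode[of N \<omega> "N ^ 9" "(4 * L + 3) * N ^ 7" \<omega>', OF _ _ _ agree])
      show "\<not> U N 0 \<omega>" using nb by simp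
      fix n and v :: "int ^ 'd" assume n: "n0 < n" "n \<le> N" and v: "norm1 v \<le> N ^ 9"
      have "\<omega> \<notin> Bad" using nb by simp
      then have "?E n v \<omega> \<le> 0" using n v unfolding Bad_def by force
      moreover have "N ^ 6 * period n - 1 \<le> (4 * L + 3) * N ^ 7"
      proof -
        have "N ^ 6 * period n \<le> N ^ 6 * ((4 * L + 3) * N)" using period[OF n(2)] by simp
        also have "\<dots> = (4 * L + 3) * N ^ 7" by (subst mult.left_commute) (simp only: pow(1))
        finally show ?thesis by simp
      qed
      ultimately show "\<exists>j\<le>(4 * L + 3) * N ^ 7. excess k (needed n \<omega>) (free n \<omega>) v j \<le> 0" by blast
    next
      have N7: "N \<le> N ^ 7" using N0 by (rule self_le_power) simp
      have "2 * L * N \<le> 2 * L * N ^ 7" using N7 by simp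
      moreover have "N + 1 \<le> 2 * N ^ 7" using N7 N0 by linarith
      moreover have "(6 * L + 5) * N ^ 7 = 2 * L * N ^ 7 + (4 * L + 3) * N ^ 7 + 2 * N ^ 7"
        by (simp add: algebra_simps)
      ultimately have "2 * L * N + (4 * L + 3) * N ^ 7 + N + 1 \<le> (6 * L + 5) * N ^ 7" by linarith
      also have "\<dots> \<le> N * N ^ 7" using N(1) by (rule mult_le_mono1)
      finally have "N * (2 * L * N + (4 * L + 3) * N ^ 7 + N + 1) \<le> N * (N * N ^ 7)" by (rule mult_le_mono2)
      also have "\<dots> = N ^ 9" using pow by (simp add: mult.commute)
      finally show "N * (2 * L * N + (4 * L + 3) * N ^ 7 + N + 1) \<le> N ^ 9" .
    qed
    then show False using neq by simp
  qed
  have Ebound: "prob {\<omega>. ?E n u \<omega> > 0} \<le> real N ^ 2 * exp (- (real N)\<^sup>2 / 648)" if n: "n0 < n" "n \<le> N" for n u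
  proof -
    have "prob {\<omega>. ?E n u \<omega> > 0} \<le> real (period n) * exp (- real (N ^ 6) / (648 * (real n) ^ 4))"
      by (rule prob_excess[OF n(1)]) (use N0 in simp)
    also have "\<dots> \<le> real (N * N) * exp (- (real N)\<^sup>2 / 648)"
    proof (rule mult_mono)
      have "(4 * L + 3) * N \<le> N * N" by (rule mult_le_mono1) (use N(1) in linarith)
      then have "period n \<le> N * N" using period[OF n(2)] by (rule order_trans[rotated])
      then show "real (period n) \<le> real (N * N)" by (rule of_nat_mono)
      have "(real n) ^ 4 * (real N)\<^sup>2 \<le> (real N) ^ 4 * (real N)\<^sup>2"
        using n(2) by (intro mult_right_mono power_mono) auto
      also have "\<dots> = real N ^ 6" by (simp flip: power_add)
      finally have "(real N)\<^sup>2 / 648 \<le> real (N ^ 6) / (648 * (real n) ^ 4)"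
        using n(1) by (simp add: field_simps)
      then show "exp (- real (N ^ 6) / (648 * (real n) ^ 4)) \<le> exp (- (real N)\<^sup>2 / 648)" by simp
    qed auto
    finally show ?thesis by (simp add: power2_eq_square)
  qed
  have card: "real (card ({n0<..N} \<times> ?B)) \<le> real N * real N ^ (10 * ?D)"
  proof -
    have "card ?B \<le> (2 * N ^ 9 + 1) ^ ?D" by (rule finite_card_norm1_ball(2))
    also have "\<dots> \<le> (N ^ 10) ^ ?D"
    proof (rule power_mono)
      have "2 * N ^ 9 + 1 \<le> 3 * N ^ 9" using N0 by simp
      also have "\<dots> \<le> N * N ^ 9" using N(1) by (intro mult_le_mono1) simp
      also have "\<dots> = N ^ 10" by (simp flip: power_Suc)
      finally show "2 * N ^ 9 + 1 \<le> N ^ 10" .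
    qed simp
    finally have "card ({n0<..N} \<times> ?B) \<le> N * N ^ (10 * ?D)"
      unfolding card_cartesian_product by (intro mult_le_mono) (auto simp: power_mult)
    then have "real (card ({n0<..N} \<times> ?B)) \<le> real (N * N ^ (10 * ?D))" by (rule of_nat_mono)
    then show ?thesis by simp
  qed
  have "prob Bad \<le> (\<Sum>p\<in>{n0<..N} \<times> ?B. prob {\<omega>. ?E (fst p) (snd p) \<omega> > 0})"
    unfolding Bad_def by (intro finite_measure_subadditive_finite finB image_subsetI sets_iid_Collect) measurable
  also have "\<dots> \<le> (\<Sum>p\<in>{n0<..N} \<times> ?B. real N ^ 2 * exp (- (real N)\<^sup>2 / 648))"
    by (intro sum_mono Ebound) auto
  also have "\<dots> = real (card ({n0<..N} \<times> ?B)) * (real N ^ 2 * exp (- (real N)\<^sup>2 / 648))" by simp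
  also have "\<dots> \<le> (real N * real N ^ (10 * ?D)) * (real N ^ 2 * exp (- (real N)\<^sup>2 / 648))"
    by (intro mult_right_mono card) simp
  also have "\<dots> = real N ^ (10 * ?D + 3) * exp (- (real N)\<^sup>2 / 648)"
    by (simp add: power_add power2_eq_square power3_eq_cube)
  also have "\<dots> \<le> exp (real N) ^ (10 * ?D + 3) * exp (- (real N)\<^sup>2 / 648)"
    by (intro mult_right_mono power_mono) (auto intro: less_imp_le[OF less_le_trans[OF _ exp_ge_add_one_self]])
  also have "\<dots> = exp (real (10 * ?D + 3) * real N - (real N)\<^sup>2 / 648)"
    by (simp add: exp_of_nat_mult[symmetric] exp_add[symmetric] mult_exp_exp)
  also have "\<dots> \<le> exp (- real N)"
  proof -
    have "real (648 * (10 * ?D + 4)) * real N \<le> real N * real N"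
      using N(2) by (intro mult_right_mono of_nat_mono) auto
    then show ?thesis by (simp add: power2_eq_square algebra_simps)
  qed
  finally have bad: "prob Bad \<le> exp (- real N)" .
  have "prob {\<omega>. undecodable (N ^ 9) \<omega>} \<le> prob ({\<omega>. U N 0 \<omega>} \<union> Bad)"
    by (rule finite_measure_mono[OF sub]) (intro sets.Un Bad_sets sets_iid_Collect measurable_U)
  also have "\<dots> \<le> prob {\<omega>. U N 0 \<omega>} + prob Bad"
    by (intro measure_Un_le Bad_sets sets_iid_Collect measurable_U)
  also have "\<dots> \<le> C * exp (- c * N) + exp (- real N)"
    by (intro add_mono U_tail bad)
  also have "\<dots> \<le> C * exp (- min c 1 * N) + exp (- min c 1 * N)"
  proof -
    have "min c 1 * real N \<le> c * real N" "min c 1 * real N \<le> 1 * real N"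
      by (intro mult_right_mono; simp)+
    then show ?thesis using C_pos by (intro add_mono mult_left_mono) simp_all
  qed
  also have "\<dots> = (C + 1) * exp (- min c 1 * N)" by (simp add: algebra_simps)
  finally show ?thesis .
qed

end

section \<open>Factors from local decoding\<close>

lemma Inf_enat_eq:
  "Inf {enat r | r. G r} = (if \<exists>r. G r then enat (LEAST r. G r) else \<infinity>)"
proof (cases "\<exists>r. G r")
  case True
  then have "G (LEAST r. G r)" by (rule LeastI_ex)
  then have "Inf {enat r | r. G r} = enat (LEAST r. G r)"
    by (intro antisym Inf_lower Inf_greatest) (auto intro: Least_le)
  then show ?thesis using True by simp
next
  case False
  then show ?thesis by (simp add: Inf_enat_def)
qed

lemma measurable_Inf_enat:
  assumes [measurable]: "\<And>r. Measurable.pred M (G r)"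
  shows "(\<lambda>y. Inf {enat r | r. G r y}) \<in> M \<rightarrow>\<^sub>M count_space UNIV"
proof (rule measurable_count_spaceI)
  fix c
  show "Measurable.pred M (\<lambda>y. Inf {enat r | r. G r y} = c)"
  proof (cases c)
    case (enat n)
    have "(\<lambda>y. Inf {enat r | r. G r y} = c) = (\<lambda>y. G n y \<and> (\<forall>m<n. \<not> G m y))"
    proof
      fix y
      show "(Inf {enat r | r. G r y} = c) = (G n y \<and> (\<forall>m<n. \<not> G m y))"
      proof
        assume e: "Inf {enat r | r. G r y} = c"
        then have ex: "\<exists>r. G r y" and n: "n = (LEAST r. G r y)"
          using enat by (auto simp: Inf_enat_eq split: if_splits)
        show "G n y \<and> (\<forall>m<n. \<not> G m y)"
          unfolding n using LeastI_ex[OF ex] by (blast dest: not_less_Least)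
      next
        assume g: "G n y \<and> (\<forall>m<n. \<not> G m y)"
        then have "(LEAST r. G r y) = n" by (intro Least_equality) (auto intro: leI)
        then show "Inf {enat r | r. G r y} = c" using g enat by (auto simp: Inf_enat_eq)
      qed
    qed
    then show ?thesis by simp
  next
    case infinity
    have "(\<lambda>y. Inf {enat r | r. G r y} = c) = (\<lambda>y. \<forall>n. \<not> G n y)"
      using infinity by (auto simp: Inf_enat_eq)
    then show ?thesis by simp
  qed
qed

definition agree_on_ball :: "nat \<Rightarrow> (int ^ 'd::finite \<Rightarrow> 't) \<Rightarrow> (int ^ 'd \<Rightarrow> 't) \<Rightarrow> bool" where
  "agree_on_ball r y y' \<longleftrightarrow> (\<forall>x. norm1 x \<le> r \<longrightarrow> y x = y' x)"

text \<open>There are finitely many patterns on a finite window, so the event is a finite union of cylinders.\<close>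

lemma measurable_pred_window:
  fixes T :: "'t set"
  assumes T: "finite T"
    and local: "\<And>y y'. y \<in> space N \<Longrightarrow> y' \<in> space N \<Longrightarrow> agree_on_ball r (X y) (X y') \<Longrightarrow> A y = A y'"
    and meas: "\<And>x. (\<lambda>y. X y x) \<in> N \<rightarrow>\<^sub>M count_space T"
  shows "Measurable.pred N A"
proof -
  let ?B = "{x :: int ^ 'd::finite. norm1 x \<le> r}"
  have B: "finite ?B" using finite_card_norm1_ball(1)[of 0 r] by simp
  have inT: "X y x \<in> T" if "y \<in> space N" for x y
    using measurable_space[OF meas that] by simp
  let ?W = "{w \<in> PiE ?B (\<lambda>_. T). \<exists>y'\<in>space N. A y' \<and> (\<forall>x\<in>?B. X y' x = w x)}"
  have W: "finite ?W" by (rule finite_subset[OF _ finite_PiE[OF B, of "\<lambda>_. T"]]) (use T in auto)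
  have [measurable]: "Measurable.pred N (\<lambda>y. X y x = c)" for x c
    by (rule measurable_compose[OF meas]) simp
  have "A y = (\<exists>w\<in>?W. \<forall>x\<in>?B. X y x = w x)" if y: "y \<in> space N" for y
  proof
    assume "A y"
    then show "\<exists>w\<in>?W. \<forall>x\<in>?B. X y x = w x"
      using y inT[OF y] by (intro bexI[of _ "restrict (X y) ?B"]) auto
  next
    assume "\<exists>w\<in>?W. \<forall>x\<in>?B. X y x = w x"
    then obtain w y' where w: "y' \<in> space N" "A y'" "\<forall>x\<in>?B. X y' x = w x" "\<forall>x\<in>?B. X y x = w x"
      by auto
    then have "agree_on_ball r (X y') (X y)" by (simp add: agree_on_ball_def)
    then show "A y" using local[OF w(1) y] w(2) by simp
  qed
  then have "Measurable.pred N A = Measurable.pred N (\<lambda>y. \<exists>w\<in>?W. \<forall>x\<in>?B. X y x = w x)"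
    by (intro measurable_cong) auto
  also have "\<dots>" using W B by (intro pred_intros_finite) auto
  finally show ?thesis .
qed

locale layered_factor = layered_field_tail q mark L U h k n0 C c
  for q :: "'b::finite pmf" and mark L
    and U :: "nat \<Rightarrow> int ^ 'd::finite \<Rightarrow> ((int ^ 'd) \<times> int \<Rightarrow> 'b) \<Rightarrow> bool"
    and h :: "int ^ 'd \<Rightarrow> ((int ^ 'd) \<times> int \<Rightarrow> 'b) \<Rightarrow> 's::countable" and k n0 C c
begin

text \<open>The first conjunct makes certificates consistent: a field that fits the larger of two windows fits both.
  Without it, a pattern that no field produces would certify every value.\<close>

definition certified :: "nat \<Rightarrow> 's \<Rightarrow> (int ^ 'd \<Rightarrow> nat) \<Rightarrow> bool" where
  "certified r s y \<longleftrightarrow> (\<exists>\<omega>. agree_on_ball r (recoded \<omega>) y) \<and>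
     (\<forall>\<omega>. agree_on_ball r (recoded \<omega>) y \<longrightarrow> h 0 \<omega> = s)"

definition decoder :: "(int ^ 'd \<Rightarrow> nat) \<Rightarrow> 's" where
  "decoder y = (if \<exists>s r. certified r s y then SOME s. \<exists>r. certified r s y else undefined)"

definition factor :: "(int ^ 'd \<Rightarrow> nat) \<Rightarrow> int ^ 'd \<Rightarrow> 's" where
  "factor y v = decoder (translate v y)"

definition code_law :: "(int ^ 'd \<Rightarrow> nat) measure" where
  "code_law = distr (iid q) (field_space (count_space codes)) recoded"

lemma certified_unique:
  assumes "certified r s y" "certified r' s' y"
  shows "s = s'"
proof -
  have *: "s = s'" if c: "certified r s y" "certified r' s' y" and r: "r \<le> r'" for r r' s s'
  proof -
    obtain \<omega> where \<omega>: "agree_on_ball r' (recoded \<omega>) y" using c(2) by (auto simp: certified_def)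
    then have "agree_on_ball r (recoded \<omega>) y" using r by (auto simp: agree_on_ball_def)
    then show ?thesis using \<omega> c by (auto simp: certified_def)
  qed
  show ?thesis using *[OF assms] *[OF assms(2,1)] by (cases "r \<le> r'") auto
qed

lemma decoder_eqI: "certified r s y \<Longrightarrow> decoder y = s"
proof -
  assume c: "certified r s y"
  have "(SOME s. \<exists>r. certified r s y) = s"
    by (rule some_equality) (use c certified_unique[OF c] in blast)+
  then show "decoder y = s" using c by (auto simp: decoder_def)
qed

lemma certified_cong: "agree_on_ball r y y' \<Longrightarrow> certified r s y = certified r s y'"
  by (simp add: certified_def agree_on_ball_def)

lemma measurable_code_component: "(\<lambda>y. y (x :: int ^ 'd)) \<in> (field_space (count_space codes)) \<rightarrow>\<^sub>M count_space codes"
  unfolding field_space_def by (rule measurable_component_singleton) simp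

lemma measurable_certified [measurable]: "Measurable.pred (field_space (count_space codes)) (certified r s)"
  by (rule measurable_pred_window[OF finite_codes certified_cong measurable_code_component])

lemma measurable_decoder: "decoder \<in> (field_space (count_space codes)) \<rightarrow>\<^sub>M count_space UNIV"
proof (rule measurable_count_spaceI)
  fix s
  have "(\<lambda>y. decoder y = s) = (\<lambda>y. (\<exists>r. certified r s y) \<or> (s = undefined \<and> \<not> (\<exists>s r. certified r s y)))"
  proof
    fix y
    show "(decoder y = s) = ((\<exists>r. certified r s y) \<or> (s = undefined \<and> \<not> (\<exists>s r. certified r s y)))"
    proof (cases "\<exists>s r. certified r s y")
      case True
      then obtain s' r' where c: "certified r' s' y" by blast
      have "(\<exists>r. certified r s y) \<longleftrightarrow> s' = s"
        using c certified_unique[OF c] by blast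
      then show ?thesis using decoder_eqI[OF c] True by simp
    next
      case False
      then show ?thesis by (auto simp: decoder_def)
    qed
  qed
  also have "Measurable.pred (field_space (count_space codes)) \<dots>" by measurable
  finally show "Measurable.pred (field_space (count_space codes)) (\<lambda>y. decoder y = s)" .
qed

lemma measurable_translate: "translate (v :: int ^ 'd) \<in> (field_space (count_space codes)) \<rightarrow>\<^sub>M (field_space (count_space codes))"
proof -
  have "(\<lambda>y x. translate v y x) \<in> (field_space (count_space codes)) \<rightarrow>\<^sub>M (field_space (count_space codes))"
    unfolding field_space_def
  proof (rule measurable_PiM_single'[where f="\<lambda>x y. translate v y x"])
    show "(\<lambda>y. translate v y x) \<in> PiM UNIV (\<lambda>_. count_space codes) \<rightarrow>\<^sub>M count_space codes" for x
      using measurable_code_component unfolding field_space_def translate_def .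
  qed (auto simp: space_PiM translate_def)
  then show ?thesis by simp
qed

lemma measurable_factor: "factor \<in> (field_space (count_space codes)) \<rightarrow>\<^sub>M field_space (count_space UNIV)"
proof -
  have "(\<lambda>y v. factor y v) \<in> (field_space (count_space codes)) \<rightarrow>\<^sub>M field_space (count_space UNIV)"
    unfolding field_space_def[of "count_space UNIV"]
  proof (rule measurable_PiM_single'[where f="\<lambda>v y. factor y v"])
    show "(\<lambda>y. factor y v) \<in> (field_space (count_space codes)) \<rightarrow>\<^sub>M count_space UNIV" for v
      unfolding factor_def by (rule measurable_compose[OF measurable_translate measurable_decoder])
  qed auto
  then show ?thesis by simp
qed

lemma factor_translate: "factor (translate u y) = translate u (factor y)"
  by (simp add: fun_eq_iff factor_def translate_def ac_simps)

lemma certified_recoded: "\<not> undecodable r \<omega> \<Longrightarrow> certified r (h 0 \<omega>) (recoded \<omega>)"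
  unfolding certified_def undecodable_def agree_on_ball_def by metis

text \<open>If two fields with the same pattern have different values at the origin, then every field with that
  pattern differs from one of them. So decodability is a property of the pattern.\<close>

lemma undecodable_cong:
  assumes "agree_on_ball r (recoded \<omega>) (recoded \<omega>')"
  shows "undecodable r \<omega> = undecodable r \<omega>'"
  using assms unfolding undecodable_def agree_on_ball_def by metis

lemma measurable_undecodable [measurable]: "Measurable.pred (iid q) (undecodable r)"
  by (rule measurable_pred_window[OF finite_codes undecodable_cong measurable_recoded_at])

lemma AE_decodable: "AE \<omega> in iid q. \<exists>r. \<not> undecodable r \<omega>"
proof -
  let ?p = "prob {\<omega>. \<forall>r. undecodable r \<omega>}"
  have "?p \<le> 0"
  proof (rule tendsto_lowerbound)
    have "(\<lambda>N. (C + 1) * exp (- min c 1) ^ N) \<longlonglongrightarrow> (C + 1) * 0"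
      using c_pos by (intro tendsto_intros LIMSEQ_realpow_zero) auto
    then show "(\<lambda>N. (C + 1) * exp (- min c 1 * real N)) \<longlonglongrightarrow> 0"
      by (simp add: exp_of_nat_mult[symmetric] mult.commute)
    show "\<forall>\<^sub>F N in sequentially. ?p \<le> (C + 1) * exp (- min c 1 * real N)"
      using eventually_ge_at_top[of "6 * L + 5"] eventually_ge_at_top[of "648 * (10 * CARD('d) + 4)"]
    proof eventually_elim
      case (elim N)
      have "?p \<le> prob {\<omega>. undecodable (N ^ 9) \<omega>}"
        by (intro finite_measure_mono sets_iid_Collect measurable_undecodable) auto
      also have "\<dots> \<le> (C + 1) * exp (- min c 1 * real N)" by (rule prob_undecodable[OF elim])
      finally show ?case .
    qed
  qed simp
  then have "?p = 0" by (simp add: measure_le_0_iff)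
  moreover have "{\<omega>. \<forall>r. undecodable r \<omega>} \<in> sets (iid q)"
    by (intro sets_iid_Collect) measurable
  ultimately show ?thesis
    by (intro AE_I[where N="{\<omega>. \<forall>r. undecodable r \<omega>}"]) (auto simp: emeasure_eq_measure)
qed

lemma AE_factor_recoded: "AE \<omega> in iid q. \<forall>v. factor (recoded \<omega>) v = h v \<omega>"
proof (subst AE_all_countable, rule allI)
  fix v
  have "AE \<omega> in distr (iid q) (iid q) (shift_field v). \<exists>r. \<not> undecodable r \<omega>"
    unfolding distr_shift by (rule AE_decodable)
  then have "AE \<omega> in iid q. \<exists>r. \<not> undecodable r (shift_field v \<omega>)"
    by (rule AE_distrD[OF measurable_shift])
  then show "AE \<omega> in iid q. factor (recoded \<omega>) v = h v \<omega>"
  proof eventually_elim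
    case (elim \<omega>)
    then obtain r where "\<not> undecodable r (shift_field v \<omega>)" by blast
    from decoder_eqI[OF certified_recoded[OF this]]
    have "decoder (recoded (shift_field v \<omega>)) = h 0 (shift_field v \<omega>)" .
    moreover have "recoded (shift_field v \<omega>) = translate v (recoded \<omega>)"
      by (simp add: fun_eq_iff recoded_shift translate_def)
    moreover have "h 0 (shift_field v \<omega>) = h v \<omega>" using h_shift[of 0 v \<omega>] by simp
    ultimately show ?case by (simp add: factor_def)
  qed
qed

lemma prob_space_code_law: "prob_space code_law"
  unfolding code_law_def by (rule prob_space_distr[OF measurable_recoded])

lemma sets_code_law: "sets code_law = sets (field_space (count_space codes))"
  by (simp add: code_law_def)

lemma factor_0: "factor y 0 = decoder y"
  by (simp add: factor_def translate_def)

lemma coding_radius_le: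
  assumes "\<not> undecodable r \<omega>"
  shows "coding_radius code_law factor (recoded \<omega>) \<le> enat r"
  unfolding coding_radius_def
proof (rule Inf_lower, intro CollectI exI conjI)
  have c: "certified r (h 0 \<omega>) (recoded \<omega>)" by (rule certified_recoded[OF assms])
  have "factor y' 0 = factor (recoded \<omega>) 0" if "\<forall>v. norm1 v \<le> r \<longrightarrow> y' v = recoded \<omega> v" for y'
  proof -
    have "certified r (h 0 \<omega>) y'"
      using c certified_cong[of r y' "recoded \<omega>"] that by (simp add: agree_on_ball_def)
    then show ?thesis using decoder_eqI c by (metis factor_0)
  qed
  then show "AE y' in code_law. (\<forall>v. norm1 v \<le> r \<longrightarrow> y' v = recoded \<omega> v) \<longrightarrow> factor y' 0 = factor (recoded \<omega>) 0"
    by (intro AE_I2 impI)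
qed simp

text \<open>The condition for radius \<open>r\<close> depends on the input through its pattern on the ball and through its value at
  the origin.\<close>

lemma measurable_coding_radius:
  "coding_radius code_law factor \<in> code_law \<rightarrow>\<^sub>M count_space UNIV"
proof -
  have "Measurable.pred (field_space (count_space codes)) (\<lambda>y. AE y' in code_law. (\<forall>v. norm1 v \<le> r \<longrightarrow> y' v = y v) \<longrightarrow> factor y' 0 = factor y 0)"
    (is "Measurable.pred _ ?G") for r
  proof -
    let ?H = "\<lambda>s y. AE y' in code_law. (\<forall>v. norm1 v \<le> r \<longrightarrow> y' v = y v) \<longrightarrow> factor y' 0 = s"
    have H [measurable]: "Measurable.pred (field_space (count_space codes)) (?H s)" for s
    proof (rule measurable_pred_window[where r=r, OF finite_codes _ measurable_code_component])
      fix y y' :: "int ^ 'd \<Rightarrow> nat" assume "agree_on_ball r y y'"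
      then have "(\<forall>v. norm1 v \<le> r \<longrightarrow> z v = y v) = (\<forall>v. norm1 v \<le> r \<longrightarrow> z v = y' v)" for z
        by (auto simp: agree_on_ball_def)
      then show "?H s y = ?H s y'" by simp
    qed
    have [measurable]: "Measurable.pred (field_space (count_space codes)) (\<lambda>y. factor y 0 = s)" for s
      unfolding factor_0 by (rule measurable_compose[OF measurable_decoder]) simp
    have "?G = (\<lambda>y. \<exists>s. factor y 0 = s \<and> ?H s y)" by auto
    also have "Measurable.pred (field_space (count_space codes)) \<dots>" by measurable
    finally show ?thesis .
  qed
  from measurable_Inf_enat[OF this] show ?thesis
    unfolding coding_radius_def[abs_def] measurable_cong_sets[OF sets_code_law refl] .
qed

lemma coding_radius_tails: "stretched_exponential_tails code_law (coding_radius code_law factor)"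
proof (rule stretched_exponential_tailsI[OF prob_space_code_law measurable_coding_radius,
      of "C + 1" "min c 1" "max (6 * L + 5) (648 * (10 * CARD('d) + 4))"])
  fix N assume "max (6 * L + 5) (648 * (10 * CARD('d) + 4)) \<le> N"
  then have N: "6 * L + 5 \<le> N" "648 * (10 * CARD('d) + 4) \<le> N" by auto
  let ?R = "coding_radius code_law factor"
  have S: "{y \<in> space code_law. enat (N ^ 9) < ?R y} \<in> sets (field_space (count_space codes))"
    using measurable_compose[OF measurable_coding_radius, of "\<lambda>x. enat (N ^ 9) < x" "count_space UNIV"]
    by (simp add: pred_def sets_code_law[symmetric])
  have "measure code_law {y \<in> space code_law. enat (N ^ 9) < ?R y}
      = prob (recoded -` {y \<in> space code_law. enat (N ^ 9) < ?R y} \<inter> space (iid q))"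
    unfolding code_law_def[THEN arg_cong, of "\<lambda>M. measure M {y \<in> space code_law. enat (N ^ 9) < ?R y}"]
    by (rule measure_distr[OF measurable_recoded S])
  also have "\<dots> \<le> prob {\<omega>. undecodable (N ^ 9) \<omega>}"
    by (intro finite_measure_mono sets_iid_Collect measurable_undecodable)
      (use coding_radius_le in \<open>auto simp: not_le[symmetric]\<close>)
  also have "\<dots> \<le> (C + 1) * exp (- min c 1 * real N)" by (rule prob_undecodable[OF N])
  finally show "measure code_law {y \<in> space code_law. enat (N ^ 9) < ?R y} \<le> (C + 1) * exp (- min c 1 * real N)" .
qed (use C_pos c_pos in auto)

lemma AE_coding_radius_finite: "AE y in code_law. coding_radius code_law factor y < \<infinity>"
proof -
  have [measurable]: "Measurable.pred (field_space (count_space codes)) (\<lambda>y. coding_radius code_law factor y < \<infinity>)"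
    using measurable_compose[OF measurable_coding_radius, of "\<lambda>x. x < \<infinity>" "count_space UNIV"]
    by (simp add: measurable_cong_sets[OF sets_code_law refl])
  show ?thesis
    unfolding code_law_def[THEN arg_cong, of "\<lambda>M. AE y in M. coding_radius code_law factor y < \<infinity>"]
  proof (subst AE_distr_iff[OF measurable_recoded])
    show "{y \<in> space (field_space (count_space codes)). coding_radius code_law factor y < \<infinity>} \<in> sets (field_space (count_space codes))" by measurable
    show "AE \<omega> in iid q. coding_radius code_law factor (recoded \<omega>) < \<infinity>"
      using AE_decodable
    proof eventually_elim
      case (elim \<omega>)
      then obtain r where "coding_radius code_law factor (recoded \<omega>) \<le> enat r"
        using coding_radius_le by blast
      then show ?case by (rule le_less_trans) simp
    qed
  qed
qed

lemma code_law_product: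
  obtains \<nu> where "code_law = (\<Pi>\<^sub>M x\<in>UNIV. \<nu>)" "prob_space \<nu>" "sets \<nu> = sets (count_space codes)"
  using distr_plain distr_recoded unfolding code_law_def by metis

lemma field_law_code_law: "field_law code_law (count_space codes) (\<lambda>v y. y v) = code_law"
  unfolding field_law_def by (simp add: distr_id2 sets_code_law)

lemma distr_code_law_component:
  assumes "code_law = (\<Pi>\<^sub>M x\<in>UNIV. \<nu>)" "prob_space \<nu>" "sets \<nu> = sets (count_space codes)"
  shows "distr code_law (count_space codes) (\<lambda>y. y v) = \<nu>"
proof -
  have "distr code_law (count_space codes) (\<lambda>y. y v) = distr (\<Pi>\<^sub>M x\<in>UNIV. \<nu>) \<nu> (\<lambda>y. y v)"
    using assms by (intro distr_cong) auto
  also have "\<dots> = \<nu>" by (rule distr_PiM_component) (use assms in auto)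
  finally show ?thesis .
qed

lemma iid_process_code_law: "iid_process code_law (count_space codes) (\<lambda>v y. y v)"
proof -
  obtain \<nu> where \<nu>: "code_law = (\<Pi>\<^sub>M x\<in>UNIV. \<nu>)" "prob_space \<nu>" "sets \<nu> = sets (count_space codes)"
    by (rule code_law_product)
  interpret code: prob_space code_law by (rule prob_space_code_law)
  have meas: "(\<lambda>y. y v) \<in> code_law \<rightarrow>\<^sub>M count_space codes" for v
    using measurable_code_component unfolding measurable_cong_sets[OF sets_code_law refl] .
  have "code.indep_vars (\<lambda>_. count_space codes) (\<lambda>v y. y v) UNIV"
    by (subst code.indep_vars_iff_distr_eq_PiM)
      (auto simp: meas distr_code_law_component[OF \<nu>] restrict_UNIV \<nu>(1)[symmetric]
        field_law_code_law[unfolded field_law_def field_space_def])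
  then show ?thesis
    unfolding iid_process_def using prob_space_code_law distr_code_law_component[OF \<nu>] by simp
qed

lemma stationary_code_law: "stationary_field code_law (count_space codes) (\<lambda>v y. y v)"
proof -
  obtain \<nu> where \<nu>: "code_law = (\<Pi>\<^sub>M x\<in>UNIV. \<nu>)" "prob_space \<nu>" "sets \<nu> = sets (count_space codes)"
    by (rule code_law_product)
  have meas: "(\<lambda>y. y v) \<in> code_law \<rightarrow>\<^sub>M count_space codes" for v
    using measurable_code_component unfolding measurable_cong_sets[OF sets_code_law refl] .
  have "field_law code_law (count_space codes) (\<lambda>v y. y (v + u)) = code_law" for u
  proof -
    have "field_law code_law (count_space codes) (\<lambda>v y. y (v + u)) =
        distr (\<Pi>\<^sub>M x\<in>UNIV. \<nu>) (\<Pi>\<^sub>M x\<in>UNIV. \<nu>) (\<lambda>y. \<lambda>v\<in>UNIV. y (v + u))"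
      unfolding field_law_def using \<nu>(1) sets_code_law by (intro distr_cong) (auto simp: restrict_UNIV)
    also have "\<dots> = (\<Pi>\<^sub>M x\<in>UNIV. \<nu>)"
      by (rule distr_PiM_reindex[where M="\<lambda>_. \<nu>"]) (use \<nu> in \<open>auto simp: inj_on_def\<close>)
    finally show ?thesis using \<nu>(1) by simp
  qed
  then show ?thesis
    unfolding stationary_field_def random_field_def
    using meas prob_space_code_law field_law_code_law by simp
qed

lemma AE_resolved: "AE \<omega> in iid q. \<forall>v. \<exists>n. \<not> U n v \<omega>"
proof (subst AE_all_countable, rule allI)
  fix v
  let ?p = "prob {\<omega>. \<forall>n. U n v \<omega>}"
  have "?p \<le> 0"
  proof (rule tendsto_lowerbound)
    have "(\<lambda>n. C * exp (- c) ^ n) \<longlonglongrightarrow> C * 0"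
      using c_pos by (intro tendsto_intros LIMSEQ_realpow_zero) auto
    then show "(\<lambda>n. C * exp (- c * real n)) \<longlonglongrightarrow> 0"
      by (simp add: exp_of_nat_mult[symmetric] mult.commute)
    have "?p \<le> C * exp (- c * real n)" for n
    proof -
      have "?p \<le> prob {\<omega>. U n v \<omega>}"
        by (intro finite_measure_mono sets_iid_Collect measurable_U) auto
      also have "\<dots> \<le> C * exp (- c * real n)"
        unfolding prob_U_shift[of n v] by (rule U_tail)
      finally show ?thesis .
    qed
    then show "\<forall>\<^sub>F n in sequentially. ?p \<le> C * exp (- c * real n)" by simp
  qed simp
  then have "?p = 0" by (simp add: measure_le_0_iff)
  moreover have "{\<omega>. \<forall>n. U n v \<omega>} \<in> sets (iid q)"
    by (intro sets_iid_Collect) measurable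
  ultimately show "AE \<omega> in iid q. \<exists>n. \<not> U n v \<omega>"
    by (intro AE_I[where N="{\<omega>. \<forall>n. U n v \<omega>}"]) (auto simp: emeasure_eq_measure)
qed

text \<open>The approximations \<open>X n\<close> are eventually equal to \<open>h\<close>, hence to the factor, almost surely at each
  site. So the probabilities of cylinders converge to those of the factor, and these determine the
  law.\<close>

lemma law_factor_eqI:
  fixes X :: "nat \<Rightarrow> int ^ 'd \<Rightarrow> ((int ^ 'd) \<times> int \<Rightarrow> 'b) \<Rightarrow> 's"
  assumes "prob_space \<mu>" and sets: "sets \<mu> = sets (field_space (count_space UNIV))"
    and meas: "\<And>n v. X n v \<in> iid q \<rightarrow>\<^sub>M count_space UNIV"
    and lim: "\<And>v \<omega> n m. \<not> U m v \<omega> \<Longrightarrow> m \<le> n \<Longrightarrow> X n v \<omega> = h v \<omega>"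
    and cylinders: "\<And>B A. finite B \<Longrightarrow>
        (\<lambda>n. prob {\<omega>. \<forall>v\<in>B. X n v \<omega> \<in> A v}) \<longlonglongrightarrow> measure \<mu> {y. \<forall>v\<in>B. y v \<in> A v}"
  shows "distr (iid q) (field_space (count_space UNIV)) (\<lambda>\<omega>. factor (recoded \<omega>)) = \<mu>"
proof -
  interpret \<mu>: prob_space \<mu> by fact
  let ?S = "field_space (count_space UNIV) :: (int ^ 'd \<Rightarrow> 's) measure"
  have fm: "(\<lambda>\<omega>. factor (recoded \<omega>)) \<in> iid q \<rightarrow>\<^sub>M ?S"
    by (rule measurable_compose[OF measurable_recoded measurable_factor])
  show ?thesis
  proof (rule measure_eqI_PiM_infinite[of _ UNIV "\<lambda>_. count_space UNIV"])
    show "finite_measure (distr (iid q) ?S (\<lambda>\<omega>. factor (recoded \<omega>)))"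
      by (intro finite_measure_distr fm)
    fix A :: "int ^ 'd \<Rightarrow> 's set" and B :: "(int ^ 'd) set"
    assume B: "finite B"
    let ?C = "{y. \<forall>v\<in>B. y v \<in> A v}"
    have emb: "prod_emb UNIV (\<lambda>_. count_space UNIV) B (Pi\<^sub>E B A) = ?C"
      by (auto simp: prod_emb_def)
    have C_sets: "?C \<in> sets ?S"
      unfolding emb[symmetric] field_space_def using B by (intro sets_PiM_I) auto
    have pm: "Measurable.pred (iid q) (\<lambda>\<omega>. \<forall>v\<in>B. X n v \<omega> \<in> A v)" for n
    proof -
      have "Measurable.pred (iid q) (\<lambda>\<omega>. X n v \<omega> \<in> A v)" for v
        by (rule measurable_compose[OF meas]) simp
      then show ?thesis by (intro pred_intros_finite B)
    qed
    have "(\<lambda>n. prob {\<omega> \<in> space (iid q). \<forall>v\<in>B. X n v \<omega> \<in> A v})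
        \<longlonglongrightarrow> prob {\<omega> \<in> space (iid q). \<forall>v\<in>B. factor (recoded \<omega>) v \<in> A v}"
    proof (rule tendsto_prob_eventually_eq[OF pm])
      have "{\<omega>. \<forall>v\<in>B. factor (recoded \<omega>) v \<in> A v} \<in> sets (iid q)"
        using measurable_sets[OF fm C_sets] by (simp add: vimage_def)
      then show "Measurable.pred (iid q) (\<lambda>\<omega>. \<forall>v\<in>B. factor (recoded \<omega>) v \<in> A v)"
        by (simp add: pred_def)
      show "AE \<omega> in iid q. \<forall>\<^sub>F n in sequentially.
          (\<forall>v\<in>B. X n v \<omega> \<in> A v) = (\<forall>v\<in>B. factor (recoded \<omega>) v \<in> A v)"
        using AE_resolved AE_factor_recoded
      proof eventually_elim
        case (elim \<omega>)
        have "\<forall>\<^sub>F n in sequentially. \<forall>v\<in>B. X n v \<omega> = factor (recoded \<omega>) v"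
        proof (intro eventually_ball_finite B ballI)
          fix v
          obtain m where m: "\<not> U m v \<omega>" using elim(1) by blast
          have "X n v \<omega> = factor (recoded \<omega>) v" if "m \<le> n" for n
            using lim[OF m that] elim(2) by simp
          then show "\<forall>\<^sub>F n in sequentially. X n v \<omega> = factor (recoded \<omega>) v"
            unfolding eventually_sequentially by blast
        qed
        then show ?case by eventually_elim auto
      qed
    qed
    then have "prob {\<omega>. \<forall>v\<in>B. factor (recoded \<omega>) v \<in> A v} = measure \<mu> ?C"
      using LIMSEQ_unique[OF _ cylinders[OF B, of A]] by simp
    then show "emeasure (distr (iid q) ?S (\<lambda>\<omega>. factor (recoded \<omega>))) (prod_emb UNIV (\<lambda>_. count_space UNIV) B (Pi\<^sub>E B A)) =
        emeasure \<mu> (prod_emb UNIV (\<lambda>_. count_space UNIV) B (Pi\<^sub>E B A))"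
      unfolding emb by (simp add: emeasure_distr[OF fm C_sets] vimage_def emeasure_eq_measure \<mu>.emeasure_eq_measure)
  qed (simp_all add: field_space_def sets)
qed

lemma finitary_coding_factor:
  fixes \<mu> :: "(int ^ 'd \<Rightarrow> 's) measure"
  assumes "prob_space \<mu>" and sets: "sets \<mu> = sets (field_space (count_space UNIV))"
    and \<mu>: "distr (iid q) (field_space (count_space UNIV)) (\<lambda>\<omega>. factor (recoded \<omega>)) = \<mu>"
  shows "random_field \<mu> (count_space UNIV) (\<lambda>v y. y v)"
    and "field_law \<mu> (count_space UNIV) (\<lambda>v y. y v) = \<mu>"
    and "finitary_coding code_law (count_space codes) (\<lambda>v y. y v) \<mu> (count_space UNIV) (\<lambda>v y. y v) factor"
proof -
  let ?S = "field_space (count_space UNIV) :: (int ^ 'd \<Rightarrow> 's) measure"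
  have comp: "(\<lambda>y. y v) \<in> \<mu> \<rightarrow>\<^sub>M count_space UNIV" for v
    unfolding measurable_cong_sets[OF sets refl] field_space_def
    by (rule measurable_component_singleton) simp
  show rf: "random_field \<mu> (count_space UNIV) (\<lambda>v y. y v)"
    unfolding random_field_def using assms(1) comp by simp
  show fl: "field_law \<mu> (count_space UNIV) (\<lambda>v y. y v) = \<mu>"
    unfolding field_law_def by (simp add: distr_id2 sets)
  have mf: "factor \<in> code_law \<rightarrow>\<^sub>M ?S"
    unfolding measurable_cong_sets[OF sets_code_law refl] by (rule measurable_factor)
  have law: "distr code_law ?S factor = \<mu>"
    unfolding code_law_def \<mu>[symmetric]
    by (subst distr_distr[OF measurable_factor measurable_recoded]) (simp add: comp_def)
  have mt: "translate u \<in> ?S \<rightarrow>\<^sub>M ?S" for u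
  proof -
    have "(\<lambda>y x. translate u y x) \<in> ?S \<rightarrow>\<^sub>M ?S"
      unfolding field_space_def
    proof (rule measurable_PiM_single'[where f="\<lambda>x y. translate u y x"])
      show "(\<lambda>y. translate u y x) \<in> PiM UNIV (\<lambda>_. count_space UNIV) \<rightarrow>\<^sub>M (count_space UNIV :: 's measure)" for x
        unfolding translate_def by (rule measurable_component_singleton) simp
    qed auto
    then show ?thesis by simp
  qed
  have mtc: "translate u \<in> code_law \<rightarrow>\<^sub>M field_space (count_space codes)" for u
    unfolding measurable_cong_sets[OF sets_code_law refl] by (rule measurable_translate)
  have tc: "distr code_law (field_space (count_space codes)) (translate u) = code_law" for u
    using stationary_code_law field_law_code_law
    unfolding stationary_field_def by (simp add: field_law_def translate_def[abs_def])
  have "distr \<mu> ?S (translate u) = \<mu>" for u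
  proof -
    have "distr \<mu> ?S (translate u) = distr code_law ?S (translate u \<circ> factor)"
      unfolding law[symmetric] by (rule distr_distr[OF mt mf])
    also have "translate u \<circ> factor = factor \<circ> translate u"
      by (simp add: fun_eq_iff factor_translate)
    also have "distr code_law ?S (factor \<circ> translate u) =
        distr (distr code_law (field_space (count_space codes)) (translate u)) ?S factor"
      by (rule distr_distr[OF measurable_factor mtc, symmetric])
    also have "\<dots> = \<mu>" by (simp only: tc law)
    finally show ?thesis .
  qed
  then have st: "stationary_field \<mu> (count_space UNIV) (\<lambda>v y. y v)"
    unfolding stationary_field_def using rf fl
    by (simp add: field_law_def translate_def[abs_def])
  show "finitary_coding code_law (count_space codes) (\<lambda>v y. y v) \<mu> (count_space UNIV) (\<lambda>v y. y v) factor"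
  proof -
    have "field_law code_law (count_space UNIV) (\<lambda>v y. factor (\<lambda>u. y u) v) = \<mu>"
      unfolding field_law_def using law by simp
    then show ?thesis
      unfolding finitary_coding_def is_coding_def field_law_code_law fl
      using stationary_code_law st measurable_factor factor_translate AE_coding_radius_finite by simp
  qed
qed

end

section \<open>Cellular automata\<close>

lemma pca_noise_law:
  assumes "pca_noise M p W"
  shows "(\<lambda>x (v, i). W v i x) \<in> M \<rightarrow>\<^sub>M iid p" "distr M (iid p) (\<lambda>x (v, i). W v i x) = iid p"
proof -
  interpret prob_space M using assms by (simp add: pca_noise_def iid_process_def)
  have indep: "indep_vars (\<lambda>_. count_space UNIV) (\<lambda>(v, i). W v i) UNIV"
    and law: "distr M (count_space UNIV) (W v i) = measure_pmf p" for v i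
    using assms by (auto simp: pca_noise_def iid_process_def)
  have rv: "W v i \<in> M \<rightarrow>\<^sub>M count_space UNIV" for v i
    using indep unfolding indep_vars_def by (metis (mono_tags, lifting) UNIV_I case_prod_conv)
  show meas: "(\<lambda>x (v, i). W v i x) \<in> M \<rightarrow>\<^sub>M iid p"
    by (rule measurable_to_iid) (auto simp: rv split_beta)
  have "distr M (\<Pi>\<^sub>M j\<in>UNIV. count_space UNIV) (\<lambda>x. \<lambda>j\<in>UNIV. (case j of (v, i) \<Rightarrow> W v i) x)
      = (\<Pi>\<^sub>M j\<in>UNIV. distr M (count_space UNIV) (case j of (v, i) \<Rightarrow> W v i))"
    using indep by (subst (asm) indep_vars_iff_distr_eq_PiM) (auto simp: rv)
  also have "\<dots> = iid p"
    unfolding iid_def by (intro arg_cong2[where f=PiM] refl) (auto simp: law fun_eq_iff)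
  finally have "distr M (\<Pi>\<^sub>M j\<in>UNIV. count_space UNIV) (\<lambda>x (v, i). W v i x) = iid p"
    by (simp add: restrict_UNIV case_prod_unfold)
  then show "distr M (iid p) (\<lambda>x (v, i). W v i x) = iid p"
    using distr_cong[OF refl sets_iid[of p], of M "\<lambda>x (v, i). W v i x"] by simp
qed

definition letters :: "('x \<times> int \<Rightarrow> 'a \<times> 'm) \<Rightarrow> 'x \<Rightarrow> int \<Rightarrow> 'a" where
  "letters \<omega> = (\<lambda>v i. fst (\<omega> (v, i)))"

lemma letters_shift: "letters (shift_field u \<omega>) = (\<lambda>v i. letters \<omega> (v + u) i)"
  by (simp add: letters_def shift_field_def)

text \<open>The given probability space need not have room for the marks. Events that look at finitely many
  noise variables can be moved to a product space whose coordinates carry a letter and a mark.\<close>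

lemma prob_noise_eq_prob_letters:
  fixes W :: "int ^ 'd::finite \<Rightarrow> int \<Rightarrow> 'w \<Rightarrow> 'a::finite" and q :: "('a \<times> 'm::finite) pmf"
  assumes noise: "pca_noise M p W" and fst_q: "map_pmf fst q = p"
    and J: "finite J" and A: "\<And>w w'. (\<And>v i. (v, i) \<in> J \<Longrightarrow> w v i = w' v i) \<Longrightarrow> A w = A w'"
  shows "measure M {x \<in> space M. A (\<lambda>v i. W v i x)} = measure (iid q) {\<omega>. A (letters \<omega>)}"
proof -
  let ?A = "\<lambda>\<eta>. A (\<lambda>v i. \<eta> (v, i))"
  have "depends_on J ?A" by (rule depends_onI) (rule A)
  then have "Measurable.pred (iid p) ?A" by (rule measurable_depends_on[OF J])
  then have S: "{\<eta>. ?A \<eta>} \<in> sets (iid p)" by (rule sets_iid_Collect)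
  have "measure M {x \<in> space M. A (\<lambda>v i. W v i x)} = measure (distr M (iid p) (\<lambda>x (v, i). W v i x)) {\<eta>. ?A \<eta>}"
    by (subst measure_distr[OF pca_noise_law(1)[OF noise] S]) (auto intro!: arg_cong[where f="measure M"])
  also have "\<dots> = measure (distr (iid q) (iid p) (\<lambda>\<omega> i. fst (\<omega> i))) {\<eta>. ?A \<eta>}"
    by (simp add: pca_noise_law(2)[OF noise] distr_iid_map[of q fst, unfolded fst_q])
  also have "\<dots> = measure (iid q) {\<omega>. A (letters \<omega>)}"
  proof (subst measure_distr)
    show "(\<lambda>\<omega> i. fst (\<omega> i)) \<in> iid q \<rightarrow>\<^sub>M iid p"
      by (rule measurable_to_iid) (rule measurable_compose[OF measurable_iid_component], simp)
  qed (use S in \<open>auto simp: letters_def intro!: arg_cong[where f="measure (iid q)"]\<close>)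
  finally show ?thesis .
qed

lemma continuous_map_cylinder:
  assumes "finite B"
  shows "continuous_map config_topology euclideanreal (\<lambda>y. of_bool (\<forall>v\<in>B. y v \<in> A v))"
proof -
  have "continuous_map config_topology euclideanreal (\<lambda>y. \<Prod>v\<in>B. of_bool (y v \<in> A v))"
  proof (rule continuous_map_prod[OF assms])
    fix v assume "v \<in> B"
    have "continuous_map config_topology (discrete_topology UNIV) (\<lambda>y. y v)"
      unfolding config_topology_def by (rule continuous_map_product_projection) simp
    from continuous_map_compose[OF this, of euclideanreal "\<lambda>s. of_bool (s \<in> A v)"]
    show "continuous_map config_topology euclideanreal (\<lambda>y. of_bool (y v \<in> A v))"
      by (simp add: comp_def)
  qed
  moreover have "(\<Prod>v\<in>B. of_bool (y v \<in> A v)) = (of_bool (\<forall>v\<in>B. y v \<in> A v) :: real)" for y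
    using assms by (induction B rule: finite_induct) auto
  ultimately show ?thesis by simp
qed

locale pca_rule =
  fixes F F' :: "(int ^ 'd::finite) set"
    and f :: "(int ^ 'd \<Rightarrow> 's::finite) \<Rightarrow> (int ^ 'd \<Rightarrow> 'a::finite) \<Rightarrow> 's"
    and L :: nat
  assumes radius: "u \<in> F \<union> F' \<Longrightarrow> norm1 u \<le> L"
begin

abbreviation "steps \<equiv> pca_steps F F' f"

definition unresolved :: "nat \<Rightarrow> int ^ 'd \<Rightarrow> (int ^ 'd \<Rightarrow> int \<Rightarrow> 'a) \<Rightarrow> bool" where
  "unresolved n v w \<longleftrightarrow> (\<exists>\<xi> \<xi>'. steps w \<xi> (- int n) n v \<noteq> steps w \<xi>' (- int n) n v)"

text \<open>The constant starting state makes the definition commute with translations also at sites that are never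
  resolved.\<close>

definition final_state :: "int ^ 'd \<Rightarrow> (int ^ 'd \<Rightarrow> int \<Rightarrow> 'a) \<Rightarrow> 's" where
  "final_state v w = (let n = LEAST n. \<not> unresolved n v w in steps w (\<lambda>_. undefined) (- int n) n v)"

lemma steps_cong:
  assumes "\<And>u j. j < m \<Longrightarrow> norm1 (u - v) \<le> L * (m - j) \<Longrightarrow> w u (i0 + int j) = w' u (i0 + int j)"
  shows "steps w \<xi> i0 m v = steps w' \<xi> i0 m v"
  using assms
proof (induction m arbitrary: v)
  case (Suc m)
  have "steps w \<xi> i0 m (v + u) = steps w' \<xi> i0 m (v + u)" if u: "u \<in> F" for u
  proof (rule Suc.IH)
    fix x j assume j: "j < m" "norm1 (x - (v + u)) \<le> L * (m - j)"
    have "norm1 (x - v) \<le> norm1 (x - (v + u)) + norm1 u"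
      using norm1_triangle[of "x - (v + u)" u] by simp
    also have "\<dots> \<le> L * (m - j) + L" using j(2) radius[of u] u by simp
    also have "\<dots> = L * (Suc m - j)" using j(1) by (simp add: Suc_diff_le)
    finally show "w x (i0 + int j) = w' x (i0 + int j)" using j(1) by (intro Suc.prems) auto
  qed
  moreover have "w (v + u) (i0 + int m) = w' (v + u) (i0 + int m)" if "u \<in> F'" for u
    using radius[of u] that by (intro Suc.prems) auto
  ultimately show ?case by (simp cong: restrict_cong)
qed simp

definition noise_window :: "nat \<Rightarrow> (int ^ 'd) set \<Rightarrow> ((int ^ 'd) \<times> int) set" where
  "noise_window n B = {(u, int j) | u j. j < n \<and> (\<exists>v\<in>B. norm1 (u - v) \<le> L * n)}"

lemma finite_noise_window: "finite B \<Longrightarrow> finite (noise_window n B)"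
proof (rule finite_subset)
  show "noise_window n B \<subseteq> (\<Union>v\<in>B. {u. norm1 (u - v) \<le> L * n}) \<times> {0..int n}"
    by (auto simp: noise_window_def)
  show "finite B \<Longrightarrow> finite ((\<Union>v\<in>B. {u. norm1 (u - v) \<le> L * n}) \<times> {0..int n})"
    by (intro finite_cartesian_product finite_UN_I finite_card_norm1_ball) simp_all
qed

lemma steps_noise_window:
  assumes "v \<in> B" "\<And>u j. (u, j) \<in> noise_window n B \<Longrightarrow> w u j = w' u j"
  shows "steps w \<xi> 0 n v = steps w' \<xi> 0 n v"
proof (rule steps_cong)
  fix u j assume j: "j < n" "norm1 (u - v) \<le> L * (n - j)"
  have "L * (n - j) \<le> L * n" by simp
  then have "norm1 (u - v) \<le> L * n" using j(2) by linarith
  then have "(u, int j) \<in> noise_window n B" using j(1) assms(1) by (auto simp: noise_window_def)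
  then show "w u (0 + int j) = w' u (0 + int j)" using assms(2) by simp
qed

lemma steps_add: "steps w \<xi> i0 (a + b) = steps w (steps w \<xi> i0 a) (i0 + int a) b"
  by (induction b) (simp_all add: add.assoc)

lemma steps_shift: "steps (\<lambda>u j. w (u + x) j) (\<lambda>u. \<xi> (u + x)) i0 n v = steps w \<xi> i0 n (v + x)"
proof (induction n arbitrary: v)
  case (Suc n)
  have *: "v + u + x = v + x + u" for u by (simp add: add.commute add.left_commute)
  show ?case using Suc by (simp add: *)
qed simp

lemma steps_time_shift: "steps (\<lambda>u j. w u (j + s)) \<xi> i0 n = steps w \<xi> (i0 + s) n"
  by (induction n) (simp_all add: ac_simps)

lemma steps_cone_cong:
  assumes "\<And>u m. 1 \<le> m \<Longrightarrow> m \<le> n \<Longrightarrow> norm1 (u - v) \<le> L * m \<Longrightarrow> w u (- int m) = w' u (- int m)"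
  shows "steps w \<xi> (- int n) n v = steps w' \<xi> (- int n) n v"
proof (rule steps_cong)
  fix u j assume j: "j < n" "norm1 (u - v) \<le> L * (n - j)"
  have "- int n + int j = - int (n - j)" using j(1) by simp
  then show "w u (- int n + int j) = w' u (- int n + int j)"
    using assms[of "n - j" u] j by simp
qed

text \<open>A run from the more distant past passes through some state at time \<open>- n\<close>, and from
  there on the starting state is irrelevant.\<close>

lemma resolved_stable:
  assumes "\<not> unresolved n v w" "n \<le> m"
  shows "steps w \<xi> (- int m) m v = steps w \<xi>' (- int n) n v"
proof -
  have "steps w \<xi> (- int m) m v = steps w (steps w \<xi> (- int m) (m - n)) (- int n) n v"
    using steps_add[of w \<xi> "- int m" "m - n" n] assms(2) by simp
  also have "\<dots> = steps w \<xi>' (- int n) n v"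
    using assms(1) unfolding unresolved_def by blast
  finally show ?thesis .
qed

lemma unresolved_Suc: "unresolved (Suc n) v w \<Longrightarrow> unresolved n v w"
proof (rule ccontr)
  assume u: "unresolved (Suc n) v w" "\<not> unresolved n v w"
  have "steps w \<xi> (- int (Suc n)) (Suc n) v = steps w (\<lambda>_. undefined) (- int n) n v" for \<xi>
    by (rule resolved_stable[OF u(2)]) simp
  then show False using u(1) unfolding unresolved_def by metis
qed

lemma final_state_eq:
  assumes "\<not> unresolved n v w"
  shows "final_state v w = steps w \<xi> (- int n) n v"
proof -
  let ?n = "LEAST n. \<not> unresolved n v w"
  have "\<not> unresolved ?n v w" using assms by (rule LeastI)
  moreover have "?n \<le> n" using assms by (rule Least_le)
  ultimately have "steps w \<xi> (- int n) n v = steps w (\<lambda>_. undefined) (- int ?n) ?n v"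
    by (rule resolved_stable)
  then show ?thesis by (simp add: final_state_def Let_def)
qed

lemma unresolved_shift: "unresolved n (v + x) w = unresolved n v (\<lambda>u j. w (u + x) j)"
proof
  assume "unresolved n (v + x) w"
  then obtain \<xi> \<xi>' where "steps w \<xi> (- int n) n (v + x) \<noteq> steps w \<xi>' (- int n) n (v + x)"
    by (auto simp: unresolved_def)
  then show "unresolved n v (\<lambda>u j. w (u + x) j)"
    unfolding unresolved_def steps_shift[symmetric] by blast
next
  assume "unresolved n v (\<lambda>u j. w (u + x) j)"
  then obtain \<xi> \<xi>' where neq: "steps (\<lambda>u j. w (u + x) j) \<xi> (- int n) n v \<noteq> steps (\<lambda>u j. w (u + x) j) \<xi>' (- int n) n v"
    by (auto simp: unresolved_def)
  have "steps (\<lambda>u j. w (u + x) j) \<xi> (- int n) n v = steps w (\<lambda>u. \<xi> (u - x)) (- int n) n (v + x)" for \<xi>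
    using steps_shift[of w x "\<lambda>u. \<xi> (u - x)"] by simp
  then show "unresolved n (v + x) w" using neq unfolding unresolved_def by metis
qed

lemma final_state_shift: "final_state (v + x) w = final_state v (\<lambda>u j. w (u + x) j)"
  unfolding final_state_def unresolved_shift
  using steps_shift[of w x "\<lambda>_. undefined"] by simp

lemma coupling_time_ge:
  assumes "unresolved n v w"
  shows "enat n \<le> coupling_time F F' f w v"
  unfolding coupling_time_def
proof (rule Inf_greatest)
  fix t assume "t \<in> {enat i | i. \<forall>\<xi> \<xi>'. pca_evolution F F' f w \<xi> (- int i) v 0 = pca_evolution F F' f w \<xi>' (- int i) v 0}"
  then obtain i where t: "t = enat i" and "\<not> unresolved i v w"
    by (auto simp: unresolved_def pca_evolution_def)
  moreover have "unresolved m v w" if "m \<le> n" for m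
    using that assms by (induction rule: inc_induct) (auto dest: unresolved_Suc)
  ultimately have "n \<le> i" by (meson nat_le_linear)
  then show "enat n \<le> t" using t by simp
qed

lemma steps_cone:
  assumes "\<And>i. i \<in> cone L v n \<Longrightarrow> \<omega> i = \<omega>' i"
  shows "steps (letters \<omega>) \<xi> (- int n) n v = steps (letters \<omega>') \<xi> (- int n) n v"
  by (rule steps_cone_cong) (use assms in \<open>auto simp: letters_def cone_def\<close>)

lemma unresolved_cone:
  assumes "\<And>i. i \<in> cone L v n \<Longrightarrow> \<omega> i = \<omega>' i"
  shows "unresolved n v (letters \<omega>) = unresolved n v (letters \<omega>')"
proof -
  have "steps (letters \<omega>) \<xi> (- int n) n v = steps (letters \<omega>') \<xi> (- int n) n v" for \<xi>
    by (rule steps_cone) (rule assms)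
  then show ?thesis by (simp add: unresolved_def)
qed

lemma measurable_steps:
  fixes q :: "('a \<times> 'm::finite) pmf"
  shows "(\<lambda>\<omega>. steps (letters \<omega>) \<xi> (- int n) n v) \<in> iid q \<rightarrow>\<^sub>M count_space UNIV"
  by (rule measurable_depends_on[OF finite_cone], rule depends_onI) (rule steps_cone)

lemma prob_unresolved_le:
  fixes q :: "('a \<times> 'm::finite) pmf"
  assumes noise: "pca_noise M p W" and fst_q: "map_pmf fst q = p"
    and ct: "(\<lambda>x. coupling_time F F' f (\<lambda>u j. W u j x) v) \<in> M \<rightarrow>\<^sub>M count_space UNIV"
  shows "measure (iid q) {\<omega>. unresolved n v (letters \<omega>)} \<le>
    measure M {x \<in> space M. ereal (real n) \<le> ereal_of_enat (coupling_time F F' f (\<lambda>u j. W u j x) v)}"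
proof -
  interpret prob_space M using noise by (simp add: pca_noise_def iid_process_def)
  have "measure (iid q) {\<omega>. unresolved n v (letters \<omega>)} = prob {x \<in> space M. unresolved n v (\<lambda>u j. W u j x)}"
  proof (rule prob_noise_eq_prob_letters[OF noise fst_q finite_cone[of L v n], symmetric])
    fix w w' :: "int ^ 'd \<Rightarrow> int \<Rightarrow> 'a" assume "\<And>u i. (u, i) \<in> cone L v n \<Longrightarrow> w u i = w' u i"
    then have "steps w \<xi> (- int n) n v = steps w' \<xi> (- int n) n v" for \<xi>
      by (intro steps_cone_cong) (auto simp: cone_def)
    then show "unresolved n v w = unresolved n v w'" by (simp add: unresolved_def)
  qed
  also have "\<dots> \<le> prob {x \<in> space M. ereal (real n) \<le> ereal_of_enat (coupling_time F F' f (\<lambda>u j. W u j x) v)}"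
  proof (rule finite_measure_mono)
    show "{x \<in> space M. ereal (real n) \<le> ereal_of_enat (coupling_time F F' f (\<lambda>u j. W u j x) v)} \<in> events"
      using measurable_compose[OF ct, of "\<lambda>t. ereal (real n) \<le> ereal_of_enat t" "count_space UNIV"]
      by (simp add: pred_def)
    show "{x \<in> space M. unresolved n v (\<lambda>u j. W u j x)} \<subseteq>
        {x \<in> space M. ereal (real n) \<le> ereal_of_enat (coupling_time F F' f (\<lambda>u j. W u j x) v)}"
    proof safe
      fix x assume "unresolved n v (\<lambda>u j. W u j x)"
      from coupling_time_ge[OF this]
      show "ereal (real n) \<le> ereal_of_enat (coupling_time F F' f (\<lambda>u j. W u j x) v)"
        by (cases "coupling_time F F' f (\<lambda>u j. W u j x) v") auto
    qed
  qed
  finally show ?thesis .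
qed

text \<open>The noise is stationary in time: running \<open>n\<close> steps forward from time 0 has the same law as
  running from time \<open>- n\<close> up to time 0. Only the latter converges pointwise.\<close>

lemma prob_steps_time_shift:
  fixes q :: "('a \<times> 'm::finite) pmf"
  assumes B: "finite B"
  shows "measure (iid q) {\<omega>. \<forall>v\<in>B. steps (letters \<omega>) \<xi> 0 n v \<in> A v} =
    measure (iid q) {\<omega>. \<forall>v\<in>B. steps (letters \<omega>) \<xi> (- int n) n v \<in> A v}" (is "measure _ ?E = measure _ ?E'")
proof -
  let ?g = "\<lambda>(v :: int ^ 'd, i :: int). (v, i - int n)"
  have letters_g: "letters (\<lambda>i. \<omega> (?g i)) = (\<lambda>u j. letters \<omega> u (j + (- int n)))" for \<omega> :: "_ \<Rightarrow> 'a \<times> 'm"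
    by (simp add: letters_def)
  have steps_g: "steps (letters (\<lambda>i. \<omega> (?g i))) \<xi> 0 n = steps (letters \<omega>) \<xi> (- int n) n" for \<omega> :: "_ \<Rightarrow> 'a \<times> 'm"
    unfolding letters_g steps_time_shift by simp
  have "?E' = (\<lambda>\<omega> i. \<omega> (?g i)) -` ?E \<inter> space (iid q)"
    by (simp add: vimage_def steps_g)
  also have "measure (iid q) \<dots> = measure (distr (iid q) (iid q) (\<lambda>\<omega> i. \<omega> (?g i))) ?E"
  proof (rule measure_distr[symmetric])
    show "(\<lambda>\<omega> i. \<omega> (?g i)) \<in> iid q \<rightarrow>\<^sub>M iid q"
      by (rule measurable_to_iid) (rule measurable_iid_component)
    have "depends_on (noise_window n B) (\<lambda>\<omega> :: _ \<Rightarrow> 'a \<times> 'm. \<forall>v\<in>B. steps (letters \<omega>) \<xi> 0 n v \<in> A v)"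
    proof (rule depends_onI)
      fix \<omega> \<omega>' :: "(int ^ 'd) \<times> int \<Rightarrow> 'a \<times> 'm" assume eq: "\<And>i. i \<in> noise_window n B \<Longrightarrow> \<omega> i = \<omega>' i"
      have "steps (letters \<omega>) \<xi> 0 n v = steps (letters \<omega>') \<xi> 0 n v" if "v \<in> B" for v
        by (rule steps_noise_window[OF that]) (simp add: letters_def eq)
      then show "(\<forall>v\<in>B. steps (letters \<omega>) \<xi> 0 n v \<in> A v) = (\<forall>v\<in>B. steps (letters \<omega>') \<xi> 0 n v \<in> A v)"
        by simp
    qed
    then show "?E \<in> sets (iid q)"
      by (intro sets_iid_Collect measurable_depends_on[OF finite_noise_window[OF B]])
  qed
  also have "distr (iid q) (iid q) (\<lambda>\<omega> i. \<omega> (?g i)) = iid q"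
    by (rule distr_iid_reindex) (auto simp: inj_on_def)
  finally show ?thesis by simp
qed

lemma expectation_cylinder_evolution:
  fixes q :: "('a \<times> 'm::finite) pmf"
  assumes noise: "pca_noise M p W" and fst_q: "map_pmf fst q = p" and B: "finite B"
  shows "integral\<^sup>L (field_law M (count_space UNIV)
      (\<lambda>v x. pca_evolution F F' f (\<lambda>u j. W u j x) \<xi> 0 v (int n))) (\<lambda>y. of_bool (\<forall>v\<in>B. y v \<in> A v) :: real) =
    measure (iid q) {\<omega>. \<forall>v\<in>B. steps (letters \<omega>) \<xi> (- int n) n v \<in> A v}"
proof -
  let ?S = "field_space (count_space UNIV) :: (int ^ 'd \<Rightarrow> 's) measure"
  let ?C = "{y. \<forall>v\<in>B. y v \<in> A v}"
  let ?X = "\<lambda>v x. pca_evolution F F' f (\<lambda>u j. W u j x) \<xi> 0 v (int n)"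
  have em: "?X v \<in> M \<rightarrow>\<^sub>M count_space UNIV" for v
  proof -
    have "depends_on (noise_window n {v}) (\<lambda>\<eta>. steps (\<lambda>u j. \<eta> (u, j)) \<xi> 0 n v)"
      by (rule depends_onI, rule steps_noise_window[of _ "{v}"]) simp_all
    from measurable_depends_on[OF finite_noise_window this]
    have "(\<lambda>\<eta>. steps (\<lambda>u j. \<eta> (u, j)) \<xi> 0 n v) \<in> iid p \<rightarrow>\<^sub>M count_space UNIV" by simp
    from measurable_compose[OF pca_noise_law(1)[OF noise] this]
    show ?thesis by (simp add: pca_evolution_def)
  qed
  have efm: "(\<lambda>x v. ?X v x) \<in> M \<rightarrow>\<^sub>M ?S"
    unfolding field_space_def
    by (rule measurable_PiM_single'[where f="?X", OF em]) auto
  have emb: "prod_emb UNIV (\<lambda>_. count_space UNIV) B (Pi\<^sub>E B A) = ?C"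
    by (auto simp: prod_emb_def)
  have C_sets: "?C \<in> sets ?S"
    unfolding emb[symmetric] field_space_def using B by (intro sets_PiM_I) auto
  have "integral\<^sup>L (field_law M (count_space UNIV) ?X) (\<lambda>y. of_bool (\<forall>v\<in>B. y v \<in> A v) :: real)
      = measure (field_law M (count_space UNIV) ?X) ?C"
  proof -
    have "(\<lambda>y. of_bool (\<forall>v\<in>B. y v \<in> A v)) = (indicator ?C :: _ \<Rightarrow> real)"
      by (auto simp: indicator_def)
    moreover have "space (field_law M (count_space UNIV) ?X) = UNIV"
      by (simp add: field_law_def field_space_def space_PiM)
    ultimately show ?thesis by simp
  qed
  also have "\<dots> = measure M {x \<in> space M. \<forall>v\<in>B. steps (\<lambda>u j. W u j x) \<xi> 0 n v \<in> A v}"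
    unfolding field_law_def
    by (subst measure_distr[OF efm C_sets]) (auto simp: pca_evolution_def intro!: arg_cong[where f="measure M"])
  also have "\<dots> = measure (iid q) {\<omega>. \<forall>v\<in>B. steps (letters \<omega>) \<xi> 0 n v \<in> A v}"
  proof (rule prob_noise_eq_prob_letters[OF noise fst_q finite_noise_window[OF B, of n]])
    fix w w' :: "int ^ 'd \<Rightarrow> int \<Rightarrow> 'a" assume eq: "\<And>v i. (v, i) \<in> noise_window n B \<Longrightarrow> w v i = w' v i"
    have "steps w \<xi> 0 n v = steps w' \<xi> 0 n v" if "v \<in> B" for v
      by (rule steps_noise_window[OF that]) (rule eq)
    then show "(\<forall>v\<in>B. steps w \<xi> 0 n v \<in> A v) = (\<forall>v\<in>B. steps w' \<xi> 0 n v \<in> A v)" by simp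
  qed
  also have "\<dots> = measure (iid q) {\<omega>. \<forall>v\<in>B. steps (letters \<omega>) \<xi> (- int n) n v \<in> A v}"
    by (rule prob_steps_time_shift[OF B])
  finally show ?thesis .
qed

end

theorem theorem2p1:
  fixes F F' :: "(int ^ 'd::finite) set"
    and f :: "(int ^ 'd \<Rightarrow> 's::finite) \<Rightarrow> (int ^ 'd \<Rightarrow> 'a::finite) \<Rightarrow> 's"
    and p :: "'a pmf"
    and M :: "'w measure"
    and W :: "int ^ 'd \<Rightarrow> int \<Rightarrow> 'w \<Rightarrow> 'a"
    and \<mu> :: "(int ^ 'd \<Rightarrow> 's) measure"
  assumes "finite F" and "finite F'"
    and "pca_noise M p W"
    and "exponentially_uniformly_ergodic_pca M F F' f W"
    and "limiting_distribution M F F' f W \<mu>"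
  shows "\<exists>(T :: nat set) (N :: (int ^ 'd \<Rightarrow> nat) measure) (Y :: int ^ 'd \<Rightarrow> (int ^ 'd \<Rightarrow> nat) \<Rightarrow> nat)
           (N' :: (int ^ 'd \<Rightarrow> 's) measure) (X :: int ^ 'd \<Rightarrow> (int ^ 'd \<Rightarrow> 's) \<Rightarrow> 's)
           (\<phi> :: (int ^ 'd \<Rightarrow> nat) \<Rightarrow> int ^ 'd \<Rightarrow> 's).
           finite T \<and>
           iid_process N (count_space T) Y \<and>
           random_field N' (count_space UNIV) X \<and>
           field_law N' (count_space UNIV) X = \<mu> \<and>
           finitary_coding N (count_space T) Y N' (count_space UNIV) X \<phi> \<and>
           stretched_exponential_tails N
             (\<lambda>x. coding_radius (field_law N (count_space T) Y) \<phi> (\<lambda>v. Y v x))"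
proof -
  obtain L where L: "\<And>u. u \<in> F \<union> F' \<Longrightarrow> norm1 u \<le> L"
  proof -
    have "finite (norm1 ` (F \<union> F'))" using assms(1,2) by simp
    then show thesis using that by (metis finite_nat_set_iff_bounded_le imageI)
  qed
  interpret pca: pca_rule F F' f L by unfold_locales (rule L)
  \<comment> \<open>A uniform mark is attached to every noise variable; only the marks at time 1 are read.\<close>
  define q :: "('a \<times> bool option) pmf" where "q = pair_pmf p (pmf_of_set UNIV)"
  have fst_q: "map_pmf fst q = p" by (simp add: q_def map_fst_pair_pmf)
  define U where "U n v \<omega> = pca.unresolved n v (letters \<omega>)"
    for n v and \<omega> :: "(int ^ 'd) \<times> int \<Rightarrow> 'a \<times> bool option"
  define h where "h v \<omega> = pca.final_state v (letters \<omega>)"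
    for v and \<omega> :: "(int ^ 'd) \<times> int \<Rightarrow> 'a \<times> bool option"

  obtain C c where C: "0 < C" "0 < c" and tail: "\<And>r. 0 \<le> r \<Longrightarrow>
      measure M {x \<in> space M. ereal r \<le> ereal_of_enat (coupling_time F F' f (\<lambda>u j. W u j x) 0)} \<le> C * exp (- c * r)"
    and ct: "(\<lambda>x. coupling_time F F' f (\<lambda>u j. W u j x) 0) \<in> M \<rightarrow>\<^sub>M count_space UNIV"
    using assms(4) unfolding exponentially_uniformly_ergodic_pca_def exponential_tails_def by blast
  have U_tail: "measure (iid q) {\<omega>. U n 0 \<omega>} \<le> C * exp (- c * real n)" for n
    unfolding U_def by (rule order_trans[OF pca.prob_unresolved_le[OF assms(3) fst_q ct] tail]) simp
  obtain n0 where n0: "\<And>n. n0 < n \<Longrightarrow>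
      real ((2 * (L * n) + 1) ^ CARD('d)) * (C * exp (- c * (n - 1))) \<le> 1 / (18 * (real n)\<^sup>2)"
    using exponential_beats_polynomial[of c C L "CARD('d)"] C by auto

  \<comment> \<open>Any coordinate axis can serve for the matching.\<close>
  interpret layered_factor q snd L U h "undefined :: 'd" n0 C c
  proof unfold_locales
    show "depends_on (cone L v n) (U n v)" for v n
      unfolding U_def by (rule depends_onI) (rule pca.unresolved_cone)
    show "U n v \<omega>" if "U (Suc n) v \<omega>" for n v \<omega>
      using that pca.unresolved_Suc unfolding U_def by blast
    show "h v \<omega> = h v \<omega>'" if nU: "\<not> U n v \<omega>" and eq: "\<And>i. i \<in> cone L v n \<Longrightarrow> \<omega> i = \<omega>' i" for n v \<omega> \<omega>'
    proof -
      have "\<not> U n v \<omega>'" using pca.unresolved_cone[OF eq] nU by (simp add: U_def)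
      then have "h v \<omega>' = pca.steps (letters \<omega>') undefined (- int n) n v"
        unfolding U_def h_def by (rule pca.final_state_eq)
      moreover have "h v \<omega> = pca.steps (letters \<omega>) undefined (- int n) n v"
        using nU unfolding U_def h_def by (rule pca.final_state_eq)
      ultimately show ?thesis using pca.steps_cone[OF eq] by simp
    qed
    show "U n (v + u) \<omega> = U n v (shift_field u \<omega>)" for n v u \<omega>
      unfolding U_def letters_shift by (rule pca.unresolved_shift)
    show "h (v + u) \<omega> = h v (shift_field u \<omega>)" for v u \<omega>
      unfolding h_def letters_shift by (rule pca.final_state_shift)
    show "measure_pmf.prob q {b. snd b = m} = 1 / 3" for m
    proof -
      have "measure_pmf.prob q {b. snd b = m} = measure_pmf.prob (map_pmf snd q) {m}"
        by (simp add: vimage_def)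
      also have "\<dots> = 1 / 3"
        by (simp add: q_def map_snd_pair_pmf measure_pmf_single card_UNIV_option)
      finally show ?thesis .
    qed
  qed (use C U_tail n0 in auto)

  have \<mu>: "prob_space \<mu>" "sets \<mu> = sets (field_space (count_space UNIV))"
    and conv: "\<And>\<xi>. weakly_converges config_topology
        (\<lambda>n. field_law M (count_space UNIV) (\<lambda>v x. pca_evolution F F' f (\<lambda>u j. W u j x) \<xi> 0 v (int n))) \<mu>"
    using assms(5) by (auto simp: limiting_distribution_def)
  let ?\<xi> = "undefined :: int ^ 'd \<Rightarrow> 's"
  have "distr (iid q) (field_space (count_space UNIV)) (\<lambda>\<omega>. factor (recoded \<omega>)) = \<mu>"
  proof (rule law_factor_eqI[OF \<mu>, where X="\<lambda>n v \<omega>. pca.steps (letters \<omega>) ?\<xi> (- int n) n v"])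
    show "(\<lambda>\<omega>. pca.steps (letters \<omega>) ?\<xi> (- int n) n v) \<in> iid q \<rightarrow>\<^sub>M count_space UNIV" for n v
      by (rule pca.measurable_steps)
    show "pca.steps (letters \<omega>) ?\<xi> (- int n) n v = h v \<omega>" if "\<not> U m v \<omega>" "m \<le> n" for v \<omega> n m
      using pca.resolved_stable[of m v "letters \<omega>" n] pca.final_state_eq[of m v "letters \<omega>"] that
      unfolding U_def h_def by metis
    fix B :: "(int ^ 'd) set" and A :: "int ^ 'd \<Rightarrow> 's set"
    assume B: "finite B"
    let ?g = "\<lambda>y. of_bool (\<forall>v\<in>B. y v \<in> A v) :: real"
    have "continuous_map config_topology euclideanreal ?g"
      by (rule continuous_map_cylinder[OF B])
    moreover have "bounded (?g ` topspace config_topology)"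
      by (rule bounded_subset[of "{0, 1}"]) auto
    ultimately have "(\<lambda>n. integral\<^sup>L (field_law M (count_space UNIV)
        (\<lambda>v x. pca_evolution F F' f (\<lambda>u j. W u j x) ?\<xi> 0 v (int n))) ?g) \<longlonglongrightarrow> integral\<^sup>L \<mu> ?g"
      using conv[of ?\<xi>] unfolding weakly_converges_def by simp
    moreover have "integral\<^sup>L \<mu> ?g = measure \<mu> {y. \<forall>v\<in>B. y v \<in> A v}"
    proof -
      have "?g = indicator {y. \<forall>v\<in>B. y v \<in> A v}"
        by (auto simp: indicator_def)
      moreover have "space \<mu> = UNIV"
        using sets_eq_imp_space_eq[OF \<mu>(2)] by (simp add: field_space_def space_PiM)
      ultimately show ?thesis by simp
    qed
    ultimately show "(\<lambda>n. prob {\<omega>. \<forall>v\<in>B. pca.steps (letters \<omega>) ?\<xi> (- int n) n v \<in> A v})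
        \<longlonglongrightarrow> measure \<mu> {y. \<forall>v\<in>B. y v \<in> A v}"
      unfolding pca.expectation_cylinder_evolution[OF assms(3) fst_q B] by simp
  qed
  note coding = finitary_coding_factor[OF \<mu> this]
  have "stretched_exponential_tails code_law
      (\<lambda>x. coding_radius (field_law code_law (count_space codes) (\<lambda>v y. y v)) factor (\<lambda>v. x v))"
    using coding_radius_tails by (simp add: field_law_code_law)
  with finite_codes iid_process_code_law coding show ?thesis by blast
qed

end
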